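(* Let $s\in[\frac12,1)$ and let $\mathcal I$ be a translation invariant, positively $1$-homogeneous nonlocal operator elliptic with respect to $\mathcal{K}_s$ (see context). Let $u$ be a non-negative viscosity solution to $$-\mathcal I u+u^q|\nabla u|^m=0\quad\text{in }\mathbb{R}^n,$$ for some $q\geq0$, $m\geq0$ with $q+m>1$, and suppose $|u(x)|\leq M(1+|x|)^\gamma$ for all $x\in\mathbb{R}^n$, for some constant $M$ and some $\gamma<1$. Then $u$ is necessarily a constant. In particular, if $s\in(\frac12,1)$, $m>1$, and $\mathcal I_{\rm sym}$ is a translation invariant, positively $1$-homogeneous nonlocal operator elliptic with respect to $\mathcal{K}_{\rm sym}$, then there exists no non-negative viscosity solution $u$, other than constants, to $$-\mathcal I_{\rm sym}u+|\nabla u|^m=0\quad\text{in }\mathbb{R}^n$$ satisfying, for some constant $M$ and some $\gamma<2s$, both $|u(x)|\leq M(1+|x|)^\gamma$ for all $x\in\mathbb{R}^n$ and $\limsup_{|x|\to\infty}\frac{|u(x)|}{|x|^\gamma}>0$.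
   Context: Fix $s\in(0,1)$ and $0<\lambda\leq\Lambda$. $\mathcal{K}_s=\mathcal{K}_s(\lambda,\Lambda)$ is the family of measurable kernels $K:\mathbb{R}^n\setminus\{0\}\to[0,\infty)$ with $\frac{\lambda}{|z|^{n+2s}}\leq K(z)\leq\frac{\Lambda}{|z|^{n+2s}}$ for $z\neq0$ (no symmetry is assumed); $\mathcal{K}_{\rm sym}$ is the subclass of those with $K(z)=K(-z)$ for all $z\neq0$. With $B$ the unit ball centered at $0$, for $K\in\mathcal{K}_s$ put $$L_Ku(x)=\int_{\mathbb{R}^n}\big[u(x+z)-u(x)-1_{\{2s\in[1,2)\}}1_B(z)\nabla u(x)\cdot z\big]K(z)\,dz .$$ Let $\omega_s(z)=(1+|z|)^{-n-2s}$, and let $L^1(\omega_s)$ be the functions integrable against $\omega_s$. A nonlocal operator $\mathcal I$ is translation invariant if $\mathcal I u_h(x)=\mathcal I u(x+h)$ for all $x,h$, where $u_h=u(\cdot+h)$. It is elliptic with respect to a class $\mathcal{K}$ ($=\mathcal{K}_s$ or $\mathcal{K}_{\rm sym}$) if $$\inf_{K\in\mathcal{K}}(L_Ku(x)-L_Kv(x))\leq\mathcal I u(x)-\mathcal I v(x)\leq\sup_{K\in\mathcal{K}}(L_Ku(x)-L_Kv(x))$$ whenever $u,v\in C^{1,1}(x)\cap L^1(\omega_s)$ (where $C^{1,1}(x)$ means $C^{1,1}$ at the point $x$). Viscosity solutions: let $\Omega\subseteq\mathbb{R}^n$ be open and consider $-\mathcal I u+H(x,u,\nabla u)=0$ in $\Omega$,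 with $H$ continuous. A measurable $u\in L^1(\omega_s)$, upper (resp. lower) semicontinuous in $\bar\Omega$, is a viscosity subsolution (resp. supersolution) if for each $x_0\in\Omega$ and $\varphi\in C^2(B_r(x_0))$, for some $r>0$, with $u(x_0)=\varphi(x_0)$ and $u\leq\varphi$ (resp. $u\geq\varphi$) in $B_r(x_0)$, one has $-\mathcal I v(x_0)+H(x_0,u(x_0),\nabla\varphi(x_0))\leq0$ (resp. $\geq0$), where $v=\varphi$ in $B_r(x_0)$ and $v=u$ elsewhere. A viscosity solution is both a sub- and a supersolution. (The Hamiltonian $r^q|p|^m$ is evaluated only at $r\ge 0$.) *)

theory Defs
  imports "HOL-Analysis.Analysis"
begin

text \<open>
  Throughout, \<open>'a :: euclidean_space\<close> plays the role of $R^n$ with $n = $ \<open>DIM('a)\<close>.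
  "Measurable" means Lebesgue measurable.
\<close>

text \<open>Kernels are total functions here; nothing is required of their value at the origin, which
  never contributes to the integral defining the operator.\<close>

definition kernels :: "real \<Rightarrow> real \<Rightarrow> real \<Rightarrow> ('a::euclidean_space \<Rightarrow> real) set" where
  "kernels s lam Lam =
    {K. K \<in> borel_measurable (lebesgue_on (UNIV - {0})) \<and>
        (\<forall>z. z \<noteq> 0 \<longrightarrow>
           lam / norm z powr (real DIM('a) + 2 * s) \<le> K z \<and>
           K z \<le> Lam / norm z powr (real DIM('a) + 2 * s))}"

definition kernels_sym :: "real \<Rightarrow> real \<Rightarrow> real \<Rightarrow> ('a::euclidean_space \<Rightarrow> real) set" where
  "kernels_sym s lam Lam = {K \<in> kernels s lam Lam. \<forall>z. z \<noteq> 0 \<longrightarrow> K z = K (- z)}"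

definition grad :: "('a::euclidean_space \<Rightarrow> real) \<Rightarrow> 'a \<Rightarrow> 'a" where
  "grad u x = (THE g. GDERIV u x :> g)"

definition nonlocal_op ::
  "real \<Rightarrow> ('a::euclidean_space \<Rightarrow> real) \<Rightarrow> ('a \<Rightarrow> real) \<Rightarrow> 'a \<Rightarrow> real" where
  "nonlocal_op s K u x =
    integral\<^sup>L lebesgue (\<lambda>z.
      (u (x + z) - u x
        - (if 2 * s \<in> {1..<2} then 1 else 0) * indicator (ball 0 1) z * (grad u x \<bullet> z)) * K z)"

definition weight :: "real \<Rightarrow> 'a::euclidean_space \<Rightarrow> real" where
  "weight s z = (1 + norm z) powr (- real DIM('a) - 2 * s)"

definition L1_weight :: "real \<Rightarrow> ('a::euclidean_space \<Rightarrow> real) set" where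
  "L1_weight s = {u. integrable lebesgue (\<lambda>z. u z * weight s z)}"

text \<open>The pointwise class $C^{1,1}(x)$: the vector \<open>g\<close> is then the gradient of \<open>u\<close> at \<open>x\<close>.\<close>

definition C11_at :: "'a::euclidean_space \<Rightarrow> ('a \<Rightarrow> real) set" where
  "C11_at x = {u. \<exists>g C r. 0 < r \<and>
      (\<forall>z\<in>ball 0 r. \<bar>u (x + z) - u x - g \<bullet> z\<bar> \<le> C * (norm z)\<^sup>2)}"

text \<open>
  A nonlocal operator \<open>I\<close> is a total function, but \<open>I u x\<close> is meaningful only for
  \<open>u \<in> C11_at x \<inter> L1_weight s\<close>.  The three structural properties below constrain \<open>I\<close> only
  there.
\<close>

type_synonym 'a operator = "('a \<Rightarrow> real) \<Rightarrow> 'a \<Rightarrow> real"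

definition translation_invariant :: "real \<Rightarrow> 'a::euclidean_space operator \<Rightarrow> bool" where
  "translation_invariant s I \<longleftrightarrow>
    (\<forall>u x h. u \<in> C11_at (x + h) \<inter> L1_weight s \<longrightarrow> I (\<lambda>y. u (y + h)) x = I u (x + h))"

definition pos_homogeneous :: "real \<Rightarrow> 'a::euclidean_space operator \<Rightarrow> bool" where
  "pos_homogeneous s I \<longleftrightarrow>
    (\<forall>u x c. u \<in> C11_at x \<inter> L1_weight s \<and> 0 < c \<longrightarrow> I (\<lambda>y. c * u y) x = c * I u x)"

text \<open>The extrema are taken in the extended reals, so that they need no boundedness side
  condition.\<close>

definition elliptic ::
  "real \<Rightarrow> ('a::euclidean_space \<Rightarrow> real) set \<Rightarrow> 'a operator \<Rightarrow> bool" where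
  "elliptic s \<K> I \<longleftrightarrow>
    (\<forall>u v x. u \<in> C11_at x \<inter> L1_weight s \<and> v \<in> C11_at x \<inter> L1_weight s \<longrightarrow>
       (INF K\<in>\<K>. ereal (nonlocal_op s K u x - nonlocal_op s K v x)) \<le> ereal (I u x - I v x) \<and>
       ereal (I u x - I v x) \<le> (SUP K\<in>\<K>. ereal (nonlocal_op s K u x - nonlocal_op s K v x)))"

definition usc_on :: "'a::topological_space set \<Rightarrow> ('a \<Rightarrow> real) \<Rightarrow> bool" where
  "usc_on S f \<longleftrightarrow> (\<forall>x\<in>S. \<forall>a. f x < a \<longrightarrow> (\<forall>\<^sub>F y in at x within S. f y < a))"

definition lsc_on :: "'a::topological_space set \<Rightarrow> ('a \<Rightarrow> real) \<Rightarrow> bool" where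
  "lsc_on S f \<longleftrightarrow> (\<forall>x\<in>S. \<forall>a. a < f x \<longrightarrow> (\<forall>\<^sub>F y in at x within S. a < f y))"

text \<open>$C^2$ on an open set, with gradient \<open>g\<close> and Hessian \<open>D\<close>.\<close>

definition C2_on :: "'a::euclidean_space set \<Rightarrow> ('a \<Rightarrow> real) \<Rightarrow> bool" where
  "C2_on S f \<longleftrightarrow>
    (\<exists>(g :: 'a \<Rightarrow> 'a) (D :: 'a \<Rightarrow> 'a \<Rightarrow>\<^sub>L 'a).
       (\<forall>x\<in>S. GDERIV f x :> g x \<and> (g has_derivative blinfun_apply (D x)) (at x)) \<and>
       continuous_on S D)"

definition glue ::
  "('a::euclidean_space \<Rightarrow> real) \<Rightarrow> 'a \<Rightarrow> real \<Rightarrow> ('a \<Rightarrow> real) \<Rightarrow> 'a \<Rightarrow> real" where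
  "glue \<phi> x r u = (\<lambda>y. if y \<in> ball x r then \<phi> y else u y)"

text \<open>
  Viscosity sub- and supersolutions of \<open>- I u + H(x, u, grad u) = 0\<close> in \<open>\<Omega>\<close>.  A function that is
  $C^2$ on an open ball need not be integrable there, so the test is imposed exactly for those
  test functions for which the glued function is in \<open>L1_weight s\<close>, i.e. for which the operator
  is defined at the contact point.
\<close>

definition visc_subsolution ::
  "real \<Rightarrow> 'a::euclidean_space operator \<Rightarrow> ('a \<Rightarrow> real \<Rightarrow> 'a \<Rightarrow> real) \<Rightarrow> 'a set \<Rightarrow>
   ('a \<Rightarrow> real) \<Rightarrow> bool" where
  "visc_subsolution s I H \<Omega> u \<longleftrightarrow>
    u \<in> L1_weight s \<and> usc_on (closure \<Omega>) u \<and>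
    (\<forall>x0\<in>\<Omega>. \<forall>r>0. \<forall>\<phi>.
       C2_on (ball x0 r) \<phi> \<and> u x0 = \<phi> x0 \<and> (\<forall>y\<in>ball x0 r. u y \<le> \<phi> y) \<and>
       glue \<phi> x0 r u \<in> L1_weight s \<longrightarrow>
       - I (glue \<phi> x0 r u) x0 + H x0 (u x0) (grad \<phi> x0) \<le> 0)"

definition visc_supersolution ::
  "real \<Rightarrow> 'a::euclidean_space operator \<Rightarrow> ('a \<Rightarrow> real \<Rightarrow> 'a \<Rightarrow> real) \<Rightarrow> 'a set \<Rightarrow>
   ('a \<Rightarrow> real) \<Rightarrow> bool" where
  "visc_supersolution s I H \<Omega> u \<longleftrightarrow>
    u \<in> L1_weight s \<and> lsc_on (closure \<Omega>) u \<and>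
    (\<forall>x0\<in>\<Omega>. \<forall>r>0. \<forall>\<phi>.
       C2_on (ball x0 r) \<phi> \<and> u x0 = \<phi> x0 \<and> (\<forall>y\<in>ball x0 r. \<phi> y \<le> u y) \<and>
       glue \<phi> x0 r u \<in> L1_weight s \<longrightarrow>
       0 \<le> - I (glue \<phi> x0 r u) x0 + H x0 (u x0) (grad \<phi> x0))"

definition visc_solution ::
  "real \<Rightarrow> 'a::euclidean_space operator \<Rightarrow> ('a \<Rightarrow> real \<Rightarrow> 'a \<Rightarrow> real) \<Rightarrow> 'a set \<Rightarrow>
   ('a \<Rightarrow> real) \<Rightarrow> bool" where
  "visc_solution s I H \<Omega> u \<longleftrightarrow> visc_subsolution s I H \<Omega> u \<and> visc_supersolution s I H \<Omega> u"

text \<open>Real powers of non-negative numbers with $0^0 = 1$, so that the Hamiltonian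
  $r^q |p|^m$ is continuous for all $q, m \ge 0$; in contrast, \<open>0 powr 0 = 0\<close>.\<close>

definition rpow :: "real \<Rightarrow> real \<Rightarrow> real" where
  "rpow t a = (if a = 0 then 1 else t powr a)"

end

theory Submission
  imports Defs
begin

text \<open>
  For sublinear growth, double the variables multiplicatively: with \<open>v = 1 + u\<close>, maximise the
  quotient of \<open>v x\<close> and \<open>v y * exp (L * sqrt (norm (x - y))) * (1 + (norm x)\<^sup>2 / \<rho>\<^sup>2)\<close>.  If \<open>u\<close> is
  not constant, the maximum exceeds 1 for some small \<open>L\<close> and all large \<open>\<rho>\<close>.  At a maximum point
  positive homogeneity lets one subtract the equations of \<open>u\<close> at \<open>x\<close> and \<open>y\<close> after division by
  \<open>v x\<close> and \<open>v y\<close>.  The drift caused by asymmetric kernels then cancels up to the gradient of the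
  logarithmic penalty, which is at most \<open>1 / \<rho>\<close>; every error carries a negative power of \<open>\<rho>\<close>, while the
  concavity of the square root gives a strictly negative contribution that decays only like a power
  of \<open>ln \<rho>\<close>.  Working with \<open>ln v\<close> instead of \<open>u\<close> is what reaches every exponent \<open>\<gamma> < 1\<close>: \<open>ln v\<close> grows
  logarithmically, so that the maximum points are at distance at most a power of \<open>ln \<rho>\<close>.

  For symmetric kernels and \<open>\<gamma> \<ge> 1\<close> there is no drift.  Touching \<open>u\<close> from below by a bump of bounded
  height and width \<open>R\<close> bounds a weighted mean of \<open>u\<close> at scale \<open>R\<close> by \<open>R powr (- 2 * s) + R powr (- m)\<close>,
  and touching it from above by a paraboloid turns this bound into \<open>u x = o(norm x powr \<gamma>)\<close>,
  contradicting the lower bound on the growth.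
\<close>

section \<open>Integrals of the model kernel\<close>

text \<open>The square root is singled out by the Hamiltonian. With \<open>f = L * sqrt t\<close>,
  the product of \<open>f\<close> and its slope is \<open>L^2 / 2\<close> at every distance t. The
  gain from superlinear growth of the Hamiltonian is governed by this product, so it absorbs a
  gradient error of size 1 / \<rho> whether the two contact points are close or far apart. The
  assumption s \<ge> 1/2 enters at small t, where the concavity gain is of order t^(1/2 - 2s) and
  has to dominate an error of order t^(-1/2). The limit \<gamma> < 1 comes from long jumps z: values
  of size \<rho>^\<gamma> meet a penalty that changes by the relative amount |z| / \<rho>, and the
  product has to vanish as \<rho> grows. Second derivatives of the test functions of the doubling
  argument are never estimated: their bounds come from compactness, and the radius on which they act
  is made small after all other constants are fixed.\<close>

lemma lebesgue_affine_const:
  fixes t :: "'a::euclidean_space"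
  assumes "c \<noteq> 0"
  shows "lebesgue = density (distr lebesgue lebesgue (\<lambda>x. t + c *\<^sub>R x)) (\<lambda>_. ennreal (\<bar>c\<bar> ^ DIM('a)))"
    and "(\<lambda>x. t + c *\<^sub>R x) \<in> lebesgue \<rightarrow>\<^sub>M lebesgue"
proof -
  have eq: "(\<lambda>x. t + (\<Sum>j\<in>Basis. (c * (x \<bullet> j)) *\<^sub>R j)) = (\<lambda>x. t + c *\<^sub>R x)"
    unfolding scaleR_scaleR[symmetric] scaleR_sum_right[symmetric] euclidean_representation ..
  show "lebesgue = density (distr lebesgue lebesgue (\<lambda>x. t + c *\<^sub>R x)) (\<lambda>_. ennreal (\<bar>c\<bar> ^ DIM('a)))"
    using lebesgue_affine_euclidean[of "\<lambda>_. c" t] assms by (simp add: eq)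
  show "(\<lambda>x. t + c *\<^sub>R x) \<in> lebesgue \<rightarrow>\<^sub>M lebesgue"
    using lebesgue_affine_measurable[of "\<lambda>_. c" t] assms by (simp add: eq)
qed

lemma has_bochner_integral_lebesgue_affine:
  fixes f :: "'a::euclidean_space \<Rightarrow> real"
  assumes "c \<noteq> 0" and "has_bochner_integral lebesgue f I"
  shows "has_bochner_integral lebesgue (\<lambda>x. f (t + c *\<^sub>R x)) (I / \<bar>c\<bar> ^ DIM('a))"
proof -
  let ?T = "\<lambda>x::'a. t + c *\<^sub>R x"
  have T: "?T \<in> lebesgue \<rightarrow>\<^sub>M lebesgue"
    by (rule lebesgue_affine_const(2)[OF assms(1)])
  have f: "f \<in> borel_measurable lebesgue"
    using assms(2) by (auto simp: has_bochner_integral_iff)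
  have "has_bochner_integral (density (distr lebesgue lebesgue ?T) (\<lambda>_. ennreal (\<bar>c\<bar> ^ DIM('a)))) f I"
    using assms(2) lebesgue_affine_const(1)[OF assms(1), of t] by simp
  then have "integrable (distr lebesgue lebesgue ?T) (\<lambda>x. \<bar>c\<bar> ^ DIM('a) * f x)"
    and "(\<integral>x. \<bar>c\<bar> ^ DIM('a) * f x \<partial>distr lebesgue lebesgue ?T) = I"
    using f by (auto simp: has_bochner_integral_iff integrable_density integral_density)
  then have "integrable lebesgue (\<lambda>x. \<bar>c\<bar> ^ DIM('a) * f (?T x))"
    and "(\<integral>x. \<bar>c\<bar> ^ DIM('a) * f (?T x) \<partial>lebesgue) = I"
    using T f by (auto simp: integrable_distr_eq integral_distr)
  then show ?thesis
    using assms(1) by (auto simp: has_bochner_integral_iff field_simps)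
qed

text \<open>Reflection through the origin turns the integral into its negative. A function that is
  not integrable has integral 0 by convention, which settles the remaining case.\<close>

lemma integral_lebesgue_odd:
  fixes f :: "'a::euclidean_space \<Rightarrow> real"
  assumes "\<And>x. f (- x) = - f x"
  shows "integral\<^sup>L lebesgue f = 0"
proof (cases "integrable lebesgue f")
  case True
  then have "has_bochner_integral lebesgue (\<lambda>x. f (0 + (-1) *\<^sub>R x)) (integral\<^sup>L lebesgue f / \<bar>-1\<bar> ^ DIM('a))"
    by (intro has_bochner_integral_lebesgue_affine has_bochner_integral_integrable) auto
  then have "has_bochner_integral lebesgue (\<lambda>x. - f x) (integral\<^sup>L lebesgue f)"
    using assms by simp
  then have "- integral\<^sup>L lebesgue f = integral\<^sup>L lebesgue f"
    by (auto simp: has_bochner_integral_iff)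
  then show ?thesis by simp
qed (rule not_integrable_integral_eq)

lemma AE_lebesgue_nonzero: "AE z in lebesgue. z \<noteq> (0::'a::euclidean_space)"
  by (rule AE_completion[OF AE_lborel_singleton])

text \<open>The kernel of the fractional Laplacian up to a constant; every admissible kernel lies
  between two multiples of it. Its value at the origin is 0, by the convention for
  \<open>0 powr\<close>.\<close>

definition ker :: "real \<Rightarrow> 'a::euclidean_space \<Rightarrow> real" where
  "ker s z = norm z powr (- real DIM('a) - 2 * s)"

lemma ker_nonneg [simp]: "0 \<le> ker s z"
  by (simp add: ker_def)

lemma ker_measurable [measurable]: "ker s \<in> borel_measurable borel"
  unfolding ker_def by measurable

lemma ker_measurable_lebesgue [measurable]: "ker s \<in> borel_measurable lebesgue"
  by (simp add: measurable_completion)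

lemma ker_scale: "0 < c \<Longrightarrow> ker s (c *\<^sub>R z) = c powr (- real DIM('a) - 2 * s) * ker s (z::'a::euclidean_space)"
  by (simp add: ker_def powr_mult)

lemma ker_mono:
  fixes z :: "'a::euclidean_space"
  assumes "0 \<le> s" "0 < r" "r \<le> norm z"
  shows "ker s z \<le> r powr (- real DIM('a) - 2 * s)"
  unfolding ker_def using assms by (intro powr_mono2') auto

lemma nn_integral_cball_const:
  fixes c :: real
  assumes "0 \<le> c" "0 \<le> r"
  shows "(\<integral>\<^sup>+z. ennreal (c * indicator (cball (0::'a::euclidean_space) r) z) \<partial>lborel)
     = ennreal (c * unit_ball_vol (real DIM('a)) * r ^ DIM('a))"
proof -
  have "(\<integral>\<^sup>+z. ennreal (c * indicator (cball (0::'a) r) z) \<partial>lborel)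
     = (\<integral>\<^sup>+z. ennreal c * indicator (cball (0::'a) r) z \<partial>lborel)"
    using assms by (intro nn_integral_cong) (auto simp: indicator_def)
  also have "\<dots> = ennreal c * emeasure lborel (cball (0::'a) r)"
    by (subst nn_integral_cmult_indicator) auto
  also have "\<dots> = ennreal (c * unit_ball_vol (real DIM('a)) * r ^ DIM('a))"
    using assms by (simp add: emeasure_cball ennreal_mult' mult.assoc)
  finally show ?thesis .
qed

lemma two_powr_shell:
  fixes x :: real assumes "1 \<le> x"
  obtains k :: nat where "2 ^ k \<le> x" "x \<le> 2 ^ Suc k"
proof -
  define k where "k = nat \<lfloor>log 2 x\<rfloor>"
  have l: "0 \<le> log 2 x" using assms by simp
  have "real k \<le> log 2 x" "log 2 x \<le> real (Suc k)"
    unfolding k_def using l by linarith+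
  then have "2 powr real k \<le> x" "x \<le> 2 powr real (Suc k)"
    using assms by (simp_all add: le_log_iff log_le_iff)
  then show thesis using that[of k] powr_realpow[of 2 "Suc k"] powr_realpow[of 2 k] by auto
qed

text \<open>Dyadic shells: the one at radius 2^(-k) contributes a multiple of 2^(-k (2 - 2s)), the
  one at radius 2^k a multiple of 2^(k (b - 2s)), and \<open>s < 1\<close> and
  \<open>b < 2 * s\<close> make both geometric series converge. Each shell is enlarged to a ball,
  whose volume is explicit.\<close>

lemma integrable_min_ker:
  assumes "0 \<le> s" "s < 1" "0 \<le> b" "b < 2 * s"
  shows "integrable lebesgue (\<lambda>z::'a::euclidean_space. min ((norm z)\<^sup>2) (norm z powr b) * ker s z)"
proof -
  define n where "n = real DIM('a)"
  define V where "V = unit_ball_vol n"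
  have V: "0 \<le> V" unfolding V_def n_def by simp
  let ?f = "\<lambda>z::'a. min ((norm z)\<^sup>2) (norm z powr b) * ker s z"
  \<comment> \<open>Bounds for the integrand on a shell: the increasing factor is taken at the outer
    radius, the decreasing kernel at the inner one. Hence \<open>k + 1\<close> stands in the kernel
    factor of \<open>c\<close> and in the growth factor of \<open>d\<close>.\<close>
  define c where "c k = (1/2) powr (2 * real k) * (1/2) powr ((real k + 1) * (- n - 2 * s))" for k :: nat
  define d where "d k = 2 powr ((real k + 1) * b) * 2 powr (real k * (- n - 2 * s))" for k :: nat
  define g where "g k z = c k * indicator (cball 0 ((1/2) ^ k)) z
      + d k * indicator (cball 0 (2 ^ Suc k)) z" for k and z :: 'a
  have cd: "0 \<le> c k" "0 \<le> d k" for k unfolding c_def d_def by auto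
  have point: "ennreal (?f z) \<le> (\<Sum>k. ennreal (g k z))" for z
  proof -
    have single: "ennreal (g k z) \<le> (\<Sum>k. ennreal (g k z))" for k
      using sum_le_suminf[of "\<lambda>k. ennreal (g k z)" "{k}"] by simp
    consider "z = 0" | "z \<noteq> 0" "norm z \<le> 1" | "1 \<le> norm z" by linarith
    then show ?thesis
    proof cases
      case 1 then show ?thesis by simp
    next
      case 2
      then obtain k where k: "2 ^ k \<le> 1 / norm z" "1 / norm z \<le> 2 ^ Suc k"
        using two_powr_shell[of "1 / norm z"] by auto
      have u: "norm z \<le> (1/2) ^ k" and l: "(1/2) ^ Suc k \<le> norm z"
        using k 2 by (simp_all add: field_simps power_one_over)
      have l': "(1/2) powr (real k + 1) \<le> norm z"
        using l powr_realpow[of "1/2" "Suc k"] by (simp add: add.commute del: power_Suc)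
      have "(norm z)\<^sup>2 \<le> ((1/2) ^ k)\<^sup>2"
        using u by (intro power_mono) auto
      also have "((1/2::real) ^ k)\<^sup>2 = (1/2) powr (2 * real k)"
        using powr_realpow[of "1/2::real" "2 * k"] power_even_eq[of "1/2::real" k] by simp
      finally have a: "min ((norm z)\<^sup>2) (norm z powr b) \<le> (1/2) powr (2 * real k)" by simp
      have "ker s z \<le> ((1/2) powr (real k + 1)) powr (- n - 2 * s)"
        unfolding n_def using ker_mono[OF assms(1) _ l'] by simp
      then have "ker s z \<le> (1/2) powr ((real k + 1) * (- n - 2 * s))"
        by (simp add: powr_powr)
      then have "?f z \<le> c k"
        unfolding c_def using a by (intro mult_mono) auto
      also have "c k \<le> g k z"
        using u cd by (simp add: g_def)
      finally show ?thesis using single[of k] by (meson ennreal_leI order_trans)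
    next
      case 3
      then obtain k where k: "2 ^ k \<le> norm z" "norm z \<le> 2 ^ Suc k"
        using two_powr_shell[of "norm z"] by auto
      have l: "2 powr real k \<le> norm z" and u: "norm z \<le> 2 powr (real k + 1)"
        using k by (simp_all add: powr_realpow powr_add)
      have "norm z powr b \<le> (2 powr (real k + 1)) powr b"
        using u assms by (intro powr_mono2) auto
      then have a: "min ((norm z)\<^sup>2) (norm z powr b) \<le> 2 powr ((real k + 1) * b)"
        by (simp add: powr_powr)
      have "ker s z \<le> (2 powr real k) powr (- n - 2 * s)"
        unfolding n_def using ker_mono[OF assms(1) _ l] by simp
      then have "ker s z \<le> 2 powr (real k * (- n - 2 * s))"
        by (simp add: powr_powr)
      then have "?f z \<le> d k"
        unfolding d_def using a by (intro mult_mono) auto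
      also have "d k \<le> g k z"
        using k cd by (simp add: g_def)
      finally show ?thesis using single[of k] by (meson ennreal_leI order_trans)
    qed
  qed
  define A where "A = V * (1/2) powr (- n - 2 * s)"
  define B where "B = V * 2 powr (b + n)"
  have AB: "0 \<le> A" "0 \<le> B" using V by (auto simp: A_def B_def)
  have p1: "(1/2) ^ k = (1/2::real) powr real k" and p2: "2 ^ k = (2::real) powr real k" for k :: nat
    by (simp_all add: powr_realpow)
  have cc: "c k * V * ((1/2) ^ k) ^ DIM('a) = A * ((1/2) powr (2 - 2 * s)) ^ k" for k
  proof -
    have "c k * V * ((1/2) ^ k) ^ DIM('a)
      = V * ((1/2) powr (2 * real k) * (1/2) powr ((real k + 1) * (- n - 2 * s)) * (1/2) powr (real k * n))"
      by (simp add: c_def p1 powr_power n_def mult_ac)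
    also have "\<dots> = A * ((1/2) powr ((2 - 2 * s) * real k))"
      unfolding A_def powr_add[symmetric] mult.assoc by (simp add: algebra_simps)
    finally show ?thesis by (simp add: powr_power mult.commute)
  qed
  have dd: "d k * V * (2 ^ Suc k) ^ DIM('a) = B * (2 powr (b - 2 * s)) ^ k" for k
  proof -
    have "d k * V * (2 ^ Suc k) ^ DIM('a)
      = V * (2 powr ((real k + 1) * b) * 2 powr (real k * (- n - 2 * s)) * 2 powr ((real k + 1) * n))"
      unfolding d_def p2 by (simp add: powr_power n_def mult_ac add.commute)
    also have "\<dots> = B * (2 powr ((b - 2 * s) * real k))"
      unfolding B_def powr_add[symmetric] mult.assoc by (simp add: algebra_simps)
    finally show ?thesis by (simp add: powr_power mult.commute)
  qed
  have int_g: "(\<integral>\<^sup>+z. ennreal (g k z) \<partial>lborel)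
      = ennreal (A * ((1/2) powr (2 - 2 * s)) ^ k + B * (2 powr (b - 2 * s)) ^ k)" for k
  proof -
    have "(\<integral>\<^sup>+z. ennreal (g k z) \<partial>lborel) = (\<integral>\<^sup>+z. ennreal (c k * indicator (cball (0::'a) ((1/2) ^ k)) z)
       + ennreal (d k * indicator (cball 0 (2 ^ Suc k)) z) \<partial>lborel)"
      unfolding g_def using cd by (intro nn_integral_cong) (simp add: ennreal_plus)
    also have "\<dots> = ennreal (c k * V * ((1/2) ^ k) ^ DIM('a)) + ennreal (d k * V * (2 ^ Suc k) ^ DIM('a))"
      unfolding V_def n_def using cd
      by (subst nn_integral_add)
        (auto simp del: power_Suc simp add: nn_integral_cball_const intro!: borel_measurable_times borel_measurable_indicator)
    also have "\<dots> = ennreal (A * ((1/2) powr (2 - 2 * s)) ^ k + B * (2 powr (b - 2 * s)) ^ k)"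
      unfolding cc dd using AB by (simp add: ennreal_plus)
    finally show ?thesis .
  qed
  have "(1/2::real) powr (2 - 2 * s) < (1/2) powr 0"
    using assms by (intro powr_less_mono') auto
  moreover have "(2::real) powr (b - 2 * s) < 2 powr 0"
    using assms by (intro powr_less_mono) auto
  ultimately have sm: "summable (\<lambda>k. A * ((1/2) powr (2 - 2 * s)) ^ k + B * (2 powr (b - 2 * s)) ^ k)"
    by (intro summable_add summable_mult summable_geometric) auto
  have "(\<integral>\<^sup>+z. ennreal (?f z) \<partial>lborel) \<le> (\<integral>\<^sup>+z. (\<Sum>k. ennreal (g k z)) \<partial>lborel)"
    by (intro nn_integral_mono point)
  also have "\<dots> = (\<Sum>k. \<integral>\<^sup>+z. ennreal (g k z) \<partial>lborel)"
    unfolding g_def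
    by (intro nn_integral_suminf measurable_compose[OF _ measurable_ennreal] borel_measurable_add
        borel_measurable_times borel_measurable_indicator) auto
  also have "\<dots> < top"
    unfolding int_g using AB by (subst suminf_ennreal2[OF _ sm]) auto
  finally have "integrable lborel ?f"
    by (intro integrableI_bounded) auto
  then show ?thesis
    by (subst integrable_completion) auto
qed

text \<open>The Jacobian R^n and the homogeneity R^(-n - 2s) of the kernel leave R^(-2s), the
  scaling of an operator of order 2s.\<close>

lemma has_bochner_integral_ker_scale:
  fixes f :: "'a::euclidean_space \<Rightarrow> real"
  assumes "0 < R" and "has_bochner_integral lebesgue (\<lambda>z. f z * ker s z) I"
  shows "has_bochner_integral lebesgue (\<lambda>z. f (z /\<^sub>R R) * ker s z) (I * R powr (- 2 * s))"
proof -
  let ?p = "real DIM('a) + 2 * s"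
  have "has_bochner_integral lebesgue (\<lambda>x. f (0 + inverse R *\<^sub>R x) * ker s (0 + inverse R *\<^sub>R x))
      (I / \<bar>inverse R\<bar> ^ DIM('a))"
    by (rule has_bochner_integral_lebesgue_affine[OF _ assms(2)]) (use assms in auto)
  then have *: "has_bochner_integral lebesgue
      (\<lambda>x. R powr (- ?p) * (f (0 + inverse R *\<^sub>R x) * ker s (0 + inverse R *\<^sub>R x)))
      (R powr (- ?p) * (I / \<bar>inverse R\<bar> ^ DIM('a)))"
    by (rule has_bochner_integral_mult_right)
  have p: "- real DIM('a) - 2 * s = - ?p" by simp
  have "inverse R powr (- ?p) = R powr ?p"
    using assms(1) by (simp add: powr_minus powr_divide[of 1 R] inverse_eq_divide del: minus_add_distrib)
  then have k: "ker s (inverse R *\<^sub>R x) = R powr ?p * ker s x" for x :: 'a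
    using assms(1) ker_scale[of "inverse R" s x] unfolding p by simp
  have e1: "R powr (- ?p) * (f (0 + inverse R *\<^sub>R x) * ker s (0 + inverse R *\<^sub>R x)) = f (x /\<^sub>R R) * ker s x" for x
    unfolding add_0_left k using assms(1) by (simp add: powr_minus del: minus_add_distrib)
  have e2: "R powr (- ?p) * (I / \<bar>inverse R\<bar> ^ DIM('a)) = I * R powr (- 2 * s)"
  proof -
    have "R powr (- ?p) * R ^ DIM('a) = R powr (- ?p + real DIM('a))"
      using assms(1) by (simp only: powr_add powr_realpow)
    moreover have "I / \<bar>inverse R\<bar> ^ DIM('a) = I * R ^ DIM('a)"
      using assms(1) by (simp add: power_inverse divide_inverse)
    ultimately show ?thesis by simp
  qed
  show ?thesis using * unfolding e1 e2 .
qed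

section \<open>Weighted integrability\<close>

lemma one_plus_norm_pos: "0 < 1 + norm z"
  by (simp add: add_pos_nonneg)

lemma weight_pos: "0 < weight s z"
  using one_plus_norm_pos[of z] by (simp add: weight_def)

lemma weight_le_1:
  fixes z :: "'a::euclidean_space"
  shows "0 \<le> s \<Longrightarrow> weight s z \<le> 1"
  using powr_mono2'[of "- real DIM('a) - 2 * s" 1 "1 + norm z"]
  by (simp add: weight_def)

lemma weight_measurable [measurable]: "weight s \<in> borel_measurable borel"
  unfolding weight_def by measurable

lemma weight_measurable_lebesgue [measurable]: "weight s \<in> borel_measurable lebesgue"
  by (simp add: measurable_completion)

lemma weight_le_ker: "0 \<le> s \<Longrightarrow> z \<noteq> 0 \<Longrightarrow> weight s z \<le> ker s z"
  unfolding weight_def ker_def by (rule powr_mono2') auto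

text \<open>The ratio (1 + |z|) / |z| decreases in |z|, so its value at radius r is the worst
  one.\<close>

lemma ker_le_weight:
  fixes z :: "'a::euclidean_space"
  assumes "0 \<le> s" "0 < r" "r \<le> norm z"
  shows "ker s z \<le> ((1 + r) / r) powr (real DIM('a) + 2 * s) * weight s z"
proof -
  let ?p = "real DIM('a) + 2 * s"
  have p: "- real DIM('a) - 2 * s = - ?p" by simp
  have "(1 + norm z) / ((1 + r) / r) \<le> norm z"
    using assms by (simp add: field_simps)
  then have "ker s z \<le> ((1 + norm z) / ((1 + r) / r)) powr (- real DIM('a) - 2 * s)"
    unfolding ker_def using assms by (intro powr_mono2') (auto intro!: divide_pos_pos)
  also have "\<dots> = ((1 + r) / r) powr ?p * weight s z"
  proof -
    have "((1 + norm z) / ((1 + r) / r)) powr (- real DIM('a) - 2 * s)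
      = (1 + norm z) powr (- ?p) / ((1 + r) / r) powr (- ?p)"
      using assms by (subst powr_divide) (auto intro!: divide_nonneg_pos)
    also have "\<dots> = ((1 + r) / r) powr ?p * weight s z"
      unfolding weight_def p using assms by (simp add: powr_minus divide_inverse del: minus_add_distrib)
    finally show ?thesis .
  qed
  finally show ?thesis .
qed

lemma integrable_min_ker_0:
  assumes "0 < s" "s < 1"
  shows "integrable lebesgue (\<lambda>z::'a::euclidean_space. min ((norm z)\<^sup>2) 1 * ker s z)"
proof -
  have "min ((norm z)\<^sup>2) (norm z powr 0) * ker s z = min ((norm z)\<^sup>2) 1 * ker s z" for z :: 'a
    by (cases "z = 0") (auto simp: ker_def)
  then show ?thesis
    using integrable_min_ker[of s 0, where 'a='a] assms by (simp only: order_refl mult_pos_pos zero_less_numeral less_imp_le)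
qed

lemma integrable_weight:
  assumes "0 < s" "s < 1"
  shows "integrable lebesgue (weight s :: 'a::euclidean_space \<Rightarrow> real)"
proof (rule Bochner_Integration.integrable_bound)
  have "integrable lebesgue (indicator (cball 0 1) :: 'a \<Rightarrow> real)"
    using emeasure_bounded_finite[of "cball (0::'a) 1"] by (auto simp: emeasure_lborel_cball_finite)
  then show "integrable lebesgue (\<lambda>z::'a. min ((norm z)\<^sup>2) 1 * ker s z + indicator (cball 0 1) z)"
    by (intro Bochner_Integration.integrable_add integrable_min_ker_0 assms)
  show "AE z in lebesgue. norm (weight s z) \<le> norm (min ((norm z)\<^sup>2) 1 * ker s z + indicator (cball (0::'a) 1) z)"
  proof (rule AE_I2)
    fix z :: 'a
    show "norm (weight s z) \<le> norm (min ((norm z)\<^sup>2) 1 * ker s z + indicator (cball (0::'a) 1) z)"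
    proof (cases "norm z \<le> 1")
      case True
      then show ?thesis
        using weight_le_1[of s z] weight_pos[of s z] assms by (simp add: add_increasing)
    next
      case False
      then have "z \<noteq> 0" "1 \<le> (norm z)\<^sup>2" by (auto intro: one_le_power)
      then show ?thesis
        using False weight_le_ker[of s z] weight_pos[of s z] assms by (simp add: min_absorb2)
    qed
  qed
qed simp

lemma L1_weight_measurable:
  assumes "u \<in> L1_weight s"
  shows "u \<in> borel_measurable lebesgue"
proof -
  have "(\<lambda>z. u z * weight s z / weight s z) \<in> borel_measurable lebesgue"
    using assms unfolding L1_weight_def
    by (intro borel_measurable_divide weight_measurable_lebesgue) auto
  moreover have "u z * weight s z / weight s z = u z" for z
    using weight_pos[of s z] by simp
  ultimately show ?thesis by simp
qed

lemma L1_weight_bound: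
  assumes u: "u \<in> L1_weight s" and f: "f \<in> borel_measurable lebesgue"
    and bd: "\<And>z. \<bar>f z\<bar> \<le> C * (\<bar>u z\<bar> + 1)" and s: "0 < s" "s < 1"
  shows "f \<in> L1_weight s"
proof -
  have "integrable lebesgue (\<lambda>z. f z * weight s z)"
  proof (rule Bochner_Integration.integrable_bound)
    show "integrable lebesgue (\<lambda>z. C * (\<bar>u z * weight s z\<bar> + weight s z))"
      using u unfolding L1_weight_def
      by (intro integrable_mult_right Bochner_Integration.integrable_add integrable_weight s integrable_abs) auto
    show "(\<lambda>z. f z * weight s z) \<in> borel_measurable lebesgue" using f by simp
    show "AE z in lebesgue. norm (f z * weight s z) \<le> norm (C * (\<bar>u z * weight s z\<bar> + weight s z))"
    proof (rule AE_I2)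
      fix z
      have "\<bar>f z\<bar> * weight s z \<le> C * (\<bar>u z\<bar> + 1) * weight s z"
        using weight_pos[of s z] by (intro mult_right_mono bd) auto
      also have "\<dots> = C * (\<bar>u z * weight s z\<bar> + weight s z)"
        using weight_pos[of s z] by (simp add: abs_mult algebra_simps)
      also have "\<dots> \<le> \<bar>C * (\<bar>u z * weight s z\<bar> + weight s z)\<bar>" by (rule abs_ge_self)
      finally show "norm (f z * weight s z) \<le> norm (C * (\<bar>u z * weight s z\<bar> + weight s z))"
        using weight_pos[of s z] by (simp add: abs_mult)
    qed
  qed
  then show ?thesis by (simp add: L1_weight_def)
qed

text \<open>The weight is tempered: since 1 + |z + h| \<le> (1 + |h|) (1 + |z|), moving its argument
  by \<open>h\<close> costs at most a fixed power of \<open>1 + norm h\<close>.\<close>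

lemma L1_weight_shift:
  fixes u :: "'a::euclidean_space \<Rightarrow> real"
  assumes u: "u \<in> L1_weight s" and s: "0 \<le> s"
  shows "(\<lambda>z. u (z + h)) \<in> L1_weight s"
proof -
  let ?p = "real DIM('a) + 2 * s"
  have "has_bochner_integral lebesgue (\<lambda>z. u (h + 1 *\<^sub>R z) * weight s (h + 1 *\<^sub>R z))
     (integral\<^sup>L lebesgue (\<lambda>z. u z * weight s z) / \<bar>1\<bar> ^ DIM('a))"
    using u unfolding L1_weight_def
    by (intro has_bochner_integral_lebesgue_affine[where f = "\<lambda>z. u z * weight s z"])
      (auto intro: has_bochner_integral_integrable)
  then have i: "integrable lebesgue (\<lambda>z. u (z + h) * weight s (z + h))"
    by (auto simp: has_bochner_integral_iff add.commute)
  have p: "- real DIM('a) - 2 * s = - ?p" by simp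
  have ratio: "weight s z \<le> (1 + norm h) powr ?p * weight s (z + h)" for z :: 'a
  proof -
    have "1 + norm (z + h) \<le> (1 + norm h) * (1 + norm z)"
      using norm_triangle_ineq[of z h] by (simp add: algebra_simps add_increasing2 order_trans[OF norm_triangle_ineq])
    then have "(1 + norm (z + h)) / (1 + norm h) \<le> 1 + norm z"
      by (simp add: divide_le_eq add_pos_nonneg mult.commute)
    then have "weight s z \<le> ((1 + norm (z + h)) / (1 + norm h)) powr (- ?p)"
      using s unfolding weight_def by (subst diff_conv_add_uminus, subst minus_add_distrib[symmetric])
        (intro powr_mono2', auto intro!: divide_pos_pos add_pos_nonneg)
    also have "\<dots> = (1 + norm h) powr ?p * weight s (z + h)"
      unfolding weight_def p using one_plus_norm_pos[of h] one_plus_norm_pos[of "z + h"]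
      by (subst powr_divide) (simp_all add: powr_minus divide_inverse del: minus_add_distrib)
    finally show ?thesis .
  qed
  have "integrable lebesgue (\<lambda>z. u (z + h) * weight s z)"
  proof (rule Bochner_Integration.integrable_bound)
    show "integrable lebesgue (\<lambda>z. (1 + norm h) powr ?p * (u (z + h) * weight s (z + h)))"
      by (intro integrable_mult_right i)
    have "(\<lambda>z. u (z + h) * weight s (z + h) * (weight s z / weight s (z + h))) \<in> borel_measurable lebesgue"
      by (intro borel_measurable_times borel_measurable_integrable[OF i] measurable_completion) simp
    then show "(\<lambda>z. u (z + h) * weight s z) \<in> borel_measurable lebesgue"
      using weight_pos[of s "_ + h"] by (simp add: less_imp_neq[symmetric])
    show "AE z in lebesgue. norm (u (z + h) * weight s z)
        \<le> norm ((1 + norm h) powr ?p * (u (z + h) * weight s (z + h)))"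
    proof (rule AE_I2)
      fix z :: 'a
      show "norm (u (z + h) * weight s z) \<le> norm ((1 + norm h) powr ?p * (u (z + h) * weight s (z + h)))"
        using mult_left_mono[OF ratio[of z], of "\<bar>u (z + h)\<bar>"] weight_pos[of s z] weight_pos[of s "z + h"]
        by (simp add: abs_mult mult_ac)
    qed
  qed
  then show ?thesis by (simp add: L1_weight_def)
qed

text \<open>Viscosity tests are imposed only if the glued function is integrable. Continuity up to
  the boundary of the ball makes the test function bounded there and so discharges this
  proviso.\<close>

lemma glue_L1_weight:
  fixes u :: "'a::euclidean_space \<Rightarrow> real"
  assumes u: "u \<in> L1_weight s" and c: "continuous_on (cball x r) \<phi>" and s: "0 < s" "s < 1"
  shows "glue \<phi> x r u \<in> L1_weight s"
proof -
  have "compact (\<phi> ` cball x r)"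
    by (rule compact_continuous_image[OF c compact_cball])
  then obtain B where B: "0 < B" "\<And>y. y \<in> cball x r \<Longrightarrow> \<bar>\<phi> y\<bar> \<le> B"
    using compact_imp_bounded bounded_pos by (metis (no_types, lifting) image_eqI real_norm_def)
  have m: "(\<lambda>y. indicator (ball x r) y *\<^sub>R \<phi> y + indicator (- ball x r) y *\<^sub>R u y) \<in> borel_measurable lebesgue"
  proof (rule borel_measurable_add)
    have "(\<lambda>y. indicator (ball x r) y *\<^sub>R \<phi> y) \<in> borel_measurable borel"
      by (rule borel_measurable_continuous_on_indicator) (auto intro: continuous_on_subset[OF c])
    then show "(\<lambda>y. indicator (ball x r) y *\<^sub>R \<phi> y) \<in> borel_measurable lebesgue"
      by (simp add: measurable_completion)
    show "(\<lambda>y. indicator (- ball x r) y *\<^sub>R u y) \<in> borel_measurable lebesgue"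
      using L1_weight_measurable[OF u] by (intro borel_measurable_scaleR borel_measurable_indicator) auto
  qed
  have "glue \<phi> x r u = (\<lambda>y. indicator (ball x r) y *\<^sub>R \<phi> y + indicator (- ball x r) y *\<^sub>R u y)"
    by (auto simp: glue_def fun_eq_iff indicator_def)
  then have "glue \<phi> x r u \<in> borel_measurable lebesgue" using m by simp
  moreover have "\<bar>glue \<phi> x r u z\<bar> \<le> max B 1 * (\<bar>u z\<bar> + 1)" for z
  proof (cases "z \<in> ball x r")
    case True
    then have "\<bar>glue \<phi> x r u z\<bar> \<le> B" using B(2)[of z] by (simp add: glue_def)
    also have "\<dots> \<le> max B 1 * 1" by simp
    also have "\<dots> \<le> max B 1 * (\<bar>u z\<bar> + 1)" by (intro mult_left_mono) auto
    finally show ?thesis .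
  next
    case False
    then have "\<bar>glue \<phi> x r u z\<bar> \<le> 1 * (\<bar>u z\<bar> + 1)" by (auto simp: glue_def)
    also have "\<dots> \<le> max B 1 * (\<bar>u z\<bar> + 1)" by (intro mult_right_mono) auto
    finally show ?thesis .
  qed
  ultimately show ?thesis by (intro L1_weight_bound[OF u _ _ s])
qed

section \<open>Kernels, pointwise expansions and convergence of the singular integral\<close>

lemma kernels_bounds:
  assumes "K \<in> kernels s lam Lam" "z \<noteq> 0"
  shows "lam * ker s z \<le> K z" "K z \<le> Lam * ker s z"
proof -
  have "c / norm z powr (real DIM('a) + 2 * s) = c * ker s z" for c and z :: 'a
    by (simp add: ker_def powr_minus_divide[symmetric] divide_inverse powr_minus[symmetric])
  then show "lam * ker s z \<le> K z" "K z \<le> Lam * ker s z"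
    using assms by (auto simp: kernels_def)
qed

lemma kernels_measurable:
  assumes "K \<in> kernels s lam Lam"
  shows "K \<in> borel_measurable lebesgue"
proof -
  have "K \<in> borel_measurable (lebesgue_on (UNIV - {0}))" using assms by (simp add: kernels_def)
  then have "(\<lambda>x. if x \<in> UNIV - {0} then K x else 0) \<in> borel_measurable lebesgue"
    using borel_measurable_if_I[of K "UNIV - {0}"] by auto
  moreover have "(\<lambda>x. indicator {0} x * K 0) \<in> borel_measurable lebesgue"
    by (intro borel_measurable_times borel_measurable_indicator) auto
  ultimately have "(\<lambda>x. (if x \<in> UNIV - {0} then K x else 0) + indicator {0} x * K 0) \<in> borel_measurable lebesgue"
    by (rule borel_measurable_add)
  moreover have "(\<lambda>x. (if x \<in> UNIV - {0} then K x else 0) + indicator {0} x * K 0) = K"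
    by (auto simp: fun_eq_iff indicator_def)
  ultimately show ?thesis by simp
qed

text \<open>\<^const>\<open>C11_at\<close> with the gradient exposed.\<close>

definition expands :: "('a::euclidean_space \<Rightarrow> real) \<Rightarrow> 'a \<Rightarrow> 'a \<Rightarrow> bool" where
  "expands f x g \<longleftrightarrow> (\<exists>C r. 0 < r \<and> (\<forall>z\<in>ball 0 r. \<bar>f (x + z) - f x - g \<bullet> z\<bar> \<le> C * (norm z)\<^sup>2))"

lemma expands_C11_at: "expands f x g \<Longrightarrow> f \<in> C11_at x"
  unfolding expands_def C11_at_def by blast

lemma expandsE:
  assumes "expands f x g"
  obtains C r where "0 \<le> C" "0 < r" "\<And>z. norm z < r \<Longrightarrow> \<bar>f (x + z) - f x - g \<bullet> z\<bar> \<le> C * (norm z)\<^sup>2"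
proof -
  obtain C r where C: "0 < r" "\<forall>z\<in>ball 0 r. \<bar>f (x + z) - f x - g \<bullet> z\<bar> \<le> C * (norm z)\<^sup>2"
    using assms unfolding expands_def by blast
  have "\<bar>f (x + z) - f x - g \<bullet> z\<bar> \<le> max C 0 * (norm z)\<^sup>2" if "norm z < r" for z
    using C(2) that by (intro order_trans[OF bspec[OF C(2)]] mult_right_mono) auto
  then show thesis using that[of "max C 0" r] C(1) by auto
qed

text \<open>\<open>grad\<close> is a definite description. The quadratic remainder makes
  \<open>f\<close> differentiable at \<open>x\<close>, and uniqueness of the derivative identifies
  the vector described.\<close>

lemma expands_grad:
  assumes "expands f x g"
  shows "grad f x = g"
proof -
  obtain C r where C: "0 \<le> C" "0 < r" "\<And>z. norm z < r \<Longrightarrow> \<bar>f (x + z) - f x - g \<bullet> z\<bar> \<le> C * (norm z)\<^sup>2"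
    using expandsE[OF assms] by blast
  have "(f has_derivative (\<lambda>h. h \<bullet> g)) (at x)"
    unfolding has_derivative_at
  proof (intro conjI bounded_linear_inner_left)
    have "((\<lambda>h. C * norm h) \<longlongrightarrow> C * 0) (at (0::'a))"
      by (intro tendsto_intros tendsto_norm_zero)
    then have lim: "((\<lambda>h. C * norm h) \<longlongrightarrow> 0) (at (0::'a))" by simp
    show "(\<lambda>h. norm (f (x + h) - f x - h \<bullet> g) / norm h) \<midarrow>0\<rightarrow> 0"
    proof (rule tendsto_sandwich[OF _ _ tendsto_const lim])
      show "\<forall>\<^sub>F h in at 0. norm (f (x + h) - f x - h \<bullet> g) / norm h \<le> C * norm h"
        unfolding eventually_at using C
        by (intro exI[of _ r]) (auto simp: divide_le_eq power2_eq_square inner_commute mult.assoc)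
    qed auto
  qed
  then have G: "GDERIV f x :> g" by (simp add: gderiv_def)
  have unique: "g' = g" if "GDERIV f x :> g'" for g'
  proof -
    have "(\<lambda>h. h \<bullet> g) = (\<lambda>h. h \<bullet> g')"
      using G that unfolding gderiv_def by (rule has_derivative_unique)
    then have "(g' - g) \<bullet> (g' - g) = 0"
      by (metis inner_diff_right eq_iff_diff_eq_0)
    then show ?thesis by simp
  qed
  then show ?thesis using G unique unfolding grad_def by (metis the_equality)
qed

lemma expands_glue:
  assumes "expands \<phi> x g" "0 < r"
  shows "expands (glue \<phi> x r u) x g"
proof -
  obtain C r' where C: "0 < r'" "\<forall>z\<in>ball 0 r'. \<bar>\<phi> (x + z) - \<phi> x - g \<bullet> z\<bar> \<le> C * (norm z)\<^sup>2"
    using assms unfolding expands_def by blast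
  show ?thesis unfolding expands_def
    using C assms(2) by (intro exI[of _ C] exI[of _ "min r r'"]) (auto simp: glue_def dist_norm)
qed

lemma expands_shift: "expands f (x + h) g \<Longrightarrow> expands (\<lambda>y. f (y + h)) x g"
  unfolding expands_def by (simp add: ac_simps)

lemma expands_cmult:
  assumes "expands f x g"
  shows "expands (\<lambda>y. c * f y) x (c *\<^sub>R g)"
proof -
  obtain C r where C: "0 < r" "\<forall>z\<in>ball 0 r. \<bar>f (x + z) - f x - g \<bullet> z\<bar> \<le> C * (norm z)\<^sup>2"
    using assms unfolding expands_def by blast
  have "\<bar>c * f (x + z) - c * f x - c *\<^sub>R g \<bullet> z\<bar> \<le> \<bar>c\<bar> * C * (norm z)\<^sup>2" if "z \<in> ball 0 r" for z
  proof -
    have "\<bar>c * f (x + z) - c * f x - c *\<^sub>R g \<bullet> z\<bar> = \<bar>c\<bar> * \<bar>f (x + z) - f x - g \<bullet> z\<bar>"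
      by (simp add: abs_mult[symmetric] algebra_simps)
    then show ?thesis using C(2) that by (simp add: mult.assoc mult_left_mono)
  qed
  then show ?thesis unfolding expands_def using C(1) by blast
qed

lemma nonlocal_op_eq:
  assumes "expands f x g" "1/2 \<le> s" "s < 1"
  shows "nonlocal_op s K f x = integral\<^sup>L lebesgue (\<lambda>z. (f (x + z) - f x - indicator (ball 0 1) z * (g \<bullet> z)) * K z)"
  unfolding nonlocal_op_def expands_grad[OF assms(1)] using assms by simp

text \<open>Near the origin the quadratic remainder tames the kernel; away from it the kernel is
  comparable to the weight. Without integrability the integral would be the default value 0, and
  operators could not be subtracted under one integral sign.\<close>

lemma nonlocal_integrable:
  fixes f :: "'a::euclidean_space \<Rightarrow> real"
  assumes ex: "expands f x g" and L1: "f \<in> L1_weight s" and s: "1/2 \<le> s" "s < 1"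
    and K: "K \<in> kernels s lam Lam" and lam: "0 \<le> lam" "lam \<le> Lam"
  shows "integrable lebesgue (\<lambda>z. (f (x + z) - f x - indicator (ball 0 1) z * (g \<bullet> z)) * K z)"
proof -
  obtain C r0 where C: "0 \<le> C" "0 < r0"
    "\<And>z. norm z < r0 \<Longrightarrow> \<bar>f (x + z) - f x - g \<bullet> z\<bar> \<le> C * (norm z)\<^sup>2"
    using expandsE[OF ex] by blast
  \<comment> \<open>With \<open>r \<le> 1\<close> the indicator of the unit ball equals 1 wherever
    the expansion is used.\<close>
  define r where "r = min r0 1"
  have r: "0 < r" "r \<le> 1" "r \<le> r0" using C by (auto simp: r_def)
  define c where "c = ((1 + r) / r) powr (real DIM('a) + 2 * s)"
  have c0: "0 \<le> c" by (simp add: c_def)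
  define B where "B z = C * (min ((norm z)\<^sup>2) 1 * ker s z) + c * \<bar>f (z + x) * weight s z\<bar>
     + c * ((\<bar>f x\<bar> + norm g) * weight s z)" for z
  have sh: "(\<lambda>z. f (z + x)) \<in> L1_weight s" using L1_weight_shift[OF L1] s by simp
  have mf: "(\<lambda>z. f (x + z)) \<in> borel_measurable lebesgue"
    using L1_weight_measurable[OF sh] by (simp add: add.commute)
  have pt: "\<bar>f (x + z) - f x - indicator (ball 0 1) z * (g \<bullet> z)\<bar> * ker s z \<le> B z" for z
  proof (cases "norm z < r")
    case True
    then have "\<bar>f (x + z) - f x - indicator (ball 0 1) z * (g \<bullet> z)\<bar> \<le> C * (norm z)\<^sup>2"
      using C(3)[of z] r by simp
    also have "(norm z)\<^sup>2 = min ((norm z)\<^sup>2) 1"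
      using True r by (simp add: min_def power_le_one abs_square_le_1)
    finally have "\<bar>f (x + z) - f x - indicator (ball 0 1) z * (g \<bullet> z)\<bar> * ker s z
      \<le> C * min ((norm z)\<^sup>2) 1 * ker s z"
      by (intro mult_right_mono) auto
    then show ?thesis
      unfolding B_def using c0 weight_pos[of s z] by (simp add: mult.assoc add_increasing2)
  next
    case False
    have "\<bar>indicator (ball 0 1) z * (g \<bullet> z)\<bar> \<le> norm g"
    proof (cases "norm z < 1")
      case True
      then have "norm g * norm z \<le> norm g * 1" by (intro mult_left_mono) auto
      then show ?thesis using Cauchy_Schwarz_ineq2[of g z] True by simp
    qed simp
    then have "\<bar>f (x + z) - f x - indicator (ball 0 1) z * (g \<bullet> z)\<bar> \<le> \<bar>f (z + x)\<bar> + (\<bar>f x\<bar> + norm g)"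
      by (simp add: add.commute[of z x])
    moreover have "ker s z \<le> c * weight s z"
      unfolding c_def using s r False by (intro ker_le_weight) auto
    ultimately have "\<bar>f (x + z) - f x - indicator (ball 0 1) z * (g \<bullet> z)\<bar> * ker s z
       \<le> (\<bar>f (z + x)\<bar> + (\<bar>f x\<bar> + norm g)) * (c * weight s z)"
      by (intro mult_mono) auto
    also have "\<dots> = c * \<bar>f (z + x) * weight s z\<bar> + c * ((\<bar>f x\<bar> + norm g) * weight s z)"
      using weight_pos[of s z] by (simp add: abs_mult algebra_simps)
    moreover have "0 \<le> C * (min ((norm z)\<^sup>2) 1 * ker s z)" using C(1) by simp
    ultimately show ?thesis unfolding B_def by linarith
  qed
  have "integrable lebesgue (\<lambda>z. Lam * B z)"
    unfolding B_def using sh s unfolding L1_weight_def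
    by (intro integrable_mult_right Bochner_Integration.integrable_add integrable_weight
        integrable_min_ker_0 integrable_abs) auto
  then show ?thesis
  proof (rule Bochner_Integration.integrable_bound)
    have "(\<lambda>z. g \<bullet> z) \<in> borel_measurable lebesgue"
      by (intro measurable_completion) simp
    then show "(\<lambda>z. (f (x + z) - f x - indicator (ball 0 1) z * (g \<bullet> z)) * K z) \<in> borel_measurable lebesgue"
      using mf kernels_measurable[OF K]
      by (intro borel_measurable_times borel_measurable_diff borel_measurable_indicator) auto
    show "AE z in lebesgue. norm ((f (x + z) - f x - indicator (ball 0 1) z * (g \<bullet> z)) * K z) \<le> norm (Lam * B z)"
      using AE_lebesgue_nonzero
    proof eventually_elim
      fix z :: 'a assume z: "z \<noteq> 0"
      have "0 \<le> K z" "K z \<le> Lam * ker s z"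
        using kernels_bounds[OF K z] mult_nonneg_nonneg[OF lam(1) ker_nonneg[of s z]] by linarith+
      then have "norm ((f (x + z) - f x - indicator (ball 0 1) z * (g \<bullet> z)) * K z)
         \<le> \<bar>f (x + z) - f x - indicator (ball 0 1) z * (g \<bullet> z)\<bar> * (Lam * ker s z)"
        by (simp add: abs_mult mult_left_mono)
      also have "\<dots> \<le> Lam * B z"
        using mult_left_mono[OF pt[of z], of Lam] lam by (simp add: mult_ac)
      finally show "norm ((f (x + z) - f x - indicator (ball 0 1) z * (g \<bullet> z)) * K z) \<le> norm (Lam * B z)"
        by (simp add: abs_le_iff)
    qed
  qed
qed

section \<open>Twice differentiable test functions\<close>

text \<open>\<^const>\<open>C2_on\<close> with the gradient exposed.\<close>

definition has_C2 :: "'a::euclidean_space set \<Rightarrow> ('a \<Rightarrow> real) \<Rightarrow> ('a \<Rightarrow> 'a) \<Rightarrow> bool" where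
  "has_C2 S f g \<longleftrightarrow> (\<exists>D. (\<forall>x\<in>S. GDERIV f x :> g x \<and> (g has_derivative blinfun_apply (D x)) (at x))
      \<and> continuous_on S (D :: 'a \<Rightarrow> 'a \<Rightarrow>\<^sub>L 'a))"

lemma has_C2_imp_C2_on: "has_C2 S f g \<Longrightarrow> C2_on S f"
  unfolding has_C2_def C2_on_def by blast

lemma has_C2_subset: "has_C2 S f g \<Longrightarrow> T \<subseteq> S \<Longrightarrow> has_C2 T f g"
  unfolding has_C2_def by (meson continuous_on_subset subset_iff)

lemma has_C2_continuous_on: "has_C2 S f g \<Longrightarrow> continuous_on S f"
  unfolding has_C2_def gderiv_def
  by (meson continuous_at_imp_continuous_on has_derivative_continuous)

text \<open>The building block for all test functions: each is assembled from one-variable functions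
  of a squared distance, which, unlike the distance, is smooth at its centre.\<close>

lemma has_C2_sq_dist: "has_C2 S (\<lambda>x. (norm (x - a))\<^sup>2) (\<lambda>x. 2 *\<^sub>R (x - a))"
  unfolding has_C2_def
proof (intro exI conjI ballI)
  fix x
  show "GDERIV (\<lambda>x. (norm (x - a))\<^sup>2) x :> 2 *\<^sub>R (x - a)"
    unfolding gderiv_def power2_norm_eq_inner
    by (auto intro!: derivative_eq_intros simp: inner_commute algebra_simps)
  show "((\<lambda>x. 2 *\<^sub>R (x - a)) has_derivative blinfun_apply (2 *\<^sub>R id_blinfun)) (at x)"
    by (auto intro!: derivative_eq_intros simp: blinfun.scaleR_left)
qed (rule continuous_on_const)

lemma has_C2_add:
  assumes "has_C2 S f1 g1" "has_C2 S f2 g2"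
  shows "has_C2 S (\<lambda>x. f1 x + f2 x) (\<lambda>x. g1 x + g2 x)"
proof -
  obtain D1 where D1: "\<forall>x\<in>S. GDERIV f1 x :> g1 x \<and> (g1 has_derivative blinfun_apply (D1 x)) (at x)"
    "continuous_on S D1" using assms(1) unfolding has_C2_def by blast
  obtain D2 where D2: "\<forall>x\<in>S. GDERIV f2 x :> g2 x \<and> (g2 has_derivative blinfun_apply (D2 x)) (at x)"
    "continuous_on S D2" using assms(2) unfolding has_C2_def by blast
  show ?thesis unfolding has_C2_def
  proof (intro exI[of _ "\<lambda>x. D1 x + D2 x"] conjI ballI continuous_on_add D1(2) D2(2))
    fix x assume x: "x \<in> S"
    show "GDERIV (\<lambda>x. f1 x + f2 x) x :> g1 x + g2 x"
      using D1(1) D2(1) x by (intro GDERIV_add) auto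
    have "((\<lambda>x. g1 x + g2 x) has_derivative (\<lambda>h. D1 x h + D2 x h)) (at x)"
      using D1(1) D2(1) x by (intro has_derivative_add) auto
    moreover have "(\<lambda>h. D1 x h + D2 x h) = blinfun_apply (D1 x + D2 x)"
      by (auto simp: blinfun.add_left)
    ultimately show "((\<lambda>x. g1 x + g2 x) has_derivative blinfun_apply (D1 x + D2 x)) (at x)"
      by simp
  qed
qed

lemma has_C2_compose:
  fixes h h' h'' :: "real \<Rightarrow> real"
  assumes f: "has_C2 S f g"
    and h: "\<And>x. x \<in> S \<Longrightarrow> (h has_real_derivative h' (f x)) (at (f x))"
    and h': "\<And>x. x \<in> S \<Longrightarrow> (h' has_real_derivative h'' (f x)) (at (f x))"
    and h'': "continuous_on (f ` S) h''"
  shows "has_C2 S (\<lambda>x. h (f x)) (\<lambda>x. h' (f x) *\<^sub>R g x)"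
proof -
  obtain D where D: "\<And>x. x \<in> S \<Longrightarrow> GDERIV f x :> g x" "\<And>x. x \<in> S \<Longrightarrow> (g has_derivative blinfun_apply (D x)) (at x)"
    "continuous_on S D" using f unfolding has_C2_def by blast
  have fc: "continuous_on S f" by (rule has_C2_continuous_on[OF f])
  have gc: "continuous_on S g"
    using D(2) by (meson continuous_at_imp_continuous_on has_derivative_continuous)
  have h'c: "continuous_on S (\<lambda>x. h' (f x))"
    by (rule continuous_on_compose2[OF _ fc, of "f ` S"])
      (auto intro!: continuous_at_imp_continuous_on DERIV_isCont[OF h'])
  have h''c: "continuous_on S (\<lambda>x. h'' (f x))"
    by (rule continuous_on_compose2[OF h'' fc]) auto
  \<comment> \<open>The Hessian of the composition: h'' times the rank one map given by the
    gradient, plus h' times the Hessian of \<open>f\<close>.\<close>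
  define E where "E x = h'' (f x) *\<^sub>R (blinfun_scaleR_left (g x) o\<^sub>L blinfun_inner_left (g x)) + h' (f x) *\<^sub>R D x" for x
  have E: "blinfun_apply (E x) v = (h'' (f x) * (g x \<bullet> v)) *\<^sub>R g x + h' (f x) *\<^sub>R D x v" for x v
    by (simp add: E_def blinfun.add_left blinfun.scaleR_left inner_commute)
  show ?thesis unfolding has_C2_def
  proof (intro exI[of _ E] conjI ballI)
    fix x assume x: "x \<in> S"
    show "GDERIV (\<lambda>x. h (f x)) x :> h' (f x) *\<^sub>R g x"
      by (rule GDERIV_DERIV_compose[OF D(1)[OF x] h[OF x]])
    have "GDERIV (\<lambda>x. h' (f x)) x :> h'' (f x) *\<^sub>R g x"
      by (rule GDERIV_DERIV_compose[OF D(1)[OF x] h'[OF x]])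
    then have "((\<lambda>x. h' (f x)) has_derivative (\<lambda>v. v \<bullet> (h'' (f x) *\<^sub>R g x))) (at x)"
      by (simp add: gderiv_def)
    from has_derivative_scaleR[OF this D(2)[OF x]]
    have "((\<lambda>x. h' (f x) *\<^sub>R g x) has_derivative
        (\<lambda>v. h' (f x) *\<^sub>R D x v + (v \<bullet> (h'' (f x) *\<^sub>R g x)) *\<^sub>R g x)) (at x)" .
    moreover have "(\<lambda>v. h' (f x) *\<^sub>R D x v + (v \<bullet> (h'' (f x) *\<^sub>R g x)) *\<^sub>R g x) = blinfun_apply (E x)"
      by (auto simp: E fun_eq_iff inner_commute)
    ultimately show "((\<lambda>x. h' (f x) *\<^sub>R g x) has_derivative blinfun_apply (E x)) (at x)" by simp
  next
    have "continuous_on S (\<lambda>x. blinfun_scaleR_left (g x))"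
      by (rule bounded_linear.continuous_on[OF bounded_linear_blinfun_scaleR_left gc])
    moreover have "continuous_on S (\<lambda>x. blinfun_inner_left (g x))"
      by (rule bounded_linear.continuous_on[OF bounded_linear_blinfun_inner_left gc])
    ultimately show "continuous_on S E"
      unfolding E_def
      by (intro continuous_on_add continuous_on_scaleR h''c h'c D(3)
          bounded_bilinear.continuous_on[OF bounded_bilinear_blinfun_compose])
  qed
qed

text \<open>On the closed ball of half the radius the continuous Hessian is bounded by compactness,
  so the gradient is Lipschitz there. The mean value inequality for \<open>f\<close> minus its
  linear part then yields the second factor |z|.\<close>

lemma has_C2_expands:
  assumes f: "has_C2 (ball x r) f g" and r: "0 < r"
  shows "expands f x (g x)"
proof -
  obtain D where D: "\<And>y. y \<in> ball x r \<Longrightarrow> GDERIV f y :> g y"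
    "\<And>y. y \<in> ball x r \<Longrightarrow> (g has_derivative blinfun_apply (D y)) (at y)"
    "continuous_on (ball x r) D" using f unfolding has_C2_def by blast
  have sub: "cball x (r / 2) \<subseteq> ball x r" using r by auto
  have "compact (D ` cball x (r / 2))"
    by (intro compact_continuous_image continuous_on_subset[OF D(3)] sub compact_cball)
  then obtain B where B: "0 < B" "\<And>y. y \<in> cball x (r / 2) \<Longrightarrow> norm (D y) \<le> B"
    using compact_imp_bounded bounded_pos by (metis (no_types, lifting) image_eqI)
  have g: "norm (g y - g x) \<le> B * norm (y - x)" if y: "y \<in> cball x (r / 2)" for y
  proof (rule differentiable_bound[OF convex_cball])
    show "(g has_derivative blinfun_apply (D z)) (at z within cball x (r / 2))" if "z \<in> cball x (r / 2)" for z
      using D(2) that sub by (meson has_derivative_at_withinI subsetD)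
    show "onorm (blinfun_apply (D z)) \<le> B" if "z \<in> cball x (r / 2)" for z
      using B(2)[OF that] by (simp add: norm_blinfun.rep_eq)
  qed (use y r in auto)
  have "\<bar>f (x + z) - f x - g x \<bullet> z\<bar> \<le> B * (norm z)\<^sup>2" if z: "z \<in> ball 0 (r / 2)" for z
  proof -
    let ?F = "\<lambda>y. f y - g x \<bullet> (y - x)"
    have sub': "cball x (norm z) \<subseteq> cball x (r / 2)" using z by auto
    have "norm (?F (x + z) - ?F x) \<le> (B * norm z) * norm ((x + z) - x)"
    proof (rule differentiable_bound[OF convex_cball[of x "norm z"]])
      fix y assume y: "y \<in> cball x (norm z)"
      then have y': "y \<in> cball x (r / 2)" using sub' by auto
      have "(f has_derivative (\<lambda>h. h \<bullet> g y)) (at y)"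
        using D(1) y' sub unfolding gderiv_def by auto
      then have "(?F has_derivative (\<lambda>h. h \<bullet> (g y - g x))) (at y)"
        by (auto intro!: derivative_eq_intros simp: inner_diff_right inner_commute)
      then show "(?F has_derivative (\<lambda>h. h \<bullet> (g y - g x))) (at y within cball x (norm z))"
        by (rule has_derivative_at_withinI)
      have "norm (g y - g x) \<le> B * norm z"
        using g[OF y'] y B(1) by (auto simp: dist_norm norm_minus_commute intro: order_trans mult_left_mono)
      then show "onorm (\<lambda>h. h \<bullet> (g y - g x)) \<le> B * norm z"
      proof (intro onorm_le)
          fix h
          have "norm (h \<bullet> (g y - g x)) \<le> norm (g y - g x) * norm h"
            using Cauchy_Schwarz_ineq2[of h "g y - g x"] by (simp add: mult.commute)
          also have "\<dots> \<le> B * norm z * norm h"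
            using \<open>norm (g y - g x) \<le> B * norm z\<close> by (rule mult_right_mono) simp
          finally show "norm (h \<bullet> (g y - g x)) \<le> B * norm z * norm h" .
        qed
    qed (auto simp: dist_norm)
    then show ?thesis by (simp add: power2_eq_square mult.assoc)
  qed
  then show ?thesis unfolding expands_def using r by (intro exI[of _ B] exI[of _ "r / 2"]) auto
qed

section \<open>Testing the equation and using ellipticity\<close>

lemma usc_lsc_continuous:
  fixes f :: "'a::t2_space \<Rightarrow> real"
  assumes "usc_on UNIV f" "lsc_on UNIV f"
  shows "continuous_on UNIV f"
proof (rule continuous_at_imp_continuous_on, intro ballI)
  fix x :: 'a
  show "isCont f x"
    unfolding isCont_def
  proof (rule order_tendstoI)
    show "a < f x \<Longrightarrow> \<forall>\<^sub>F y in at x. a < f y" for a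
      using assms(2) by (auto simp: lsc_on_def)
    show "f x < a \<Longrightarrow> \<forall>\<^sub>F y in at x. f y < a" for a
      using assms(1) by (auto simp: usc_on_def)
  qed
qed

text \<open>Packages what a contact point provides: the inequality with the explicit gradient, and
  the two memberships under which ellipticity may be applied to the glued function. Smoothness on a
  neighbourhood of the closed ball is what gives integrability.\<close>

lemma subsolution_test:
  assumes sol: "visc_subsolution s I H UNIV u" and s: "0 < s" "s < 1" and C2: "has_C2 S \<phi> g"
    and r: "0 < r" "cball x r \<subseteq> S" and eq: "u x = \<phi> x" and le: "\<And>y. y \<in> ball x r \<Longrightarrow> u y \<le> \<phi> y"
  shows "H x (u x) (g x) \<le> I (glue \<phi> x r u) x" "glue \<phi> x r u \<in> L1_weight s"
    "expands (glue \<phi> x r u) x (g x)"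
proof -
  have b: "has_C2 (ball x r) \<phi> g" using has_C2_subset[OF C2] r ball_subset_cball by blast
  have u: "u \<in> L1_weight s" using sol by (simp add: visc_subsolution_def)
  show L: "glue \<phi> x r u \<in> L1_weight s"
    using u has_C2_continuous_on[OF C2] r(2) s by (blast intro: glue_L1_weight continuous_on_subset)
  have ex: "expands \<phi> x (g x)" by (rule has_C2_expands[OF b r(1)])
  show "expands (glue \<phi> x r u) x (g x)" by (rule expands_glue[OF ex r(1)])
  have "- I (glue \<phi> x r u) x + H x (u x) (grad \<phi> x) \<le> 0"
    using sol has_C2_imp_C2_on[OF b] r(1) eq le L unfolding visc_subsolution_def by blast
  then show "H x (u x) (g x) \<le> I (glue \<phi> x r u) x"
    by (simp add: expands_grad[OF ex])
qed

lemma supersolution_test: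
  assumes sol: "visc_supersolution s I H UNIV u" and s: "0 < s" "s < 1" and C2: "has_C2 S \<phi> g"
    and r: "0 < r" "cball x r \<subseteq> S" and eq: "u x = \<phi> x" and le: "\<And>y. y \<in> ball x r \<Longrightarrow> \<phi> y \<le> u y"
  shows "I (glue \<phi> x r u) x \<le> H x (u x) (g x)" "glue \<phi> x r u \<in> L1_weight s"
    "expands (glue \<phi> x r u) x (g x)"
proof -
  have b: "has_C2 (ball x r) \<phi> g" using has_C2_subset[OF C2] r ball_subset_cball by blast
  have u: "u \<in> L1_weight s" using sol by (simp add: visc_supersolution_def)
  show L: "glue \<phi> x r u \<in> L1_weight s"
    using u has_C2_continuous_on[OF C2] r(2) s by (blast intro: glue_L1_weight continuous_on_subset)
  have ex: "expands \<phi> x (g x)" by (rule has_C2_expands[OF b r(1)])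
  show "expands (glue \<phi> x r u) x (g x)" by (rule expands_glue[OF ex r(1)])
  have "0 \<le> - I (glue \<phi> x r u) x + H x (u x) (grad \<phi> x)"
    using sol has_C2_imp_C2_on[OF b] r(1) eq le L unfolding visc_supersolution_def by blast
  then show "I (glue \<phi> x r u) x \<le> H x (u x) (g x)"
    by (simp add: expands_grad[OF ex])
qed

lemma visc_solution_continuous:
  assumes "visc_solution s I H UNIV u"
  shows "continuous_on UNIV u"
  using assms unfolding visc_solution_def visc_subsolution_def visc_supersolution_def
  by (intro usc_lsc_continuous) auto

lemma expands_zero: "expands (\<lambda>_. 0) x 0"
  unfolding expands_def by (intro exI[of _ 0] exI[of _ 1]) auto

lemma zero_L1_weight: "(\<lambda>_. 0) \<in> L1_weight s"
  by (simp add: L1_weight_def)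

text \<open>Doubling the zero function forces the value 0. Ellipticity tested against the zero
  function therefore bounds \<open>I u x\<close> itself and not only differences.\<close>

lemma pos_homogeneous_zero:
  assumes "pos_homogeneous s I"
  shows "I (\<lambda>_. 0) x = 0"
proof -
  have "I (\<lambda>y. 2 * (\<lambda>_. 0) y) x = 2 * I (\<lambda>_. 0) x"
    using assms expands_C11_at[OF expands_zero] zero_L1_weight zero_less_numeral
    unfolding pos_homogeneous_def by blast
  then show ?thesis by simp
qed

lemma nonlocal_op_zero: "1/2 \<le> s \<Longrightarrow> s < 1 \<Longrightarrow> nonlocal_op s K (\<lambda>_. 0) x = 0"
  by (subst nonlocal_op_eq[OF expands_zero]) auto

lemma elliptic_upper:
  assumes "elliptic s \<K> I" "u \<in> C11_at x" "u \<in> L1_weight s" "v \<in> C11_at x" "v \<in> L1_weight s"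
    and "\<And>K. K \<in> \<K> \<Longrightarrow> nonlocal_op s K u x - nonlocal_op s K v x \<le> B"
  shows "I u x - I v x \<le> B"
proof -
  have "ereal (I u x - I v x) \<le> (SUP K\<in>\<K>. ereal (nonlocal_op s K u x - nonlocal_op s K v x))"
    using assms unfolding elliptic_def by blast
  also have "\<dots> \<le> ereal B" using assms(6) by (intro SUP_least) auto
  finally show ?thesis by simp
qed

lemma elliptic_lower:
  assumes "elliptic s \<K> I" "u \<in> C11_at x" "u \<in> L1_weight s" "v \<in> C11_at x" "v \<in> L1_weight s"
    and "\<And>K. K \<in> \<K> \<Longrightarrow> B \<le> nonlocal_op s K u x - nonlocal_op s K v x"
  shows "B \<le> I u x - I v x"
proof -
  have "ereal B \<le> (INF K\<in>\<K>. ereal (nonlocal_op s K u x - nonlocal_op s K v x))"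
    using assms(6) by (intro INF_greatest) auto
  also have "\<dots> \<le> ereal (I u x - I v x)"
    using assms unfolding elliptic_def by blast
  finally show ?thesis by simp
qed

text \<open>Enlarging the class widens both extrema. For growth below the first power this reduces
  symmetric kernels to the general ones.\<close>

lemma elliptic_mono:
  fixes \<K> \<K>' :: "('a::euclidean_space \<Rightarrow> real) set"
  assumes "elliptic s \<K>' I" "\<K>' \<subseteq> \<K>"
  shows "elliptic s \<K> I"
  unfolding elliptic_def
proof (intro allI impI, elim conjE, intro conjI)
  fix u v :: "'a \<Rightarrow> real" and x assume uv: "u \<in> C11_at x \<inter> L1_weight s" "v \<in> C11_at x \<inter> L1_weight s"
  let ?d = "\<lambda>K. ereal (nonlocal_op s K u x - nonlocal_op s K v x)"
  have "(INF K\<in>\<K>. ?d K) \<le> (INF K\<in>\<K>'. ?d K)"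
    using assms(2) by (rule INF_superset_mono) simp
  also have "\<dots> \<le> ereal (I u x - I v x)"
    using assms(1) uv unfolding elliptic_def by blast
  finally show "(INF K\<in>\<K>. ?d K) \<le> ereal (I u x - I v x)" .
  have "ereal (I u x - I v x) \<le> (SUP K\<in>\<K>'. ?d K)"
    using assms(1) uv unfolding elliptic_def by blast
  also have "\<dots> \<le> (SUP K\<in>\<K>. ?d K)"
    using assms(2) by (rule SUP_subset_mono) simp
  finally show "ereal (I u x - I v x) \<le> (SUP K\<in>\<K>. ?d K)" .
qed

section \<open>Symmetric kernels\<close>

text \<open>A symmetric kernel does not see the radius of the ball in the compensator: changing it
  adds an odd function supported in an annulus. The cutoff can thus be placed at the scale of the
  test function; an asymmetric kernel would leave a drift here.\<close>

lemma annulus_odd: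
  fixes K :: "'a::euclidean_space \<Rightarrow> real"
  assumes K: "K \<in> kernels_sym s lam Lam" and s: "0 < s" "s < 1" and lam: "0 \<le> lam" "lam \<le> Lam"
    and ab: "0 < a" "0 < b"
  shows "has_bochner_integral lebesgue
     (\<lambda>z. (indicator (ball 0 a) z - indicator (ball 0 b) z) * (g \<bullet> z) * K z) 0"
proof -
  let ?f = "\<lambda>z. (indicator (ball 0 a) z - indicator (ball 0 b) z) * (g \<bullet> z) * K z"
  have K': "K \<in> kernels s lam Lam" using K by (simp add: kernels_sym_def)
  define \<rho> where "\<rho> = min (min a b) 1"
  have \<rho>: "0 < \<rho>" "\<rho> \<le> a" "\<rho> \<le> b" "\<rho> \<le> 1" using ab by (auto simp: \<rho>_def)
  define c where "c = norm g * max a b / \<rho>\<^sup>2"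
  have c: "0 \<le> c" using ab by (simp add: c_def)
  have pt: "\<bar>(indicator (ball 0 a) z - indicator (ball 0 b) z) * (g \<bullet> z)\<bar> \<le> c * min ((norm z)\<^sup>2) 1" for z
  proof (cases "norm z < \<rho> \<or> max a b \<le> norm z")
    case True
    then have "(indicator (ball 0 a) z - indicator (ball 0 b) z :: real) = 0"
      using \<rho> by (auto simp: indicator_def)
    then show ?thesis using c by simp
  next
    case False
    have "\<rho>\<^sup>2 \<le> (norm z)\<^sup>2" "\<rho>\<^sup>2 \<le> 1" using False \<rho> by (auto intro: power_mono simp: power_le_one)
    then have m: "1 \<le> min ((norm z)\<^sup>2) 1 / \<rho>\<^sup>2" using \<rho>(1) by simp
    have "\<bar>(indicator (ball 0 a) z - indicator (ball 0 b) z) * (g \<bullet> z)\<bar> \<le> \<bar>g \<bullet> z\<bar>"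
      by (auto simp: indicator_def)
    also have "\<dots> \<le> norm g * norm z" by (rule Cauchy_Schwarz_ineq2)
    also have "\<dots> \<le> norm g * max a b * 1"
      using False by (auto intro!: mult_left_mono)
    also have "\<dots> \<le> norm g * max a b * (min ((norm z)\<^sup>2) 1 / \<rho>\<^sup>2)"
      using m ab by (intro mult_left_mono) auto
    finally show ?thesis by (simp add: c_def)
  qed
  have int: "integrable lebesgue (\<lambda>z. c * Lam * (min ((norm z)\<^sup>2) 1 * ker s z))"
    by (intro integrable_mult_right integrable_min_ker_0 s)
  have "integrable lebesgue ?f"
  proof (rule Bochner_Integration.integrable_bound[OF int])
    have "(\<lambda>z. (indicator (ball 0 a) z - indicator (ball 0 b) z) * (g \<bullet> z)) \<in> borel_measurable lebesgue"
      by (intro measurable_completion borel_measurable_times borel_measurable_diff borel_measurable_indicator) auto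
    then show "?f \<in> borel_measurable lebesgue"
      using kernels_measurable[OF K'] by (rule borel_measurable_times)
    show "AE z in lebesgue. norm (?f z) \<le> norm (c * Lam * (min ((norm z)\<^sup>2) 1 * ker s z))"
      using AE_lebesgue_nonzero
    proof eventually_elim
      fix z :: 'a assume z: "z \<noteq> 0"
      have "0 \<le> K z" "K z \<le> Lam * ker s z"
        using kernels_bounds[OF K' z] mult_nonneg_nonneg[OF lam(1) ker_nonneg[of s z]] by linarith+
      then have "norm (?f z) \<le> (c * min ((norm z)\<^sup>2) 1) * (Lam * ker s z)"
        unfolding real_norm_def abs_mult[of _ "K z"] using pt[of z] c by (intro mult_mono) auto
      then show "norm (?f z) \<le> norm (c * Lam * (min ((norm z)\<^sup>2) 1 * ker s z))"
        by (simp add: mult_ac abs_le_iff)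
    qed
  qed
  moreover have "integral\<^sup>L lebesgue ?f = 0"
  proof (rule integral_lebesgue_odd)
    fix z
    have "z \<noteq> 0 \<Longrightarrow> K (- z) = K z" using K unfolding kernels_sym_def mem_Collect_eq by metis
    then show "?f (- z) = - ?f z" by (cases "z = 0") (simp_all add: indicator_def)
  qed
  ultimately show ?thesis by (simp add: has_bochner_integral_iff)
qed

text \<open>The bound is uniform in the base point and has the scaling expected of a bump of width
  R. With the denominators \<open>a\<close> and \<open>b\<close> at the two points, the remainder is
  a term in |z|^2 minus a term in \<open>e * d\<close>; they are at most 1 and 4 times |z|^2 /
  R^2.\<close>

lemma bump_expansion:
  fixes x z :: "'a::real_inner"
  assumes "0 < R"
  defines "\<theta> \<equiv> \<lambda>y::'a. (norm y)\<^sup>2 / (R\<^sup>2 + (norm y)\<^sup>2)"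
  shows "\<bar>\<theta> (x + z) - \<theta> x - (2 * R\<^sup>2 / (R\<^sup>2 + (norm x)\<^sup>2)\<^sup>2) *\<^sub>R x \<bullet> z\<bar> \<le> 5 * (norm (z /\<^sub>R R))\<^sup>2"
proof -
  define a b d e where "a = R\<^sup>2 + (norm x)\<^sup>2" and "b = R\<^sup>2 + (norm (x + z))\<^sup>2" and "d = b - a" and "e = x \<bullet> z"
  have d: "d = 2 * e + (norm z)\<^sup>2"
    unfolding d_def a_def b_def e_def power2_norm_eq_inner by (simp add: inner_add inner_commute)
  have ab: "R\<^sup>2 \<le> a" "R\<^sup>2 \<le> b" "0 < a" "0 < b" using assms(1) by (auto simp: a_def b_def add_pos_nonneg)
  have e: "\<bar>e\<bar> \<le> sqrt a * norm z"
  proof -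
    have "norm x \<le> sqrt a" by (intro real_le_rsqrt) (simp add: a_def)
    then show ?thesis unfolding e_def
      by (intro order_trans[OF Cauchy_Schwarz_ineq2] mult_right_mono) auto
  qed
  \<comment> \<open>Factoring \<open>d\<close> as a difference of squares gives a bound linear in
    |z| for all z, large ones included; a case distinction is avoided.\<close>
  have db: "\<bar>d\<bar> \<le> norm z * (sqrt a + sqrt b)"
  proof -
    have "d = (norm (x + z) - norm x) * (norm (x + z) + norm x)"
      by (simp add: d_def a_def b_def power2_eq_square algebra_simps)
    then have "\<bar>d\<bar> = \<bar>norm (x + z) - norm x\<bar> * (norm (x + z) + norm x)" by (simp add: abs_mult)
    also have "\<dots> \<le> norm z * (sqrt b + sqrt a)"
    proof (intro mult_mono add_mono)
      show "\<bar>norm (x + z) - norm x\<bar> \<le> norm z" using norm_triangle_ineq3[of "x + z" x] by simp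
      show "norm (x + z) \<le> sqrt b" "norm x \<le> sqrt a" by (auto intro!: real_le_rsqrt simp: a_def b_def)
    qed auto
    finally show ?thesis by (simp add: add.commute)
  qed
  have "\<theta> (x + z) - \<theta> x - (2 * R\<^sup>2 / (R\<^sup>2 + (norm x)\<^sup>2)\<^sup>2) *\<^sub>R x \<bullet> z
      = (b - R\<^sup>2) / b - (a - R\<^sup>2) / a - 2 * R\<^sup>2 / a\<^sup>2 * e"
    by (simp add: \<theta>_def a_def b_def e_def)
  also have "\<dots> = R\<^sup>2 * ((norm z)\<^sup>2 / (a * b)) - R\<^sup>2 * (2 * e * d / (a\<^sup>2 * b))"
  proof -
    have h1: "(b - R\<^sup>2) / b - (a - R\<^sup>2) / a = R\<^sup>2 * (d / (a * b))"
      using ab by (simp add: d_def diff_divide_distrib) (simp add: divide_simps, simp add: algebra_simps)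
    have "2 * e / a\<^sup>2 = 2 * e * (a + d) / (a\<^sup>2 * b)" using ab by (simp add: d_def)
    also have "\<dots> = 2 * e * a / (a\<^sup>2 * b) + 2 * e * d / (a\<^sup>2 * b)"
      by (simp add: distrib_left add_divide_distrib)
    also have "2 * e * a / (a\<^sup>2 * b) = 2 * e / (a * b)" using ab by (simp add: power2_eq_square)
    finally have h2: "2 * e / a\<^sup>2 = 2 * e / (a * b) + 2 * e * d / (a\<^sup>2 * b)" .
    have h3: "(norm z)\<^sup>2 / (a * b) = d / (a * b) - 2 * e / (a * b)"
      using d by (simp add: add_divide_distrib)
    have "2 * R\<^sup>2 / a\<^sup>2 * e = R\<^sup>2 * (2 * e / a\<^sup>2)" by simp
    then show ?thesis unfolding h1 h2 h3 by (simp only: right_diff_distrib distrib_left)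
  qed
  finally have eq: "\<theta> (x + z) - \<theta> x - (2 * R\<^sup>2 / (R\<^sup>2 + (norm x)\<^sup>2)\<^sup>2) *\<^sub>R x \<bullet> z
    = R\<^sup>2 * ((norm z)\<^sup>2 / (a * b)) - R\<^sup>2 * (2 * e * d / (a\<^sup>2 * b))" .
  have R4: "R\<^sup>2 * R\<^sup>2 \<le> a * b" using ab by (intro mult_mono) auto
  have t1: "R\<^sup>2 * ((norm z)\<^sup>2 / (a * b)) \<le> (norm z)\<^sup>2 / R\<^sup>2"
  proof -
    have "R\<^sup>2 * ((norm z)\<^sup>2 / (a * b)) \<le> R\<^sup>2 * ((norm z)\<^sup>2 / (R\<^sup>2 * R\<^sup>2))"
      using R4 assms(1) by (intro mult_left_mono divide_left_mono) (auto intro!: mult_pos_pos ab)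
    also have "\<dots> = (norm z)\<^sup>2 / R\<^sup>2" using assms(1) by (simp add: power2_eq_square)
    finally show ?thesis .
  qed
  have sq: "R \<le> sqrt a" "R \<le> sqrt b" using ab by (auto intro: real_le_rsqrt)
  have sab: "sqrt a * sqrt a = a" "sqrt b * sqrt b = b" using ab by auto
  have "\<bar>e * d\<bar> \<le> (sqrt a * norm z) * (norm z * (sqrt a + sqrt b))"
    unfolding abs_mult by (intro mult_mono e db) (use ab in auto)
  also have "\<dots> = (norm z)\<^sup>2 * (a + sqrt a * sqrt b)"
    using sab by (simp add: power2_eq_square algebra_simps)
  finally have ed: "\<bar>e * d\<bar> \<le> (norm z)\<^sup>2 * (a + sqrt a * sqrt b)" .
  have ra: "(a + sqrt a * sqrt b) / (a\<^sup>2 * b) \<le> 2 / (R\<^sup>2 * R\<^sup>2)"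
  proof -
    have "(a + sqrt a * sqrt b) / (a\<^sup>2 * b) = 1 / (a * b) + 1 / (a * (sqrt a * sqrt b))"
    proof -
      have "sqrt a * sqrt b / (a\<^sup>2 * b) = 1 / (a * (sqrt a * sqrt b))"
        using ab sab by (simp add: divide_simps power2_eq_square) (simp add: mult_ac)
      moreover have "a / (a\<^sup>2 * b) = 1 / (a * b)" using ab by (simp add: power2_eq_square)
      ultimately show ?thesis by (simp add: add_divide_distrib)
    qed
    also have "\<dots> \<le> 1 / (R\<^sup>2 * R\<^sup>2) + 1 / (R\<^sup>2 * R\<^sup>2)"
    proof (intro add_mono divide_left_mono)
      show "R\<^sup>2 * R\<^sup>2 \<le> a * (sqrt a * sqrt b)"
        unfolding power2_eq_square[of R] using ab sq assms(1)
        by (intro mult_mono) (auto simp: power2_eq_square)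
    qed (use R4 ab assms(1) in auto)
    finally show ?thesis by simp
  qed
  have t2: "\<bar>R\<^sup>2 * (2 * e * d / (a\<^sup>2 * b))\<bar> \<le> 4 * ((norm z)\<^sup>2 / R\<^sup>2)"
  proof -
    have "\<bar>R\<^sup>2 * (2 * e * d / (a\<^sup>2 * b))\<bar> = 2 * R\<^sup>2 * (\<bar>e * d\<bar> / (a\<^sup>2 * b))"
      using ab by (simp add: abs_mult)
    also have "\<dots> \<le> 2 * R\<^sup>2 * ((norm z)\<^sup>2 * (a + sqrt a * sqrt b) / (a\<^sup>2 * b))"
      using ed ab by (intro mult_left_mono divide_right_mono) auto
    also have "\<dots> = 2 * R\<^sup>2 * (norm z)\<^sup>2 * ((a + sqrt a * sqrt b) / (a\<^sup>2 * b))" by simp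
    also have "\<dots> \<le> 2 * R\<^sup>2 * (norm z)\<^sup>2 * (2 / (R\<^sup>2 * R\<^sup>2))"
      by (intro mult_left_mono ra) auto
    also have "\<dots> = 4 * ((norm z)\<^sup>2 / R\<^sup>2)" using assms(1) by (simp add: power2_eq_square)
    finally show ?thesis .
  qed
  have sub5: "\<bar>p - q\<bar> \<le> 5 * c" if "0 \<le> p" "p \<le> c" "\<bar>q\<bar> \<le> 4 * c" for p q c :: real
    using that by linarith
  have "0 \<le> R\<^sup>2 * ((norm z)\<^sup>2 / (a * b))" using ab by auto
  then have "\<bar>R\<^sup>2 * ((norm z)\<^sup>2 / (a * b)) - R\<^sup>2 * (2 * e * d / (a\<^sup>2 * b))\<bar> \<le> 5 * ((norm z)\<^sup>2 / R\<^sup>2)"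
    using t1 t2 sub5[of "R\<^sup>2 * ((norm z)\<^sup>2 / (a * b))" "(norm z)\<^sup>2 / R\<^sup>2"] by blast
  moreover have "(norm (z /\<^sub>R R))\<^sup>2 = (norm z)\<^sup>2 / R\<^sup>2"
    using assms(1) by (simp add: power_mult_distrib divide_inverse power_inverse mult.commute)
  ultimately show ?thesis unfolding eq by simp
qed

lemma DERIV_bump:
  fixes Q t :: real
  assumes "0 < Q + t"
  shows "((\<lambda>t. c - k * (t / (Q + t))) has_real_derivative - (k * (Q / (Q + t)\<^sup>2))) (at t)"
    and "((\<lambda>t. - (k * (Q / (Q + t)\<^sup>2))) has_real_derivative 2 * k * Q / (Q + t) ^ 3) (at t)"
proof -
  show "((\<lambda>t. c - k * (t / (Q + t))) has_real_derivative - (k * (Q / (Q + t)\<^sup>2))) (at t)"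
    using assms by (auto intro!: derivative_eq_intros simp: power2_eq_square right_diff_distrib[symmetric])
  have deriv: "((\<lambda>t. - (k * (Q / (Q + t)\<^sup>2))) has_real_derivative
      - (k * ((0 * (Q + t)\<^sup>2 - Q * (2 * (Q + t))) / ((Q + t)\<^sup>2 * (Q + t)\<^sup>2)))) (at t)"
    using assms by (auto intro!: derivative_eq_intros)
  have cube: "- (k * ((0 * w\<^sup>2 - Q * (2 * w)) / (w\<^sup>2 * w\<^sup>2))) = 2 * k * Q / w ^ 3" if "0 < w" for w :: real
    using that by (simp add: power2_eq_square power3_eq_cube mult_ac)
  show "((\<lambda>t. - (k * (Q / (Q + t)\<^sup>2))) has_real_derivative 2 * k * Q / (Q + t) ^ 3) (at t)"
    by (rule DERIV_cong[OF deriv cube[OF assms]])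
qed

lemma has_C2_bump:
  assumes "0 < R"
  shows "has_C2 UNIV (\<lambda>y::'a::euclidean_space. c - k * ((norm y)\<^sup>2 / (R\<^sup>2 + (norm y)\<^sup>2)))
     (\<lambda>y. - (k * (2 * R\<^sup>2 / (R\<^sup>2 + (norm y)\<^sup>2)\<^sup>2)) *\<^sub>R y)"
proof -
  have pos: "0 < R\<^sup>2 + (norm y)\<^sup>2" for y :: 'a using assms by (simp add: add_pos_nonneg)
  have "has_C2 UNIV (\<lambda>y::'a. (\<lambda>t. c - k * (t / (R\<^sup>2 + t))) ((norm (y - 0))\<^sup>2))
     (\<lambda>y. (\<lambda>t. - (k * (R\<^sup>2 / (R\<^sup>2 + t)\<^sup>2))) ((norm (y - 0))\<^sup>2) *\<^sub>R (2 *\<^sub>R (y - 0)))"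
  proof (rule has_C2_compose[OF has_C2_sq_dist, where h'' = "\<lambda>t. 2 * k * R\<^sup>2 / (R\<^sup>2 + t) ^ 3"])
    fix x :: 'a
    show "((\<lambda>t. c - k * (t / (R\<^sup>2 + t))) has_real_derivative - (k * (R\<^sup>2 / (R\<^sup>2 + (norm (x - 0))\<^sup>2)\<^sup>2)))
        (at ((norm (x - 0))\<^sup>2))"
      using pos[of x] by (intro DERIV_bump) simp
    show "((\<lambda>t. - (k * (R\<^sup>2 / (R\<^sup>2 + t)\<^sup>2))) has_real_derivative 2 * k * R\<^sup>2 / (R\<^sup>2 + (norm (x - 0))\<^sup>2) ^ 3)
        (at ((norm (x - 0))\<^sup>2))"
      using pos[of x] by (intro DERIV_bump) simp
  next
    show "continuous_on (range (\<lambda>x::'a. (norm (x - 0))\<^sup>2)) (\<lambda>t. 2 * k * R\<^sup>2 / (R\<^sup>2 + t) ^ 3)"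
      using pos by (auto intro!: continuous_intros simp: less_imp_neq[symmetric])
  qed
  then show ?thesis by (simp add: mult_ac)
qed

lemma has_C2_paraboloid:
  "has_C2 UNIV (\<lambda>y::'a::euclidean_space. c + k * (norm (y - a))\<^sup>2) (\<lambda>y. (2 * k) *\<^sub>R (y - a))"
proof -
  have "has_C2 UNIV (\<lambda>y::'a. (\<lambda>t. c + k * t) ((norm (y - a))\<^sup>2))
     (\<lambda>y. (\<lambda>t. k) ((norm (y - a))\<^sup>2) *\<^sub>R (2 *\<^sub>R (y - a)))"
    by (rule has_C2_compose[OF has_C2_sq_dist, where h'' = "\<lambda>t. 0"])
      (auto intro!: derivative_eq_intros continuous_intros)
  then show ?thesis by (simp add: mult.commute)
qed

section \<open>Mean and pointwise bounds for symmetric kernels\<close>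

lemma has_bochner_integral_weight_scale:
  assumes s: "0 < s" "s < 1" and R: "0 < R"
  shows "has_bochner_integral lebesgue (\<lambda>z::'a::euclidean_space. (R + norm z) powr (- real DIM('a) - 2 * s))
     (R powr (- 2 * s) * integral\<^sup>L lebesgue (weight s :: 'a \<Rightarrow> real))"
proof -
  let ?W = "integral\<^sup>L lebesgue (weight s :: 'a \<Rightarrow> real)" and ?p = "- real DIM('a) - 2 * s"
  have "has_bochner_integral lebesgue (\<lambda>z::'a. weight s (0 + inverse R *\<^sub>R z)) (?W / \<bar>inverse R\<bar> ^ DIM('a))"
    by (rule has_bochner_integral_lebesgue_affine[where f = "weight s" and t = 0 and c = "inverse R"])
      (use R in \<open>auto intro: has_bochner_integral_integrable integrable_weight s\<close>)
  then have *: "has_bochner_integral lebesgue (\<lambda>z::'a. R powr ?p * weight s (0 + inverse R *\<^sub>R z))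
      (R powr ?p * (?W / \<bar>inverse R\<bar> ^ DIM('a)))"
    by (rule has_bochner_integral_mult_right)
  have e1: "R powr ?p * weight s (0 + inverse R *\<^sub>R z) = (R + norm z) powr ?p" for z :: 'a
  proof -
    have "R * (1 + norm (inverse R *\<^sub>R z)) = R + norm z" using R by (simp add: field_simps)
    then show ?thesis
      using R powr_mult[of R "1 + norm (inverse R *\<^sub>R z)" ?p] by (simp add: weight_def)
  qed
  have e2: "R powr ?p * (?W / \<bar>inverse R\<bar> ^ DIM('a)) = R powr (- 2 * s) * ?W"
  proof -
    have "R powr ?p * R ^ DIM('a) = R powr (?p + real DIM('a))"
      using R by (simp only: powr_add powr_realpow)
    moreover have "?W / \<bar>inverse R\<bar> ^ DIM('a) = ?W * R ^ DIM('a)"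
      using R by (simp add: power_inverse divide_inverse)
    ultimately show ?thesis by simp
  qed
  show ?thesis using * unfolding e1 e2 .
qed

lemma integrable_shift_weight:
  fixes u :: "'a::euclidean_space \<Rightarrow> real"
  assumes u: "u \<in> L1_weight s" and s: "0 < s" "s < 1" and R: "1 \<le> R" and A: "A \<in> sets lebesgue"
  shows "integrable lebesgue (\<lambda>z. indicator A z * u (x + z) * (R + norm z) powr (- real DIM('a) - 2 * s))"
proof (rule Bochner_Integration.integrable_bound)
  have sh: "(\<lambda>z. u (z + x)) \<in> L1_weight s" using L1_weight_shift[OF u] s by simp
  then show "integrable lebesgue (\<lambda>z. u (z + x) * weight s z)" by (simp add: L1_weight_def)
  have "(\<lambda>z::'a. (R + norm z) powr (- real DIM('a) - 2 * s)) \<in> borel_measurable lebesgue"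
    by (intro measurable_completion) simp
  then show "(\<lambda>z. indicator A z * u (x + z) * (R + norm z) powr (- real DIM('a) - 2 * s)) \<in> borel_measurable lebesgue"
    using L1_weight_measurable[OF sh] A
    by (intro borel_measurable_times borel_measurable_indicator) (auto simp: add.commute)
  show "AE z in lebesgue. norm (indicator A z * u (x + z) * (R + norm z) powr (- real DIM('a) - 2 * s))
     \<le> norm (u (z + x) * weight s z)"
  proof (rule AE_I2)
    fix z :: 'a
    have "(R + norm z) powr (- real DIM('a) - 2 * s) \<le> weight s z"
      unfolding weight_def using R s by (intro powr_mono2') (auto simp: add_pos_nonneg)
    then show "norm (indicator A z * u (x + z) * (R + norm z) powr (- real DIM('a) - 2 * s))
     \<le> norm (u (z + x) * weight s z)"
      using weight_pos[of s z]
      by (cases "z \<in> A") (auto simp: abs_mult add.commute[of z x] intro!: mult_left_mono)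
  qed
qed

lemma min_scale_integral:
  assumes "0 < s" "s < 1" "0 < R"
  shows "has_bochner_integral lebesgue (\<lambda>z::'a::euclidean_space. min ((norm (z /\<^sub>R R))\<^sup>2) 1 * ker s z)
    (integral\<^sup>L lebesgue (\<lambda>z::'a. min ((norm z)\<^sup>2) 1 * ker s z) * R powr (- 2 * s))"
  by (rule has_bochner_integral_ker_scale[where f = "\<lambda>z. min ((norm z)\<^sup>2) 1"])
    (auto intro: has_bochner_integral_integrable integrable_min_ker_0 assms)

text \<open>The equation is tested from below with a bump of height comparable to \<^term>\<open>u 0\<close> and width
  \<^term>\<open>R\<close>: since the operator is nonlocal, the single contact point already controls a weighted mean
  of \<^term>\<open>u\<close>.\<close>

lemma supersolution_mean_bound:
  fixes u :: "'a::euclidean_space \<Rightarrow> real"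
  assumes s: "1/2 \<le> s" "s < 1" and lam: "0 < lam" "lam \<le> Lam" and m: "0 < m"
    and hom: "pos_homogeneous s I" and ell: "elliptic s (kernels_sym s lam Lam) I"
    and nonneg: "\<And>x. 0 \<le> u x" and cont: "continuous_on UNIV u"
    and super: "visc_supersolution s I (\<lambda>x r p. rpow (norm p) m) UNIV u"
  obtains C where "0 \<le> C" "\<And>R. 1 \<le> R \<Longrightarrow> \<exists>x. norm x \<le> R \<and>
     (\<integral>z. indicator (- ball 0 1) z * u (x + z) * (R + norm z) powr (- real DIM('a) - 2 * s) \<partial>lebesgue)
       \<le> C * (R powr (- 2 * s) + R powr (- m))"
proof -
  have s0: "0 < s" using s by simp
  define J where "J = integral\<^sup>L lebesgue (\<lambda>z::'a. min ((norm z)\<^sup>2) 1 * ker s z)"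
  define W where "W = integral\<^sup>L lebesgue (weight s :: 'a \<Rightarrow> real)"
  have J: "0 \<le> J" unfolding J_def by (intro integral_nonneg_AE AE_I2) auto
  have W: "0 \<le> W" unfolding W_def using weight_pos less_imp_le by (intro integral_nonneg_AE AE_I2) blast
  \<comment> \<open>The height makes the contact global: from radius R on the bump function \<theta>
    is at least 1/2, so the penalty is at least \<open>u 0 + 1\<close> there, while the minimum over
    the ball is at most \<open>u 0\<close>.\<close>
  define k where "k = 2 * (u 0 + 1)"
  have k: "2 \<le> k" "0 < k" using nonneg[of 0] by (auto simp: k_def)
  define C where "C = (k powr m + 5 * k * Lam * J) / lam + (u 0 + k) * W"
  have C: "0 \<le> C" unfolding C_def using k lam J W nonneg[of 0] by (intro add_nonneg_nonneg) auto
  have "\<exists>x. norm x \<le> R \<and>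
     (\<integral>z. indicator (- ball 0 1) z * u (x + z) * (R + norm z) powr (- real DIM('a) - 2 * s) \<partial>lebesgue)
       \<le> C * (R powr (- 2 * s) + R powr (- m))" if R1: "1 \<le> R" for R
  proof -
    have R: "0 < R" using R1 by simp
    let ?p = "- real DIM('a) - 2 * s"
    define \<theta> where "\<theta> y = (norm y)\<^sup>2 / (R\<^sup>2 + (norm y)\<^sup>2)" for y :: 'a
    have den: "0 < R\<^sup>2 + (norm y)\<^sup>2" for y :: 'a using R by (simp add: add_pos_nonneg)
    have \<theta>: "0 \<le> \<theta> y" "\<theta> y \<le> 1" for y using den[of y] by (auto simp: \<theta>_def)
    have \<theta>half: "1/2 \<le> \<theta> y" if "R \<le> norm y" for y
    proof -
      have "R\<^sup>2 \<le> (norm y)\<^sup>2" using that R by (intro power_mono) auto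
      then show ?thesis using den[of y] by (simp add: \<theta>_def field_simps)
    qed
    have "continuous_on (cball 0 R) (\<lambda>y. u y + k * \<theta> y)"
      unfolding \<theta>_def
      by (intro continuous_intros continuous_on_subset[OF cont] ballI less_imp_neq[OF den, symmetric]) auto
    then obtain x where x: "x \<in> cball 0 R" and minx: "\<And>y. y \<in> cball 0 R \<Longrightarrow> u x + k * \<theta> x \<le> u y + k * \<theta> y"
      using continuous_attains_inf[of "cball (0::'a) R" "\<lambda>y. u y + k * \<theta> y"] R by (auto simp: cball_eq_empty)
    have x0: "u x + k * \<theta> x \<le> u 0" using minx[of 0] R by (simp add: \<theta>_def)
    have glob: "u x + k * \<theta> x \<le> u y + k * \<theta> y" for y :: 'a
    proof (cases "norm y \<le> R")
      case False
      then have "k * (1/2) \<le> k * \<theta> y" using \<theta>half[of y] k by (intro mult_left_mono) auto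
      then show ?thesis using x0 nonneg[of y] by (simp add: k_def)
    qed (use minx[of y] in simp)
    define \<phi> where "\<phi> y = (u x + k * \<theta> x) - k * ((norm y)\<^sup>2 / (R\<^sup>2 + (norm y)\<^sup>2))" for y :: 'a
    have \<phi>: "\<phi> y = u x + k * \<theta> x - k * \<theta> y" for y by (simp add: \<phi>_def \<theta>_def)
    define g where "g = - (k * (2 * R\<^sup>2 / (R\<^sup>2 + (norm x)\<^sup>2)\<^sup>2)) *\<^sub>R x"
    have C2: "has_C2 UNIV \<phi> (\<lambda>y. - (k * (2 * R\<^sup>2 / (R\<^sup>2 + (norm y)\<^sup>2)\<^sup>2)) *\<^sub>R y)"
      unfolding \<phi>_def by (rule has_C2_bump[OF R])
    let ?G = "glue \<phi> x 1 u"
    have eq: "u x = \<phi> x" by (simp add: \<phi>)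
    have le: "\<phi> y \<le> u y" for y using glob[of y] by (simp add: \<phi>)
    have test: "I ?G x \<le> rpow (norm g) m" "?G \<in> L1_weight s" "expands ?G x g"
      using supersolution_test[OF super s0 s(2) C2 zero_less_one subset_UNIV eq le] by (simp_all only: g_def)
    \<comment> \<open>A bump of height k and width R has slope at most k / R. Through the
      Hamiltonian this is the source of the term \<open>R powr (- m)\<close>.\<close>
    have gR: "norm g \<le> k / R"
    proof -
      have "norm g = k * (2 * R\<^sup>2 * norm x / (R\<^sup>2 + (norm x)\<^sup>2)\<^sup>2)" using k by (simp add: g_def)
      also have "2 * R\<^sup>2 * norm x / (R\<^sup>2 + (norm x)\<^sup>2)\<^sup>2 \<le> 1 / R"
      proof -
        have "2 * R * norm x \<le> R\<^sup>2 + (norm x)\<^sup>2" by (rule sum_squares_bound)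
        then have "R\<^sup>2 * (2 * R * norm x) \<le> (R\<^sup>2 + (norm x)\<^sup>2) * (R\<^sup>2 + (norm x)\<^sup>2)"
          using R by (intro mult_mono) auto
        then show ?thesis using R den[of x] by (simp add: divide_simps power2_eq_square mult_ac)
      qed
      finally show ?thesis using k by (simp add: mult_left_mono)
    qed
    have gm: "rpow (norm g) m \<le> k powr m * R powr (- m)"
    proof -
      have "rpow (norm g) m \<le> (k / R) powr m" using gR m by (simp add: rpow_def powr_mono2)
      also have "\<dots> = k powr m / R powr m" using k R by (simp add: powr_divide)
      finally show ?thesis by (simp add: powr_minus divide_inverse)
    qed
    \<comment> \<open>A minorant of the excess of \<open>u\<close> over the test function, whose
      values are at most \<open>u 0 + k\<close>. The radius R in the weight keeps the constant part
      integrable at the origin, and makes the weight comparable with its translates by distances of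
      order R, which later allows a change of base point.\<close>
    define q where "q z = indicator (- ball 0 1) z * u (x + z) * (R + norm z) powr ?p
        - (u 0 + k) * (R + norm z) powr ?p" for z
    have wint: "has_bochner_integral lebesgue (\<lambda>z::'a. (R + norm z) powr ?p) (R powr (- 2 * s) * W)"
      unfolding W_def by (rule has_bochner_integral_weight_scale[OF s0 s(2) R])
    have uint: "integrable lebesgue (\<lambda>z. indicator (- ball 0 1) z * u (x + z) * (R + norm z) powr ?p)"
      by (rule integrable_shift_weight[OF _ s0 s(2) R1]) (use super in \<open>auto simp: visc_supersolution_def\<close>)
    have qint: "integrable lebesgue q"
      unfolding q_def using uint wint by (auto simp: has_bochner_integral_iff)
    have mint: "has_bochner_integral lebesgue (\<lambda>z::'a. min ((norm (z /\<^sub>R R))\<^sup>2) 1 * ker s z) (J * R powr (- 2 * s))"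
      unfolding J_def by (rule min_scale_integral[OF s0 s(2) R])
    have lower: "lam * integral\<^sup>L lebesgue q - 5 * k * Lam * (J * R powr (- 2 * s))
       \<le> nonlocal_op s K ?G x - nonlocal_op s K (\<lambda>_. 0) x" if K: "K \<in> kernels_sym s lam Lam" for K
    proof -
      have K': "K \<in> kernels s lam Lam" using K by (simp add: kernels_sym_def)
      define F where "F z = (?G (x + z) - ?G x - indicator (ball 0 1) z * (g \<bullet> z)) * K z" for z
      \<comment> \<open>Trades the unit ball of the compensator for the ball of radius R, on which
        the Taylor bound of the bump is sharp.\<close>
      define O' where "O' z = (indicator (ball 0 R) z - indicator (ball 0 1) z) * (g \<bullet> z) * K z" for z
      have O: "has_bochner_integral lebesgue O' 0"
        unfolding O'_def using lam by (intro annulus_odd[OF K s0 s(2)] R) auto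
      have Fint: "integrable lebesgue F"
        unfolding F_def using lam by (intro nonlocal_integrable[OF test(3,2) s K']) auto
      have "integral\<^sup>L lebesgue (\<lambda>z. lam * q z - 5 * k * Lam * (min ((norm (z /\<^sub>R R))\<^sup>2) 1 * ker s z))
          \<le> integral\<^sup>L lebesgue (\<lambda>z. F z - O' z)"
      proof (rule integral_mono_AE)
        show "integrable lebesgue (\<lambda>z. lam * q z - 5 * k * Lam * (min ((norm (z /\<^sub>R R))\<^sup>2) 1 * ker s z))"
          using qint mint by (auto simp: has_bochner_integral_iff)
        show "integrable lebesgue (\<lambda>z. F z - O' z)"
          using Fint O by (auto simp: has_bochner_integral_iff)
        show "AE z in lebesgue. lam * q z - 5 * k * Lam * (min ((norm (z /\<^sub>R R))\<^sup>2) 1 * ker s z) \<le> F z - O' z"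
          using AE_lebesgue_nonzero
        proof eventually_elim
          fix z :: 'a assume z: "z \<noteq> 0"
          define w where "w = \<phi> (x + z) - \<phi> x - indicator (ball 0 R) z * (g \<bullet> z)"
          \<comment> \<open>Outside the glued ball the operator sees \<open>u\<close> instead of the
            test function. This excess is nonnegative because the contact is global, so it may be
            paired with the lower kernel bound.\<close>
          define P where "P = indicator (- ball 0 1) z * (u (x + z) - \<phi> (x + z))"
          have P0: "0 \<le> P" using glob[of "x + z"] by (auto simp: P_def \<phi> indicator_def)
          have FO: "F z - O' z = (w + P) * K z"
          proof -
            have G: "?G (x + z) - ?G x = \<phi> (x + z) - \<phi> x + P"
              by (auto simp: glue_def P_def indicator_def dist_norm)
            have "F z - O' z = ((?G (x + z) - ?G x) - indicator (ball 0 R) z * (g \<bullet> z)) * K z"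
              by (simp add: F_def O'_def algebra_simps)
            also have "\<dots> = (w + P) * K z" unfolding G w_def by (simp add: algebra_simps)
            finally show ?thesis .
          qed
          have w: "\<bar>w\<bar> \<le> 5 * k * min ((norm (z /\<^sub>R R))\<^sup>2) 1"
          proof (cases "norm z < R")
            case True
            have "w = - k * (\<theta> (x + z) - \<theta> x - (2 * R\<^sup>2 / (R\<^sup>2 + (norm x)\<^sup>2)\<^sup>2) *\<^sub>R x \<bullet> z)"
              using True by (simp add: w_def \<phi> g_def algebra_simps)
            then have "\<bar>w\<bar> = k * \<bar>\<theta> (x + z) - \<theta> x - (2 * R\<^sup>2 / (R\<^sup>2 + (norm x)\<^sup>2)\<^sup>2) *\<^sub>R x \<bullet> z\<bar>"
              using k by (simp add: abs_mult)
            also have "\<dots> \<le> k * (5 * (norm (z /\<^sub>R R))\<^sup>2)"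
              unfolding \<theta>_def using k by (intro mult_left_mono bump_expansion[OF R]) auto
            also have "(norm (z /\<^sub>R R))\<^sup>2 = min ((norm (z /\<^sub>R R))\<^sup>2) 1"
            proof -
              have "norm (z /\<^sub>R R) \<le> 1" using True R by (simp add: field_simps)
              then have "(norm (z /\<^sub>R R))\<^sup>2 \<le> 1" by (intro power_le_one) auto
              then show ?thesis by (simp only: min_absorb1)
            qed
            finally show ?thesis by simp
          next
            case False
            have "w = k * (\<theta> x - \<theta> (x + z))"
              using False by (simp add: w_def \<phi> right_diff_distrib)
            then have "\<bar>w\<bar> = k * \<bar>\<theta> x - \<theta> (x + z)\<bar>"
              using k by (simp add: abs_mult)
            also have "\<dots> \<le> k * 1" using \<theta>[of x] \<theta>[of "x + z"] k by (intro mult_left_mono) auto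
            also have "\<dots> \<le> 5 * k * min ((norm (z /\<^sub>R R))\<^sup>2) 1"
            proof -
              have "1 \<le> norm (z /\<^sub>R R)" using False R by (simp add: field_simps)
              then have "1 \<le> (norm (z /\<^sub>R R))\<^sup>2" by (rule one_le_power)
              then have "min ((norm (z /\<^sub>R R))\<^sup>2) 1 = 1" by (rule min_absorb2)
              then show ?thesis using k by simp
            qed
            finally show ?thesis .
          qed
          have Kb: "lam * ker s z \<le> K z" "K z \<le> Lam * ker s z" using kernels_bounds[OF K' z] by auto
          have K0: "0 \<le> K z" using Kb lam by (meson ker_nonneg less_imp_le mult_nonneg_nonneg order_trans)
          have a: "- (5 * k * Lam * (min ((norm (z /\<^sub>R R))\<^sup>2) 1 * ker s z)) \<le> w * K z"
          proof -
            have "\<bar>w * K z\<bar> \<le> (5 * k * min ((norm (z /\<^sub>R R))\<^sup>2) 1) * (Lam * ker s z)"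
              unfolding abs_mult using w Kb K0 k by (intro mult_mono) auto
            then have "\<bar>w * K z\<bar> \<le> 5 * k * Lam * (min ((norm (z /\<^sub>R R))\<^sup>2) 1 * ker s z)"
              by (simp only: mult_ac)
            then show ?thesis by linarith
          qed
          have b: "lam * q z \<le> P * K z"
          proof -
            have wR: "(R + norm z) powr ?p \<le> ker s z" "0 \<le> (R + norm z) powr ?p"
              unfolding ker_def using R s0 z by (auto intro!: powr_mono2')
            have "q z \<le> P * (R + norm z) powr ?p"
            proof -
              have "indicator (- ball 0 1) z * u (x + z) - (u 0 + k) \<le> P"
              proof (cases "z \<in> ball 0 1")
                case True then show ?thesis using nonneg[of 0] k by (simp add: P_def)
              next
                case False
                have "\<phi> (x + z) \<le> u 0 + k"
                  unfolding \<phi> using x0 k mult_nonneg_nonneg[OF less_imp_le[OF k(2)] \<theta>(1)[of "x + z"]] by linarith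
                then show ?thesis using False by (simp add: P_def)
              qed
              from mult_right_mono[OF this wR(2)] show ?thesis by (simp add: q_def left_diff_distrib)
            qed
            also have "\<dots> \<le> P * ker s z" by (intro mult_left_mono wR P0)
            finally have "lam * q z \<le> lam * (P * ker s z)" using lam by (intro mult_left_mono) auto
            also have "\<dots> = P * (lam * ker s z)" by simp
            also have "\<dots> \<le> P * K z" by (intro mult_left_mono Kb P0)
            finally show ?thesis .
          qed
          show "lam * q z - 5 * k * Lam * (min ((norm (z /\<^sub>R R))\<^sup>2) 1 * ker s z) \<le> F z - O' z"
            unfolding FO using a b by (simp add: distrib_right)
        qed
      qed
      also have "\<dots> = nonlocal_op s K ?G x"
        using Fint O unfolding nonlocal_op_eq[OF test(3) s] F_def[symmetric]
        by (auto simp: has_bochner_integral_iff)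
      also have "\<dots> = nonlocal_op s K ?G x - nonlocal_op s K (\<lambda>_. 0) x"
        by (simp add: nonlocal_op_zero[OF s])
      finally show ?thesis
        using qint mint by (simp add: has_bochner_integral_iff)
    qed
    have "lam * integral\<^sup>L lebesgue q - 5 * k * Lam * (J * R powr (- 2 * s)) \<le> I ?G x - I (\<lambda>_. 0) x"
      by (rule elliptic_lower[OF ell expands_C11_at[OF test(3)] test(2) expands_C11_at[OF expands_zero] zero_L1_weight])
        (rule lower)
    then have "lam * integral\<^sup>L lebesgue q \<le> 5 * k * Lam * (J * R powr (- 2 * s)) + k powr m * R powr (- m)"
      using test(1) gm by (simp add: pos_homogeneous_zero[OF hom])
    also have "\<dots> \<le> (k powr m + 5 * k * Lam * J) * (R powr (- 2 * s) + R powr (- m))"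
      using k lam J by (simp add: algebra_simps)
    finally have "integral\<^sup>L lebesgue q \<le> (k powr m + 5 * k * Lam * J) / lam * (R powr (- 2 * s) + R powr (- m))"
      using lam by (simp add: field_simps)
    moreover have "integral\<^sup>L lebesgue q
       = (\<integral>z. indicator (- ball 0 1) z * u (x + z) * (R + norm z) powr ?p \<partial>lebesgue) - (u 0 + k) * (R powr (- 2 * s) * W)"
      unfolding q_def using uint wint by (simp add: has_bochner_integral_iff)
    moreover have "(u 0 + k) * (R powr (- 2 * s) * W) \<le> (u 0 + k) * W * (R powr (- 2 * s) + R powr (- m))"
      using nonneg[of 0] k W by (simp add: algebra_simps)
    ultimately have "(\<integral>z. indicator (- ball 0 1) z * u (x + z) * (R + norm z) powr ?p \<partial>lebesgue)
       \<le> C * (R powr (- 2 * s) + R powr (- m))"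
      unfolding C_def by (simp add: distrib_right)
    then show ?thesis using x by auto
  qed
  then show thesis using that C by blast
qed

text \<open>The power of r is pure scaling. Positivity of the constant matters, since it ends up as
  the factor of \<open>u x0\<close> in the pointwise bound; it follows from a unit ball about a
  point at distance 2, which lies in the shell 1 < |z| \<le> 3.\<close>

lemma ker_exterior:
  assumes s: "0 < s" "s < 1"
  obtains c where "0 < c" "\<And>r. 0 < r \<Longrightarrow>
    has_bochner_integral lebesgue (\<lambda>z::'a::euclidean_space. indicator (- ball 0 r) z * ker s z) (c * r powr (- 2 * s))"
proof -
  let ?f = "\<lambda>z::'a. indicator (- ball 0 1) z * ker s z"
  have int: "integrable lebesgue ?f"
  proof (rule Bochner_Integration.integrable_bound[OF integrable_min_ker_0[OF s]])
    show "?f \<in> borel_measurable lebesgue"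
      by (intro borel_measurable_times borel_measurable_indicator) auto
    show "AE z in lebesgue. norm (?f z) \<le> norm (min ((norm z)\<^sup>2) 1 * ker s z)"
      by (intro AE_I2) (auto simp: indicator_def min_def abs_square_le_1)
  qed
  define c where "c = integral\<^sup>L lebesgue ?f"
  obtain e :: 'a where e: "norm e = 1" using vector_choose_size[of 1] by auto
  have "0 < measure lebesgue (ball (2 *\<^sub>R e) 1) * 3 powr (- real DIM('a) - 2 * s)"
    using content_ball_pos[of 1 "2 *\<^sub>R e"] by simp
  also have "\<dots> = (\<integral>z. indicator (ball (2 *\<^sub>R e) 1) z * 3 powr (- real DIM('a) - 2 * s) \<partial>lebesgue)"
    by simp
  also have "\<dots> \<le> c"
    unfolding c_def
  proof (rule integral_mono[OF _ int])
    show "integrable lebesgue (\<lambda>z::'a. indicator (ball (2 *\<^sub>R e) 1) z * 3 powr (- real DIM('a) - 2 * s))"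
      using emeasure_bounded_finite[of "ball (2 *\<^sub>R e) 1"] by (intro integrable_mult_left) auto
    fix z :: 'a
    show "indicator (ball (2 *\<^sub>R e) 1) z * 3 powr (- real DIM('a) - 2 * s) \<le> ?f z"
    proof (cases "z \<in> ball (2 *\<^sub>R e) 1")
      case True
      then have "norm (z - 2 *\<^sub>R e) < 1" by (simp add: dist_norm norm_minus_commute)
      then have b: "1 < norm z" "norm z \<le> 3"
        using norm_triangle_ineq2[of "2 *\<^sub>R e" z] norm_triangle_ineq[of "z - 2 *\<^sub>R e" "2 *\<^sub>R e"] e
        by (auto simp: norm_minus_commute)
      then have "3 powr (- real DIM('a) - 2 * s) \<le> ker s z"
        unfolding ker_def using s by (intro powr_mono2') auto
      then show ?thesis using True b by simp
    qed simp
  qed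
  finally have "0 < c" .
  moreover have "has_bochner_integral lebesgue (\<lambda>z::'a. indicator (- ball 0 r) z * ker s z) (c * r powr (- 2 * s))"
    if r: "0 < r" for r
  proof -
    have "has_bochner_integral lebesgue (\<lambda>z::'a. indicator (- ball 0 1) (z /\<^sub>R r) * ker s z) (c * r powr (- 2 * s))"
      unfolding c_def by (rule has_bochner_integral_ker_scale[OF r, where f = "indicator (- ball 0 1)"])
        (rule has_bochner_integral_integrable[OF int])
    moreover have "indicator (- ball 0 1) (z /\<^sub>R r) = (indicator (- ball 0 r) z :: real)" for z :: 'a
      using r by (auto simp: indicator_def field_simps)
    ultimately show ?thesis by simp
  qed
  ultimately show thesis using that by blast
qed

text \<open>For a subsolution the converse holds: at a contact point with a paraboloid, the value of
  \<^term>\<open>u\<close> is controlled by its mean over the complement of a small ball.\<close>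

lemma subsolution_pointwise_bound:
  fixes u :: "'a::euclidean_space \<Rightarrow> real"
  assumes s: "1/2 \<le> s" "s < 1" and lam: "0 < lam" "lam \<le> Lam"
    and hom: "pos_homogeneous s I" and ell: "elliptic s (kernels_sym s lam Lam) I"
    and nonneg: "\<And>x. 0 \<le> u x" and cont: "continuous_on UNIV u"
    and sub: "visc_subsolution s I (\<lambda>x r p. rpow (norm p) m) UNIV u"
    and growth: "\<And>x. u x \<le> M * (1 + norm x) powr \<gamma>" and M: "0 < M" and \<gamma>: "0 < \<gamma>" "\<gamma> \<le> 2"
  obtains A B where "0 < A" "0 \<le> B"
    "\<And>x0 e. 1 \<le> norm x0 \<Longrightarrow> 0 < e \<Longrightarrow> e < 1 \<Longrightarrow> \<exists>x. norm x \<le> 2 * norm x0 \<and>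
      u x0 * A \<le> B * e\<^sup>2 * norm x0 powr \<gamma>
        + Lam * (e * norm x0) powr (2 * s)
          * (\<integral>z. indicator (- ball 0 (e * norm x0)) z * u (x + z) * ker s z \<partial>lebesgue)"
proof -
  have s0: "0 < s" using s by simp
  define J where "J = integral\<^sup>L lebesgue (\<lambda>z::'a. min ((norm z)\<^sup>2) 1 * ker s z)"
  have J: "0 \<le> J" unfolding J_def by (intro integral_nonneg_AE AE_I2) auto
  obtain c where c: "0 < c" "\<And>r. 0 < r \<Longrightarrow>
    has_bochner_integral lebesgue (\<lambda>z::'a. indicator (- ball 0 r) z * ker s z) (c * r powr (- 2 * s))"
    using ker_exterior[OF s0 s(2), where 'a = 'a] by blast
  have uL: "u \<in> L1_weight s" using sub by (simp add: visc_subsolution_def)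
  have "\<exists>x. norm x \<le> 2 * norm x0 \<and>
      u x0 * (lam * c) \<le> (9 * M * Lam * J) * e\<^sup>2 * norm x0 powr \<gamma>
        + Lam * (e * norm x0) powr (2 * s)
          * (\<integral>z. indicator (- ball 0 (e * norm x0)) z * u (x + z) * ker s z \<partial>lebesgue)"
    if R1: "1 \<le> norm x0" and e: "0 < e" "e < 1" for x0 e
  proof -
    define R where "R = norm x0"
    have R: "0 < R" "1 \<le> R" using R1 by (auto simp: R_def)
    \<comment> \<open>Steep enough that the paraboloid dominates \<open>u\<close> at distance
      \<open>d \<ge> R\<close> from \<open>x0\<close>: there 1 + |y| \<le> 3d,
      \<open>3 powr \<gamma> \<le> 9\<close>, and d^(\<gamma> - 2) is at most R^(\<gamma> - 2).
      Hence the maximum over the ball is a global one.\<close>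
    define A where "A = 9 * M * R powr (\<gamma> - 2)"
    have A: "0 < A" using M R by (simp add: A_def)
    \<comment> \<open>Gluing on the small scale e R makes the paraboloid cost only a multiple of e^2
      R^\<gamma>, with e still free.\<close>
    define r where "r = e * R"
    have r: "0 < r" using e R by (simp add: r_def)
    have far: "u y \<le> A * (norm (y - x0))\<^sup>2" if d: "R \<le> norm (y - x0)" for y
    proof -
      define d where "d = norm (y - x0)"
      have d: "R \<le> d" "1 \<le> d" "0 < d" using that R by (auto simp: d_def)
      have "1 + norm y \<le> 3 * d"
        using norm_triangle_sub[of y x0] d R by (simp add: d_def R_def)
      then have "(1 + norm y) powr \<gamma> \<le> (3 * d) powr \<gamma>" using \<gamma> by (intro powr_mono2) auto
      also have "\<dots> = 3 powr \<gamma> * d powr \<gamma>" using d by (simp add: powr_mult)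
      also have "\<dots> \<le> 9 * d powr \<gamma>"
        using powr_mono[of \<gamma> 2 3] \<gamma> by (intro mult_right_mono) auto
      also have "d powr \<gamma> = d\<^sup>2 * d powr (\<gamma> - 2)"
        using d by (simp add: powr_diff)
      also have "d powr (\<gamma> - 2) \<le> R powr (\<gamma> - 2)"
        using d R \<gamma> by (intro powr_mono2') auto
      finally have "(1 + norm y) powr \<gamma> \<le> 9 * (d\<^sup>2 * R powr (\<gamma> - 2))" by (simp add: mult_left_mono)
      then have "M * (1 + norm y) powr \<gamma> \<le> M * (9 * (d\<^sup>2 * R powr (\<gamma> - 2)))"
        using M by (intro mult_left_mono) auto
      then show ?thesis using growth[of y] by (simp add: A_def d_def mult_ac)
    qed
    have "continuous_on (cball x0 R) (\<lambda>y. u y - A * (norm (y - x0))\<^sup>2)"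
      by (intro continuous_intros continuous_on_subset[OF cont]) auto
    then obtain x where x: "x \<in> cball x0 R"
      and maxx: "\<And>y. y \<in> cball x0 R \<Longrightarrow> u y - A * (norm (y - x0))\<^sup>2 \<le> u x - A * (norm (x - x0))\<^sup>2"
      using continuous_attains_sup[of "cball x0 R" "\<lambda>y. u y - A * (norm (y - x0))\<^sup>2"] R by auto
    have top: "u x0 \<le> u x - A * (norm (x - x0))\<^sup>2" using maxx[of x0] R by simp
    have glob: "u y - A * (norm (y - x0))\<^sup>2 \<le> u x - A * (norm (x - x0))\<^sup>2" for y
    proof (cases "y \<in> cball x0 R")
      case False
      then show ?thesis using far[of y] top nonneg[of x0] by (simp add: dist_norm norm_minus_commute)
    qed (rule maxx)
    have ux: "u x0 \<le> u x" using top mult_nonneg_nonneg[OF less_imp_le[OF A] zero_le_power2[of "norm (x - x0)"]] by linarith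
    define \<phi> where "\<phi> y = (u x - A * (norm (x - x0))\<^sup>2) + A * (norm (y - x0))\<^sup>2" for y
    define g where "g = (2 * A) *\<^sub>R (x - x0)"
    have C2: "has_C2 UNIV \<phi> (\<lambda>y. (2 * A) *\<^sub>R (y - x0))"
      unfolding \<phi>_def by (rule has_C2_paraboloid)
    let ?G = "glue \<phi> x r u"
    have le: "u y \<le> \<phi> y" for y using glob[of y] by (simp add: \<phi>_def)
    have test: "rpow (norm g) m \<le> I ?G x" "?G \<in> L1_weight s" "expands ?G x g"
      using subsolution_test[OF sub s0 s(2) C2 r, of x] le by (auto simp: \<phi>_def g_def)
    have \<phi>z: "\<phi> (x + z) - \<phi> x = g \<bullet> z + A * (norm z)\<^sup>2" for z
      unfolding \<phi>_def g_def power2_norm_eq_inner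
      by (simp add: inner_diff_left inner_diff_right inner_add_left inner_add_right inner_commute algebra_simps)
    have c': "has_bochner_integral lebesgue (\<lambda>z::'a. indicator (- ball 0 r) z * ker s z) (c * r powr (- 2 * s))"
      by (rule c(2)[OF r])
    have mint: "has_bochner_integral lebesgue (\<lambda>z::'a. min ((norm (z /\<^sub>R r))\<^sup>2) 1 * ker s z) (J * r powr (- 2 * s))"
      unfolding J_def by (rule min_scale_integral[OF s0 s(2) r])
    let ?S = "\<integral>z. indicator (- ball 0 r) z * u (x + z) * ker s z \<partial>lebesgue"
    have uint: "integrable lebesgue (\<lambda>z. indicator (- ball 0 r) z * u (x + z) * ker s z)"
    proof (rule Bochner_Integration.integrable_bound)
      let ?c = "((1 + r) / r) powr (real DIM('a) + 2 * s)"
      have sh: "(\<lambda>z. u (z + x)) \<in> L1_weight s" using L1_weight_shift[OF uL] s0 by simp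
      then show "integrable lebesgue (\<lambda>z. ?c * (u (z + x) * weight s z))"
        unfolding L1_weight_def by (intro integrable_mult_right) simp
      show "(\<lambda>z. indicator (- ball 0 r) z * u (x + z) * ker s z) \<in> borel_measurable lebesgue"
        using L1_weight_measurable[OF sh]
        by (intro borel_measurable_times borel_measurable_indicator) (auto simp: add.commute)
      show "AE z in lebesgue. norm (indicator (- ball 0 r) z * u (x + z) * ker s z)
          \<le> norm (?c * (u (z + x) * weight s z))"
      proof (rule AE_I2)
        fix z :: 'a
        show "norm (indicator (- ball 0 r) z * u (x + z) * ker s z) \<le> norm (?c * (u (z + x) * weight s z))"
        proof (cases "z \<in> ball 0 r")
          case False
          then have "u (x + z) * ker s z \<le> u (x + z) * (?c * weight s z)"
            using s0 r by (intro mult_left_mono ker_le_weight nonneg) auto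
          then show ?thesis
            using False nonneg[of "x + z"] weight_pos[of s z] by (simp add: abs_mult add.commute mult_ac)
        qed simp
      qed
    qed
    have upper: "nonlocal_op s K ?G x - nonlocal_op s K (\<lambda>_. 0) x
       \<le> Lam * A * r\<^sup>2 * (J * r powr (- 2 * s)) + Lam * ?S - lam * u x * (c * r powr (- 2 * s))"
      if K: "K \<in> kernels_sym s lam Lam" for K
    proof -
      have K': "K \<in> kernels s lam Lam" using K by (simp add: kernels_sym_def)
      define F where "F z = (?G (x + z) - ?G x - indicator (ball 0 1) z * (g \<bullet> z)) * K z" for z
      define O' where "O' z = (indicator (ball 0 r) z - indicator (ball 0 1) z) * (g \<bullet> z) * K z" for z
      have O: "has_bochner_integral lebesgue O' 0"
        unfolding O'_def using lam by (intro annulus_odd[OF K s0 s(2)] r) auto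
      have Fint: "integrable lebesgue F"
        unfolding F_def using lam by (intro nonlocal_integrable[OF test(3,2) s K']) auto
      define Q where "Q z = Lam * A * r\<^sup>2 * (min ((norm (z /\<^sub>R r))\<^sup>2) 1 * ker s z)
          + Lam * (indicator (- ball 0 r) z * u (x + z) * ker s z) - lam * u x * (indicator (- ball 0 r) z * ker s z)" for z
      have "nonlocal_op s K ?G x - nonlocal_op s K (\<lambda>_. 0) x = integral\<^sup>L lebesgue F"
        unfolding nonlocal_op_eq[OF test(3) s] F_def[symmetric] by (simp add: nonlocal_op_zero[OF s])
      also have "\<dots> = integral\<^sup>L lebesgue (\<lambda>z. F z - O' z)"
        using Fint O by (auto simp: has_bochner_integral_iff)
      also have "\<dots> \<le> integral\<^sup>L lebesgue Q"
      proof (rule integral_mono_AE)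
        show "integrable lebesgue Q"
          unfolding Q_def using uint mint c' by (auto simp: has_bochner_integral_iff)
        show "integrable lebesgue (\<lambda>z. F z - O' z)"
          using Fint O by (auto simp: has_bochner_integral_iff)
        show "AE z in lebesgue. F z - O' z \<le> Q z"
          using AE_lebesgue_nonzero
        proof eventually_elim
          fix z :: 'a assume z: "z \<noteq> 0"
          have Kb: "lam * ker s z \<le> K z" "K z \<le> Lam * ker s z" using kernels_bounds[OF K' z] by auto
          have "F z - O' z = (?G (x + z) - ?G x - indicator (ball 0 r) z * (g \<bullet> z)) * K z"
            by (simp add: F_def O'_def algebra_simps)
          moreover have "?G x = u x" using r by (simp add: glue_def \<phi>_def)
          ultimately have FO: "F z - O' z = (?G (x + z) - u x - indicator (ball 0 r) z * (g \<bullet> z)) * K z" by simp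
          show "F z - O' z \<le> Q z"
          proof (cases "z \<in> ball 0 r")
            case True
            have "?G (x + z) - u x - g \<bullet> z = A * (norm z)\<^sup>2"
              using True \<phi>z[of z] by (simp add: glue_def dist_norm \<phi>_def)
            then have "F z - O' z = A * (norm z)\<^sup>2 * K z" using True by (simp add: FO)
            also have "\<dots> \<le> A * (norm z)\<^sup>2 * (Lam * ker s z)" using A by (intro mult_left_mono Kb) auto
            also have "\<dots> = Q z"
            proof -
              have "norm (z /\<^sub>R r) \<le> 1" using True r by (simp add: field_simps)
              then have "(norm (z /\<^sub>R r))\<^sup>2 \<le> 1" by (intro power_le_one) auto
              then have m: "min ((norm (z /\<^sub>R r))\<^sup>2) 1 = (norm (z /\<^sub>R r))\<^sup>2" by (rule min_absorb1)
              have "r\<^sup>2 * (norm (z /\<^sub>R r))\<^sup>2 = (norm z)\<^sup>2" using r by (simp add: field_simps)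
              then have "Lam * A * r\<^sup>2 * ((norm (z /\<^sub>R r))\<^sup>2 * ker s z) = A * (norm z)\<^sup>2 * (Lam * ker s z)"
                by (simp add: mult_ac)
              then show ?thesis unfolding Q_def m using True by auto
            qed
            finally show ?thesis .
          next
            case False
            have "F z - O' z = u (x + z) * K z - u x * K z"
              using False by (simp add: FO glue_def dist_norm algebra_simps)
            also have "\<dots> \<le> u (x + z) * (Lam * ker s z) - u x * (lam * ker s z)"
              by (intro diff_mono mult_left_mono Kb nonneg)
            also have "\<dots> \<le> Q z"
              using False A lam by (simp add: Q_def mult_ac)
            finally show ?thesis .
          qed
        qed
      qed
      also have "\<dots> = Lam * A * r\<^sup>2 * (J * r powr (- 2 * s)) + Lam * ?S - lam * u x * (c * r powr (- 2 * s))"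
        unfolding Q_def using uint mint c' by (simp add: has_bochner_integral_iff)
      finally show ?thesis .
    qed
    have "I ?G x - I (\<lambda>_. 0) x \<le> Lam * A * r\<^sup>2 * (J * r powr (- 2 * s)) + Lam * ?S - lam * u x * (c * r powr (- 2 * s))"
      by (rule elliptic_upper[OF ell expands_C11_at[OF test(3)] test(2) expands_C11_at[OF expands_zero] zero_L1_weight])
        (rule upper)
    \<comment> \<open>Of the Hamiltonian only its sign is used in this bound; its growth entered
      through the mean bound.\<close>
    moreover have "0 \<le> I ?G x" using test(1) by (auto simp: rpow_def split: if_splits intro: order_trans[rotated])
    ultimately have "lam * u x * (c * r powr (- 2 * s)) \<le> Lam * A * r\<^sup>2 * (J * r powr (- 2 * s)) + Lam * ?S"
      by (simp add: pos_homogeneous_zero[OF hom])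
    then have "r powr (2 * s) * (lam * u x * (c * r powr (- 2 * s)))
       \<le> r powr (2 * s) * (Lam * A * r\<^sup>2 * (J * r powr (- 2 * s)) + Lam * ?S)"
      by (intro mult_left_mono) auto
    moreover have "r powr (2 * s) * r powr (- 2 * s) = 1" using r by (simp add: powr_add[symmetric])
    ultimately have main: "lam * u x * c \<le> Lam * A * r\<^sup>2 * J + Lam * r powr (2 * s) * ?S"
      by (simp add: algebra_simps)
    have "u x0 * (lam * c) \<le> u x * (lam * c)" using ux lam c(1) by (intro mult_right_mono) auto
    also have "\<dots> \<le> Lam * A * r\<^sup>2 * J + Lam * r powr (2 * s) * ?S" using main by (simp add: mult_ac)
    also have "Lam * A * r\<^sup>2 * J = (9 * M * Lam * J) * e\<^sup>2 * R powr \<gamma>"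
      using R by (simp add: A_def r_def power_mult_distrib powr_diff)
    finally have "u x0 * (lam * c) \<le> (9 * M * Lam * J) * e\<^sup>2 * R powr \<gamma> + Lam * r powr (2 * s) * ?S" .
    moreover have "norm x \<le> 2 * R"
      using x norm_triangle_sub[of x x0] by (simp add: dist_norm norm_minus_commute R_def)
    ultimately show ?thesis unfolding R_def r_def by blast
  qed
  moreover have "0 < lam * c" "0 \<le> 9 * M * Lam * J" using lam c(1) M J by auto
  ultimately show thesis using that by blast
qed

text \<open>The pointwise bound lives at some point within 2 R of the origin, the mean bound at
  another within R. Their distance is at most 3 R, so the exterior integral at the first is
  controlled by the mean at the second. The factor e is fixed before R tends to infinity: the
  paraboloid takes half of \<eta>, and all other terms are of lower order in R.\<close>

lemma sym_solution_little_o: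
  fixes u :: "'a::euclidean_space \<Rightarrow> real"
  assumes s: "1/2 \<le> s" "s < 1" and lam: "0 < lam" "lam \<le> Lam" and m: "1 < m"
    and hom: "pos_homogeneous s I" and ell: "elliptic s (kernels_sym s lam Lam) I"
    and nonneg: "\<And>x. 0 \<le> u x"
    and sol: "visc_solution s I (\<lambda>x r p. rpow (norm p) m) UNIV u"
    and growth: "\<And>x. u x \<le> M * (1 + norm x) powr \<gamma>" and \<gamma>: "1 \<le> \<gamma>" "\<gamma> \<le> 2" and \<eta>: "0 < \<eta>"
  shows "\<forall>\<^sub>F x in at_infinity. u x \<le> \<eta> * norm x powr \<gamma>"
proof -
  have s0: "0 < s" using s by simp
  have cont: "continuous_on UNIV u" by (rule visc_solution_continuous[OF sol])
  define M' where "M' = max M 1"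
  have M': "0 < M'" by (simp add: M'_def)
  have growth': "u x \<le> M' * (1 + norm x) powr \<gamma>" for x
    by (rule order_trans[OF growth]) (auto simp: M'_def intro!: mult_right_mono)
  obtain C where C: "0 \<le> C" "\<And>R. 1 \<le> R \<Longrightarrow> \<exists>x. norm x \<le> R \<and>
     (\<integral>z. indicator (- ball 0 1) z * u (x + z) * (R + norm z) powr (- real DIM('a) - 2 * s) \<partial>lebesgue)
       \<le> C * (R powr (- 2 * s) + R powr (- m))"
  proof (rule supersolution_mean_bound[OF s lam _ hom ell nonneg cont])
    show "0 < m" using m by simp
    show "visc_supersolution s I (\<lambda>x r p. rpow (norm p) m) UNIV u" using sol by (simp add: visc_solution_def)
  qed (rule that)
  obtain A B where A: "0 < A" and B: "0 \<le> B" and AB: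
    "\<And>x0 e. 1 \<le> norm x0 \<Longrightarrow> 0 < e \<Longrightarrow> e < 1 \<Longrightarrow> \<exists>x. norm x \<le> 2 * norm x0 \<and>
      u x0 * A \<le> B * e\<^sup>2 * norm x0 powr \<gamma>
        + Lam * (e * norm x0) powr (2 * s)
          * (\<integral>z. indicator (- ball 0 (e * norm x0)) z * u (x + z) * ker s z \<partial>lebesgue)"
  proof (rule subsolution_pointwise_bound[OF s lam hom ell nonneg cont _ growth' M'])
    show "visc_subsolution s I (\<lambda>x r p. rpow (norm p) m) UNIV u" using sol by (simp add: visc_solution_def)
    show "0 < \<gamma>" "\<gamma> \<le> 2" using \<gamma> by auto
  qed (rule that)
  \<comment> \<open>Chosen so that \<open>B * e^2\<close> is at most half of
    \<open>\<eta> * A\<close>; the summand 1 covers \<open>B = 0\<close>.\<close>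
  define e where "e = min (1/2) (sqrt (\<eta> * A / (2 * B + 1)))"
  have e: "0 < e" "e < 1" using A B \<eta> by (auto simp: e_def)
  have "e\<^sup>2 \<le> (sqrt (\<eta> * A / (2 * B + 1)))\<^sup>2" using e by (intro power_mono) (auto simp: e_def)
  also have "\<dots> = \<eta> * A / (2 * B + 1)" using A B \<eta> by simp
  finally have "e\<^sup>2 * (2 * B + 1) \<le> \<eta> * A" using B by (simp add: field_simps)
  then have Be: "B * e\<^sup>2 \<le> \<eta> * A / 2" by (simp add: algebra_simps) (smt (verit) zero_le_power2)
  let ?p = "real DIM('a) + 2 * s"
  define w where "w = measure lebesgue (ball (0::'a) 1)"
  \<comment> \<open>The gain in the exponent of R. It is positive since \<gamma> + m > 2 > 2s. The
    second bound handles the term R^(2s - m); the bound 1 handles the unit ball missing from the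
    mean and, with \<gamma> \<ge> 1, the bounded term.\<close>
  define \<delta> where "\<delta> = min 1 (\<gamma> + m - 2 * s)"
  have \<delta>: "0 < \<delta>" "\<delta> \<le> 1" "\<delta> \<le> \<gamma> + m - 2 * s" using \<gamma> m s by (auto simp: \<delta>_def)
  define D where "D = Lam * e powr (2 * s) * ((1 + 4 / e) powr ?p * (C * 2) + M' * 9 * e powr (- ?p) * w)"
  have bound: "u x0 * A \<le> \<eta> * A / 2 * norm x0 powr \<gamma> + D * norm x0 powr (\<gamma> - \<delta>)" if R1: "1 \<le> norm x0" for x0
  proof -
    define R where "R = norm x0"
    have R: "1 \<le> R" "0 < R" using R1 by (auto simp: R_def)
    obtain x where x: "norm x \<le> 2 * R" and ux: "u x0 * A \<le> B * e\<^sup>2 * R powr \<gamma>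
        + Lam * (e * R) powr (2 * s) * (\<integral>z. indicator (- ball 0 (e * R)) z * u (x + z) * ker s z \<partial>lebesgue)"
      using AB[OF R1 e] unfolding R_def by blast
    obtain y where y: "norm y \<le> R" and uy:
      "(\<integral>z. indicator (- ball 0 1) z * u (y + z) * (R + norm z) powr (- real DIM('a) - 2 * s) \<partial>lebesgue)
       \<le> C * (R powr (- 2 * s) + R powr (- m))"
      using C(2)[OF R(1)] by blast
    define d where "d = x - y"
    have d: "norm d \<le> 3 * R" using x y norm_triangle_ineq4[of x y] by (simp add: d_def)
    define f where "f z = indicator (- ball 0 1) z * u (y + z) * (R + norm z) powr (- real DIM('a) - 2 * s)" for z
    have uL: "u \<in> L1_weight s" using sol by (simp add: visc_solution_def visc_subsolution_def)
    have fint: "integrable lebesgue f"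
      unfolding f_def by (rule integrable_shift_weight[OF uL s0 s(2) R(1)]) auto
    define c1 where "c1 = (1 + 4 / e) powr ?p"
    \<comment> \<open>The mean about y omits the unit ball around y. There \<open>u\<close> is
      bounded by its growth and the kernel by its value at radius e R; together with the prefactor
      R^(2s) this is of order R^(\<gamma> - n).\<close>
    define c2 where "c2 = M' * (2 + R) powr \<gamma> * (e * R) powr (- ?p)"
    have c12: "0 \<le> c1" "0 \<le> c2" using M' by (auto simp: c1_def c2_def)
    have f0: "0 \<le> f z" for z using nonneg by (auto simp: f_def)
    have f_shift: "has_bochner_integral lebesgue (\<lambda>z. f (d + 1 *\<^sub>R z)) (integral\<^sup>L lebesgue f / \<bar>1\<bar> ^ DIM('a))"
      using fint by (intro has_bochner_integral_lebesgue_affine has_bochner_integral_integrable) auto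
    have "has_bochner_integral lebesgue (indicator (ball (0::'a) 1)) w"
      unfolding w_def using emeasure_bounded_finite[of "ball (0::'a) 1"]
      by (intro has_bochner_integral_real_indicator) auto
    then have w_shift: "has_bochner_integral lebesgue (\<lambda>z. indicator (ball 0 1) (d + 1 *\<^sub>R z)) (w / \<bar>1\<bar> ^ DIM('a))"
      by (intro has_bochner_integral_lebesgue_affine) auto
    have "(\<integral>z. indicator (- ball 0 (e * R)) z * u (x + z) * ker s z \<partial>lebesgue)
      \<le> (\<integral>z. c1 * f (d + 1 *\<^sub>R z) + c2 * indicator (ball 0 1) (d + 1 *\<^sub>R z) \<partial>lebesgue)"
    proof (rule integral_mono')
      show "integrable lebesgue (\<lambda>z. c1 * f (d + 1 *\<^sub>R z) + c2 * indicator (ball 0 1) (d + 1 *\<^sub>R z))"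
        using f_shift w_shift by (auto simp: has_bochner_integral_iff)
      fix z :: 'a
      show "0 \<le> c1 * f (d + 1 *\<^sub>R z) + c2 * indicator (ball 0 1) (d + 1 *\<^sub>R z)"
        using c12 f0 by simp
      show "indicator (- ball 0 (e * R)) z * u (x + z) * ker s z
          \<le> c1 * f (d + 1 *\<^sub>R z) + c2 * indicator (ball 0 1) (d + 1 *\<^sub>R z)"
      proof (cases "z \<in> ball 0 (e * R)")
        case True
        then show ?thesis using c12 f0 by simp
      next
        case False
        then have z: "e * R \<le> norm z" by simp
        have eR: "0 < e * R" using e R by simp
        have z0: "0 < norm z" using z eR by linarith
        show ?thesis
        proof (cases "norm (d + z) < 1")
          case True
          have "norm (x + z) \<le> norm (d + z) + norm y"
            using norm_triangle_ineq[of "d + z" y] by (simp add: d_def)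
          then have "1 + norm (x + z) \<le> 2 + R" using True y by simp
          then have "u (x + z) \<le> M' * (2 + R) powr \<gamma>"
            using growth'[of "x + z"] M' \<gamma> by (smt (verit) mult_left_mono norm_ge_zero powr_mono2)
          moreover have "ker s z \<le> (e * R) powr (- ?p)"
            using ker_mono[OF _ eR z, of s] s0 by simp
          ultimately have "u (x + z) * ker s z \<le> c2"
            unfolding c2_def using M' by (intro mult_mono) auto
          moreover have "f (d + z) = 0" using True by (simp add: f_def)
          ultimately show ?thesis using True False by simp
        next
          case out: False
          \<comment> \<open>Since |z| \<ge> e R, the shift by d is absorbed: the singular kernel at
            z is at most a constant, depending on e, times the regularised weight at d + z.\<close>
          have "R + norm (d + z) \<le> 4 * R + norm z" using norm_triangle_ineq[of d z] d by simp
          also have "\<dots> \<le> (4 / e) * norm z + norm z"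
            using z e by (simp add: field_simps)
          finally have "(R + norm (d + z)) / (1 + 4 / e) \<le> norm z"
            using e by (subst pos_divide_le_eq) (auto simp: add_pos_pos algebra_simps)
          then have "ker s z \<le> ((R + norm (d + z)) / (1 + 4 / e)) powr (- ?p)"
            unfolding ker_def using R e s0 by (subst diff_conv_add_uminus, subst minus_add_distrib[symmetric])
              (intro powr_mono2', auto intro!: divide_pos_pos add_pos_pos add_pos_nonneg)
          also have "\<dots> = c1 * (R + norm (d + z)) powr (- ?p)"
            unfolding c1_def using R e
            by (subst powr_divide) (auto simp: powr_minus divide_inverse simp del: minus_add_distrib)
          finally have "u (x + z) * ker s z \<le> u (x + z) * (c1 * (R + norm (d + z)) powr (- ?p))"
            by (intro mult_left_mono nonneg)
          also have "\<dots> = c1 * f (d + z)"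
            using out by (simp add: f_def d_def add.commute)
          finally show ?thesis using False out by simp
        qed
      qed
    qed
    also have "\<dots> = c1 * integral\<^sup>L lebesgue f + c2 * w"
      using f_shift w_shift by (simp add: has_bochner_integral_iff)
    also have "\<dots> \<le> c1 * (C * (R powr (- 2 * s) + R powr (- m))) + c2 * w"
      using uy c12 unfolding f_def by (intro add_mono mult_left_mono) auto
    finally have S: "(\<integral>z. indicator (- ball 0 (e * R)) z * u (x + z) * ker s z \<partial>lebesgue)
      \<le> c1 * (C * (R powr (- 2 * s) + R powr (- m))) + c2 * w" .
    have p1: "R powr (2 * s) * (c1 * (C * (R powr (- 2 * s) + R powr (- m)))) \<le> c1 * (C * 2) * R powr (\<gamma> - \<delta>)"
    proof -
      have "R powr (2 * s) * R powr (- 2 * s) \<le> R powr (\<gamma> - \<delta>)"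
        unfolding powr_add[symmetric] using R \<delta> \<gamma> by (intro powr_mono) auto
      moreover have "R powr (2 * s) * R powr (- m) \<le> R powr (\<gamma> - \<delta>)"
        unfolding powr_add[symmetric] using R \<delta> \<gamma> by (intro powr_mono) auto
      ultimately have "R powr (2 * s) * (R powr (- 2 * s) + R powr (- m)) \<le> 2 * R powr (\<gamma> - \<delta>)"
        by (simp add: distrib_left)
      then have "(c1 * C) * (R powr (2 * s) * (R powr (- 2 * s) + R powr (- m))) \<le> (c1 * C) * (2 * R powr (\<gamma> - \<delta>))"
        using c12 C(1) by (intro mult_left_mono) auto
      then show ?thesis by (simp add: mult_ac)
    qed
    have p2: "R powr (2 * s) * (c2 * w) \<le> M' * 9 * e powr (- ?p) * w * R powr (\<gamma> - \<delta>)"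
    proof -
      have "(2 + R) powr \<gamma> \<le> (3 * R) powr \<gamma>" using R \<gamma> by (intro powr_mono2) auto
      also have "\<dots> = 3 powr \<gamma> * R powr \<gamma>" using R by (simp add: powr_mult)
      also have "\<dots> \<le> 9 * R powr \<gamma>"
        using powr_mono[of \<gamma> 2 3] \<gamma> by (intro mult_right_mono) auto
      finally have "(2 + R) powr \<gamma> \<le> 9 * R powr \<gamma>" .
      then have "R powr (2 * s) * ((2 + R) powr \<gamma> * R powr (- ?p)) \<le> R powr (2 * s) * (9 * R powr \<gamma> * R powr (- ?p))"
        by (intro mult_left_mono mult_right_mono) auto
      also have "\<dots> = 9 * R powr (2 * s + (\<gamma> + - ?p))" by (simp only: powr_add mult_ac)
      also have "\<dots> \<le> 9 * R powr (\<gamma> - \<delta>)"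
      proof -
        have "1 \<le> real DIM('a)" using DIM_positive[where 'a='a] by linarith
        then have "2 * s + (\<gamma> + - ?p) \<le> \<gamma> - \<delta>" using \<delta> by linarith
        then show ?thesis using R by (intro mult_left_mono powr_mono) auto
      qed
      finally have "R powr (2 * s) * ((2 + R) powr \<gamma> * R powr (- ?p)) \<le> 9 * R powr (\<gamma> - \<delta>)" .
      then have "(M' * e powr (- ?p) * w) * (R powr (2 * s) * ((2 + R) powr \<gamma> * R powr (- ?p)))
          \<le> (M' * e powr (- ?p) * w) * (9 * R powr (\<gamma> - \<delta>))"
        using M' by (intro mult_left_mono) (auto simp: w_def)
      moreover have "(e * R) powr (- ?p) = e powr (- ?p) * R powr (- ?p)" using e R by (simp only: powr_mult)
      ultimately show ?thesis unfolding c2_def by (simp only: mult_ac)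
    qed
    have eRp: "(e * R) powr (2 * s) = e powr (2 * s) * R powr (2 * s)" using e R by (simp only: powr_mult)
    have "Lam * (e * R) powr (2 * s) * (\<integral>z. indicator (- ball 0 (e * R)) z * u (x + z) * ker s z \<partial>lebesgue)
      \<le> Lam * (e * R) powr (2 * s) * (c1 * (C * (R powr (- 2 * s) + R powr (- m))) + c2 * w)"
      using S lam by (intro mult_left_mono) auto
    also have "Lam * (e * R) powr (2 * s) * (c1 * (C * (R powr (- 2 * s) + R powr (- m))) + c2 * w)
      = Lam * e powr (2 * s) * (R powr (2 * s) * (c1 * (C * (R powr (- 2 * s) + R powr (- m)))) + R powr (2 * s) * (c2 * w))"
      unfolding eRp by (simp only: distrib_left mult.assoc)
    also have "\<dots> \<le> Lam * e powr (2 * s) * (c1 * (C * 2) * R powr (\<gamma> - \<delta>) + M' * 9 * e powr (- ?p) * w * R powr (\<gamma> - \<delta>))"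
      using p1 p2 lam by (intro mult_left_mono add_mono) auto
    also have "\<dots> = D * R powr (\<gamma> - \<delta>)"
      by (simp only: D_def c1_def distrib_left distrib_right mult.assoc)
    finally have "u x0 * A \<le> B * e\<^sup>2 * R powr \<gamma> + D * R powr (\<gamma> - \<delta>)" using ux by linarith
    moreover have "B * e\<^sup>2 * R powr \<gamma> \<le> \<eta> * A / 2 * R powr \<gamma>" using Be by (intro mult_right_mono) auto
    ultimately show ?thesis unfolding R_def by linarith
  qed
  have "((\<lambda>R. D * R powr (- \<delta>)) \<longlongrightarrow> D * 0) at_top"
    using \<delta> by (intro tendsto_mult tendsto_const tendsto_neg_powr filterlim_ident) auto
  then have "\<forall>\<^sub>F R in at_top. D * R powr (- \<delta>) < \<eta> * A / 2"
    using A \<eta> by (intro order_tendstoD(2)) auto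
  then have "\<forall>\<^sub>F R in at_top. D * R powr (- \<delta>) < \<eta> * A / 2 \<and> 1 \<le> R"
    by (intro eventually_conj eventually_ge_at_top)
  then have "\<forall>\<^sub>F x in at_infinity. D * norm (x::'a) powr (- \<delta>) < \<eta> * A / 2 \<and> 1 \<le> norm x"
    using filterlim_norm_at_top by (rule eventually_compose_filterlim)
  then show ?thesis
  proof eventually_elim
    fix x :: 'a assume x: "D * norm x powr (- \<delta>) < \<eta> * A / 2 \<and> 1 \<le> norm x"
    have "D * norm x powr (\<gamma> - \<delta>) = D * norm x powr (- \<delta>) * norm x powr \<gamma>"
      by (simp add: powr_diff powr_minus divide_inverse)
    also have "\<dots> \<le> \<eta> * A / 2 * norm x powr \<gamma>" using x by (intro mult_right_mono) auto
    finally have "u x * A \<le> \<eta> * norm x powr \<gamma> * A" using bound[of x] x by (simp add: algebra_simps)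
    then show "u x \<le> \<eta> * norm x powr \<gamma>" using A by simp
  qed
qed

lemma Limsup_le_zero_of_little_o:
  fixes u :: "'a::euclidean_space \<Rightarrow> real"
  assumes "\<And>\<eta>. 0 < \<eta> \<Longrightarrow> \<forall>\<^sub>F x in at_infinity. u x \<le> \<eta> * norm x powr \<gamma>" and nonneg: "\<And>x. 0 \<le> u x"
  shows "Limsup at_infinity (\<lambda>x. ereal (\<bar>u x\<bar> / norm x powr \<gamma>)) \<le> 0"
proof (rule ereal_le_epsilon2)
  fix \<eta> :: real assume \<eta>: "0 < \<eta>"
  have "\<forall>\<^sub>F x in at_infinity. ereal (\<bar>u x\<bar> / norm x powr \<gamma>) \<le> ereal \<eta>"
    using assms(1)[OF \<eta>] eventually_not_equal_at_infinity[of 0]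
  proof eventually_elim
    fix x :: 'a assume "u x \<le> \<eta> * norm x powr \<gamma>" "x \<noteq> 0"
    then show "ereal (\<bar>u x\<bar> / norm x powr \<gamma>) \<le> ereal \<eta>"
      using nonneg[of x] by (simp add: divide_le_eq)
  qed
  then show "Limsup at_infinity (\<lambda>x. ereal (\<bar>u x\<bar> / norm x powr \<gamma>)) \<le> 0 + ereal \<eta>"
    by (simp add: Limsup_bounded)
qed

section \<open>The doubling argument\<close>

lemma rpow_nonneg: "0 \<le> rpow x m"
  by (simp add: rpow_def)

lemma rpow_mono: "0 \<le> x \<Longrightarrow> x \<le> y \<Longrightarrow> 0 \<le> m \<Longrightarrow> rpow x m \<le> rpow y m"
  by (simp add: rpow_def powr_mono2)

lemma rpow_mult: "0 < c \<Longrightarrow> 0 \<le> x \<Longrightarrow> rpow (c * x) m = c powr m * rpow x m"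
  by (simp add: rpow_def powr_mult)

text \<open>This is where \<^prop>\<open>q + m > 1\<close> enters: in terms of \<open>1 + u\<close> the Hamiltonian grows faster than
  linearly, which leaves room for an error in the gradient.\<close>

lemma hamiltonian_compare:
  assumes qm: "0 \<le> q" "0 \<le> m" "1 < q + m" and ab: "0 \<le> b" "b \<le> a"
    and f: "0 \<le> f" "exp f * (1 + b) \<le> 1 + a"
    and P: "0 \<le> P'" "P' * exp (- ((q + m - 1) / (m + 1)) * f) \<le> P"
  shows "rpow b q * rpow ((1 + b) * P') m / (1 + b) \<le> rpow a q * rpow ((1 + a) * P) m / (1 + a)"
proof -
  \<comment> \<open>The exponent satisfies k m \<le> q + m - 1, so the loss exp(- k f) in the
    gradient, raised to the power m, is paid for by the surplus t^(q + m - 1). The denominator m + 1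
    in place of m keeps the case m = 0.\<close>
  define k where "k = (q + m - 1) / (m + 1)"
  define t where "t = (1 + a) / (1 + b)"
  have t: "exp f \<le> t" "1 + a = t * (1 + b)" using f ab by (simp_all add: t_def field_simps)
  have "1 \<le> exp f" using f by simp
  then have t1: "1 \<le> t" "0 < t" using t(1) by linarith+
  have lnt: "f \<le> ln t" using t(1) t1 by (simp add: ln_ge_iff)
  \<comment> \<open>Equivalent to \<open>b \<le> a\<close>: passing from b to a multiplies the
    solution by at least the factor t gained by the shifted values.\<close>
  have "t * b \<le> a" using ab by (simp add: t_def field_simps)
  then have 1: "t powr q * rpow b q \<le> rpow a q"
    using rpow_mono[of "t * b" a q] rpow_mult[of t b q] t1 ab qm by simp
  have "(t * exp (- k * f)) * ((1 + b) * P') = (1 + a) * (P' * exp (- k * f))" by (simp add: t(2))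
  also have "\<dots> \<le> (1 + a) * P" using P ab by (intro mult_left_mono) (auto simp: k_def)
  finally have "rpow ((t * exp (- k * f)) * ((1 + b) * P')) m \<le> rpow ((1 + a) * P) m"
    using t1 ab P qm by (intro rpow_mono) auto
  then have 2: "(t * exp (- k * f)) powr m * rpow ((1 + b) * P') m \<le> rpow ((1 + a) * P) m"
    using rpow_mult[of "t * exp (- k * f)" "(1 + b) * P'" m] t1 ab P by simp
  have "k * m \<le> q + m - 1"
  proof -
    have "(q + m - 1) * (m / (m + 1)) \<le> (q + m - 1) * 1" using qm by (intro mult_left_mono) auto
    then show ?thesis by (simp add: k_def)
  qed
  then have "(k * m) * f \<le> (q + m - 1) * ln t"
    using f qm lnt by (intro mult_mono) auto
  then have "0 \<le> q * ln t + m * (ln t - k * f) - ln t" by (simp add: algebra_simps)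
  moreover have "t powr q * (t * exp (- k * f)) powr m / t = exp (q * ln t + m * (ln t - k * f) - ln t)"
    using t1 by (simp add: powr_def ln_mult exp_add exp_diff)
  ultimately have 3: "1 \<le> t powr q * (t * exp (- k * f)) powr m / t" by simp
  have "rpow b q * rpow ((1 + b) * P') m / (1 + b)
    \<le> (t powr q * (t * exp (- k * f)) powr m / t) * (rpow b q * rpow ((1 + b) * P') m / (1 + b))"
    using mult_right_mono[OF 3, of "rpow b q * rpow ((1 + b) * P') m / (1 + b)"] ab rpow_nonneg by auto
  also have "\<dots> = (t powr q * rpow b q) * ((t * exp (- k * f)) powr m * rpow ((1 + b) * P') m) / (1 + a)"
    using t1 ab by (simp add: t(2) divide_simps)
  also have "\<dots> \<le> rpow a q * rpow ((1 + a) * P) m / (1 + a)"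
    using 1 2 ab by (intro divide_right_mono mult_mono) (auto simp: rpow_nonneg)
  finally show ?thesis .
qed

section \<open>Increments of the square root of the norm\<close>

lemma sqrt_norm_diff:
  fixes x y :: "'a::real_normed_vector"
  assumes "y \<noteq> 0"
  shows "\<bar>sqrt (norm x) - sqrt (norm y)\<bar> \<le> norm (x - y) / sqrt (norm y)"
proof -
  have "(sqrt (norm x) - sqrt (norm y)) * (sqrt (norm x) + sqrt (norm y)) = norm x - norm y"
    by (simp add: algebra_simps)
  then have "\<bar>sqrt (norm x) - sqrt (norm y)\<bar> * (sqrt (norm x) + sqrt (norm y)) = \<bar>norm x - norm y\<bar>"
    by (metis abs_mult abs_of_nonneg add_nonneg_nonneg norm_ge_zero real_sqrt_ge_zero)
  moreover have "\<bar>sqrt (norm x) - sqrt (norm y)\<bar> * sqrt (norm y)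
     \<le> \<bar>sqrt (norm x) - sqrt (norm y)\<bar> * (sqrt (norm x) + sqrt (norm y))"
    by (intro mult_left_mono) auto
  ultimately have "\<bar>sqrt (norm x) - sqrt (norm y)\<bar> * sqrt (norm y) \<le> norm (x - y)"
    using norm_triangle_ineq3[of x y] by linarith
  then show ?thesis using assms by (simp add: pos_le_divide_eq)
qed

lemma sqrt_norm_subadd: "sqrt (norm (x + y)) \<le> sqrt (norm x) + sqrt (norm y)"
  by (rule order_trans[OF real_sqrt_le_mono[OF norm_triangle_ineq] sqrt_add_le_add_sqrt]) auto

text \<open>The last hypothesis says that \<^term>\<open>z\<close> lies in a narrow double cone around \<^term>\<open>w\<close>.\<close>

lemma sqrt_norm_concave:
  fixes w z :: "'a::real_inner"
  assumes w: "w \<noteq> 0" and z: "norm z \<le> norm w / 5" and dir: "9/10 * (norm w)\<^sup>2 * (norm z)\<^sup>2 \<le> (w \<bullet> z)\<^sup>2"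
  shows "sqrt (norm (w + z)) + sqrt (norm (w - z)) \<le> 2 * sqrt (norm w) * (1 - (norm z / norm w)\<^sup>2 / 16)"
proof -
  define t y where "t = norm w" and "y = norm z / norm w"
  have t: "0 < t" using w by (simp add: t_def)
  have y: "0 \<le> y" "y \<le> 1/5" using z t by (auto simp: y_def t_def field_simps)
  have zy: "norm z = t * y" using t by (simp add: y_def t_def)
  define P N where "P = norm (w + z)" and "N = norm (w - z)"
  have PN: "0 \<le> P" "0 \<le> N" by (auto simp: P_def N_def)
  have P2: "P\<^sup>2 = t\<^sup>2 + (norm z)\<^sup>2 + 2 * (w \<bullet> z)" and N2: "N\<^sup>2 = t\<^sup>2 + (norm z)\<^sup>2 - 2 * (w \<bullet> z)"
    unfolding P_def N_def t_def power2_norm_eq_inner by (simp_all add: inner_add inner_diff inner_commute)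
  have y2: "y\<^sup>2 \<le> 1/25" using power_mono[OF y(2,1), of 2] by (simp add: power_divide)
  \<comment> \<open>The product P N, the sum P + N and the sum of the roots are bounded in turn,
    each time by comparing squares. Expansions of roots are avoided, and every constant leaves just
    enough slack in y^2 to cover the terms in y^4.\<close>
  have "(P * N)\<^sup>2 = (t\<^sup>2 + (norm z)\<^sup>2)\<^sup>2 - 4 * (w \<bullet> z)\<^sup>2"
    unfolding power_mult_distrib P2 N2 by (simp add: power2_eq_square algebra_simps)
  also have "\<dots> \<le> (t\<^sup>2 + (norm z)\<^sup>2)\<^sup>2 - 4 * (9/10 * t\<^sup>2 * (norm z)\<^sup>2)"
    using dir by (simp add: t_def)
  also have "\<dots> = (t\<^sup>2)\<^sup>2 * ((1 + y\<^sup>2)\<^sup>2 - 18/5 * y\<^sup>2)"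
    unfolding zy by (simp add: power2_eq_square algebra_simps)
  also have "\<dots> \<le> (t\<^sup>2)\<^sup>2 * (1 - 3/4 * y\<^sup>2)\<^sup>2"
  proof (intro mult_left_mono)
    have "0 \<le> y\<^sup>2 * (1/10 - 7/16 * y\<^sup>2)" using y2 by (intro mult_nonneg_nonneg) auto
    then show "(1 + y\<^sup>2)\<^sup>2 - 18/5 * y\<^sup>2 \<le> (1 - 3/4 * y\<^sup>2)\<^sup>2"
      by (simp add: power2_eq_square algebra_simps)
  qed simp
  also have "\<dots> = (t\<^sup>2 * (1 - 3/4 * y\<^sup>2))\<^sup>2" by (simp add: power_mult_distrib)
  finally have K: "P * N \<le> t\<^sup>2 * (1 - 3/4 * y\<^sup>2)"
    by (rule power2_le_imp_le) (use y2 in simp)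
  have "(P + N)\<^sup>2 = 2 * t\<^sup>2 + 2 * (norm z)\<^sup>2 + 2 * (P * N)"
    unfolding power2_sum P2 N2 by simp
  also have "\<dots> \<le> 2 * t\<^sup>2 + 2 * (t * y)\<^sup>2 + 2 * (t\<^sup>2 * (1 - 3/4 * y\<^sup>2))"
    using K by (simp add: zy)
  also have "\<dots> = t\<^sup>2 * (4 + 1/2 * y\<^sup>2)" by (simp add: power2_eq_square algebra_simps)
  also have "\<dots> \<le> t\<^sup>2 * (2 + 1/8 * y\<^sup>2)\<^sup>2"
  proof (rule mult_left_mono)
    have "(2 + 1/8 * y\<^sup>2)\<^sup>2 = 4 + 1/2 * y\<^sup>2 + (1/8 * y\<^sup>2)\<^sup>2"
      by (simp add: power2_eq_square algebra_simps)
    then show "4 + 1/2 * y\<^sup>2 \<le> (2 + 1/8 * y\<^sup>2)\<^sup>2" by simp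
  qed simp
  also have "\<dots> = (t * (2 + 1/8 * y\<^sup>2))\<^sup>2" by (simp add: power_mult_distrib)
  finally have S: "P + N \<le> t * (2 + 1/8 * y\<^sup>2)" by (rule power2_le_imp_le) (use t in simp)
  have Q: "sqrt P * sqrt N \<le> t * (1 - 3/8 * y\<^sup>2)"
  proof -
    have "(1 - 3/8 * y\<^sup>2)\<^sup>2 = 1 - 3/4 * y\<^sup>2 + (3/8 * y\<^sup>2)\<^sup>2"
      by (simp add: power2_eq_square algebra_simps)
    then have "1 - 3/4 * y\<^sup>2 \<le> (1 - 3/8 * y\<^sup>2)\<^sup>2" by simp
    then have "t\<^sup>2 * (1 - 3/4 * y\<^sup>2) \<le> t\<^sup>2 * (1 - 3/8 * y\<^sup>2)\<^sup>2" by (intro mult_left_mono) auto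
    then have "P * N \<le> (t * (1 - 3/8 * y\<^sup>2))\<^sup>2" using K by (simp add: power_mult_distrib)
    then have "sqrt (P * N) \<le> t * (1 - 3/8 * y\<^sup>2)" using t y2 by (intro real_le_lsqrt) auto
    then show ?thesis by (simp add: real_sqrt_mult)
  qed
  have "(sqrt P + sqrt N)\<^sup>2 = P + N + 2 * (sqrt P * sqrt N)"
    unfolding power2_sum using PN by simp
  also have "\<dots> \<le> t * (2 + 1/8 * y\<^sup>2) + 2 * (t * (1 - 3/8 * y\<^sup>2))" using S Q by linarith
  also have "\<dots> = t * (4 - 5/8 * y\<^sup>2)" by (simp add: algebra_simps)
  also have "\<dots> \<le> t * (2 * (1 - y\<^sup>2 / 16))\<^sup>2"
  proof (rule mult_left_mono)
    have "(2 * (1 - y\<^sup>2 / 16))\<^sup>2 = 4 - 1/2 * y\<^sup>2 + (1/8 * y\<^sup>2)\<^sup>2"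
      by (simp add: power2_eq_square algebra_simps)
    moreover have "0 \<le> y\<^sup>2" "0 \<le> (1/8 * y\<^sup>2)\<^sup>2" by simp_all
    ultimately show "4 - 5/8 * y\<^sup>2 \<le> (2 * (1 - y\<^sup>2 / 16))\<^sup>2" by linarith
  qed (use t in simp)
  also have "\<dots> = (2 * sqrt t * (1 - y\<^sup>2 / 16))\<^sup>2"
    by (simp only: power_mult_distrib real_sqrt_pow2[OF less_imp_le[OF t]] mult_ac)
  finally have "sqrt P + sqrt N \<le> 2 * sqrt t * (1 - y\<^sup>2 / 16)"
    by (rule power2_le_imp_le) (use t y2 in simp)
  then show ?thesis by (simp add: P_def N_def t_def y_def)
qed

section \<open>Pointwise estimates for normalised increments\<close>

lemma abs_exp_minus_one:
  fixes x L :: real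
  assumes "x \<le> L" "0 \<le> L"
  shows "\<bar>exp x - 1\<bar> \<le> exp L * \<bar>x\<bar>"
proof (cases "0 \<le> x")
  case True
  have "1 - x \<le> exp (- x)" using exp_ge_add_one_self[of "- x"] by simp
  then have "(1 - x) * exp x \<le> exp (- x) * exp x" by (intro mult_right_mono) auto
  then have "exp x - 1 \<le> exp x * x" by (simp add: exp_minus algebra_simps)
  also have "\<dots> \<le> exp L * x" using assms True by (intro mult_right_mono) auto
  finally show ?thesis using True by simp
next
  case False
  then have "\<bar>exp x - 1\<bar> = 1 - exp x" by simp
  also have "\<dots> \<le> \<bar>x\<bar>" using exp_ge_add_one_self[of x] False by linarith
  also have "\<dots> \<le> exp L * \<bar>x\<bar>"
    using mult_right_mono[of 1 "exp L" "\<bar>x\<bar>"] assms by simp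
  finally show ?thesis .
qed

text \<open>The arithmetic-geometric mean inequality bounds the logarithmic gradient of the penalty
  uniformly in x, whereas the gradient of the quadratic itself is unbounded.\<close>

lemma penalty_gradient:
  fixes x :: "'a::real_normed_vector"
  assumes "0 < \<rho>"
  shows "2 * norm x / (\<rho>\<^sup>2 + (norm x)\<^sup>2) \<le> 1 / \<rho>"
  using sum_squares_bound[of \<rho> "norm x"] assms
  by (simp add: divide_simps add_pos_nonneg) (simp add: power2_eq_square mult_ac)

text \<open>X and Y stand for the increment ratios of \<open>v\<close> at the two contact points, E
  for that of the penalty. The three inequalities arise from moving both points by z, only the
  first, or only the second. The linear part of E cancels against the compensator; what is left is
  quadratic in z with a factor 1 / \<rho>, minus the concavity gain.\<close>

lemma near_estimate:
  fixes w z x :: "'a::real_inner"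
  assumes w: "w \<noteq> 0" and L: "0 \<le> L" and \<rho>: "1 \<le> \<rho>" and z: "norm z \<le> 1"
    and E: "E = 1 + (2 * (x \<bullet> z) + (norm z)\<^sup>2) / (\<rho>\<^sup>2 + (norm x)\<^sup>2)" "0 \<le> E"
    and XY: "X \<le> E * Y" and Xa: "X \<le> E * exp (L * (sqrt (norm (w + z)) - sqrt (norm w)))"
    and Yb: "exp (L * (sqrt (norm w) - sqrt (norm (w - z)))) \<le> Y"
  shows "X - Y - (2 / (\<rho>\<^sup>2 + (norm x)\<^sup>2)) *\<^sub>R x \<bullet> z
    \<le> exp L * (1 + L) * ((1 + 1 / sqrt (norm w)) / \<rho>) * (norm z)\<^sup>2
       - max 0 (exp (L * (sqrt (norm w) - sqrt (norm (w - z)))) - exp (L * (sqrt (norm (w + z)) - sqrt (norm w))))"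
proof -
  define A B where "A = L * (sqrt (norm (w + z)) - sqrt (norm w))" and "B = L * (sqrt (norm w) - sqrt (norm (w - z)))"
  have sz: "sqrt (norm z) \<le> 1" using z by simp
  define c where "c = L * (norm z / sqrt (norm w))"
  have c: "0 \<le> c" using L by (simp add: c_def)
  have AL: "A \<le> L"
  proof -
    have "sqrt (norm (w + z)) - sqrt (norm w) \<le> 1" using sqrt_norm_subadd[of w z] sz by linarith
    from mult_left_mono[OF this L] show ?thesis by (simp add: A_def)
  qed
  have BL: "B \<le> L"
  proof -
    have "sqrt (norm w) - sqrt (norm (w - z)) \<le> 1" using sqrt_norm_subadd[of "w - z" z, unfolded diff_add_cancel] sz by linarith
    from mult_left_mono[OF this L] show ?thesis by (simp add: B_def)
  qed
  have Ac: "\<bar>A\<bar> \<le> c"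
    using mult_left_mono[OF sqrt_norm_diff[OF w, of "w + z"] L] L by (simp add: A_def c_def abs_mult)
  have Bc: "\<bar>B\<bar> \<le> c"
    using mult_left_mono[OF sqrt_norm_diff[OF w, of "w - z"] L] L
    by (simp add: B_def c_def abs_mult abs_minus_commute)
  have a1: "\<bar>exp A - 1\<bar> \<le> exp L * c"
    by (rule order_trans[OF abs_exp_minus_one[OF AL L]]) (use Ac in \<open>auto intro: mult_left_mono\<close>)
  have b1: "\<bar>exp B - 1\<bar> \<le> exp L * c"
    by (rule order_trans[OF abs_exp_minus_one[OF BL L]]) (use Bc in \<open>auto intro: mult_left_mono\<close>)
  \<comment> \<open>Merges the two upper bounds for X into \<open>X \<le> E * \<mu>\<close>. Below Y
    it leaves at least the concavity gain, and it differs from 1 by first order in |z|, so its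
    product with the linear part of E is quadratic.\<close>
  define \<mu> where "\<mu> = min Y (exp A)"
  have mu: "\<mu> \<le> exp A" "\<mu> \<le> Y" "min (exp B) (exp A) \<le> \<mu>" using Yb by (auto simp: \<mu>_def A_def B_def)
  have mu1: "\<bar>\<mu> - 1\<bar> \<le> exp L * c" using mu a1 b1 by (auto simp: min_def split: if_splits)
  have muL: "\<mu> \<le> exp L" using mu(1) AL by (meson exp_le_cancel_iff order_trans)
  define d where "d = \<rho>\<^sup>2 + (norm x)\<^sup>2"
  have d: "0 < d" "\<rho> \<le> d"
    using \<rho> by (auto simp: d_def power2_eq_square add_pos_nonneg intro!: add_increasing2 mult_le_cancel_left1[THEN iffD2])
  define e where "e = (2 / d) *\<^sub>R x \<bullet> z"
  have e: "\<bar>e\<bar> \<le> norm z / \<rho>"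
  proof -
    have "\<bar>e\<bar> \<le> norm ((2 / d) *\<^sub>R x) * norm z" unfolding e_def by (rule Cauchy_Schwarz_ineq2)
    also have "norm ((2 / d) *\<^sub>R x) = 2 * norm x / d" using d by simp
    also have "\<dots> * norm z \<le> 1 / \<rho> * norm z"
      unfolding d_def using \<rho> by (intro mult_right_mono penalty_gradient) auto
    finally show ?thesis by simp
  qed
  have "X \<le> E * \<mu>" using XY Xa E(2) by (auto simp: \<mu>_def A_def min_def)
  also have "E * \<mu> = \<mu> + e * \<mu> + (norm z)\<^sup>2 / d * \<mu>"
    by (simp add: E(1) e_def d_def[symmetric] add_divide_distrib algebra_simps)
  finally have base: "X - Y - e \<le> (\<mu> - 1) * e + (norm z)\<^sup>2 / d * \<mu> - (Y - \<mu>)" by (simp add: algebra_simps)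
  have "\<bar>(\<mu> - 1) * e\<bar> \<le> (exp L * c) * (norm z / \<rho>)"
    unfolding abs_mult using mu1 e c by (intro mult_mono) auto
  moreover have "(norm z)\<^sup>2 / d * \<mu> \<le> (norm z)\<^sup>2 / \<rho> * exp L"
  proof -
    have "(norm z)\<^sup>2 / d * \<mu> \<le> (norm z)\<^sup>2 / d * exp L" using muL d by (intro mult_left_mono) auto
    also have "\<dots> \<le> (norm z)\<^sup>2 / \<rho> * exp L"
      using d \<rho> by (intro mult_right_mono divide_left_mono mult_pos_pos) auto
    finally show ?thesis .
  qed
  moreover have "max 0 (exp B - exp A) \<le> Y - \<mu>" using Yb mu by (auto simp: B_def)
  ultimately have "X - Y - e \<le> (exp L * c) * (norm z / \<rho>) + (norm z)\<^sup>2 / \<rho> * exp L - max 0 (exp B - exp A)"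
    using base by linarith
  also have "(exp L * c) * (norm z / \<rho>) + (norm z)\<^sup>2 / \<rho> * exp L
      = exp L * ((1 + L * (1 / sqrt (norm w))) / \<rho>) * (norm z)\<^sup>2"
    by (simp add: c_def power2_eq_square add_divide_distrib distrib_left distrib_right mult_ac)
  also have "\<dots> \<le> exp L * ((1 + L) * (1 + 1 / sqrt (norm w)) / \<rho>) * (norm z)\<^sup>2"
  proof -
    have "1 + L * i \<le> (1 + L) * (1 + i)" if "0 \<le> i" for i using that L by (simp add: algebra_simps)
    from this[of "1 / sqrt (norm w)"] show ?thesis using \<rho> by (intro mult_right_mono mult_left_mono divide_right_mono) auto
  qed
  finally show ?thesis unfolding e_def d_def A_def B_def by (simp add: mult.assoc)
qed

text \<open>For |x| beyond \<rho> the quadratic penalty outgrows the power \<gamma>, so the base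
  point enters only through \<rho>^\<gamma>.\<close>

lemma growth_ratio:
  fixes x z :: "'a::real_normed_vector"
  assumes \<gamma>: "0 \<le> \<gamma>" "\<gamma> < 1" and \<rho>: "1 \<le> \<rho>" and z: "1 \<le> norm z"
  shows "(1 + norm (x + z)) powr \<gamma> / (1 + (norm x)\<^sup>2 / \<rho>\<^sup>2) \<le> 2 * \<rho> powr \<gamma> + 4 * norm z powr \<gamma>"
proof -
  define d where "d = 1 + (norm x)\<^sup>2 / \<rho>\<^sup>2"
  have d: "1 \<le> d" by (simp add: d_def)
  have two: "2 powr \<gamma> \<le> 2" using powr_mono[of \<gamma> 1 2] \<gamma> by simp
  have b: "1 + norm (x + z) \<le> 2 * max (norm x) (2 * norm z)"
    using norm_triangle_ineq[of x z] z by linarith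
  have "(1 + norm (x + z)) powr \<gamma> \<le> (2 * max (norm x) (2 * norm z)) powr \<gamma>"
    using b \<gamma> by (intro powr_mono2) auto
  also have "\<dots> = 2 powr \<gamma> * max (norm x) (2 * norm z) powr \<gamma>" by (simp add: powr_mult)
  also have "\<dots> \<le> 2 * max (norm x) (2 * norm z) powr \<gamma>" using two by (intro mult_right_mono) auto
  also have "max (norm x) (2 * norm z) powr \<gamma> \<le> norm x powr \<gamma> + (2 * norm z) powr \<gamma>"
    by (simp add: max_def)
  also have "(2 * norm z) powr \<gamma> = 2 powr \<gamma> * norm z powr \<gamma>" by (simp add: powr_mult)
  also have "\<dots> \<le> 2 * norm z powr \<gamma>" using two by (intro mult_right_mono) auto
  finally have "(1 + norm (x + z)) powr \<gamma> \<le> 2 * norm x powr \<gamma> + 4 * norm z powr \<gamma>" by simp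
  also have "norm x powr \<gamma> \<le> \<rho> powr \<gamma> * d"
  proof (cases "norm x \<le> \<rho>")
    case True
    then have "norm x powr \<gamma> \<le> \<rho> powr \<gamma>" using \<gamma> by (intro powr_mono2) auto
    also have "\<dots> \<le> \<rho> powr \<gamma> * d" using mult_left_mono[OF d, of "\<rho> powr \<gamma>"] by simp
    finally show ?thesis .
  next
    case False
    define y where "y = norm x / \<rho>"
    have y: "1 \<le> y" "norm x = \<rho> * y" using False \<rho> by (auto simp: y_def)
    have "y powr \<gamma> \<le> y powr 2" using y \<gamma> by (intro powr_mono) auto
    also have "\<dots> \<le> d" using y \<rho> by (simp add: d_def power_mult_distrib)
    finally have "\<rho> powr \<gamma> * y powr \<gamma> \<le> \<rho> powr \<gamma> * d" by (intro mult_left_mono) auto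
    then show ?thesis using y \<rho> by (simp add: powr_mult)
  qed
  also have "4 * norm z powr \<gamma> \<le> 4 * norm z powr \<gamma> * d"
    using mult_left_mono[OF d, of "4 * norm z powr \<gamma>"] by simp
  finally have "(1 + norm (x + z)) powr \<gamma> \<le> (2 * \<rho> powr \<gamma> + 4 * norm z powr \<gamma>) * d"
    by (simp add: algebra_simps)
  then show ?thesis using d by (simp add: d_def[symmetric] pos_divide_le_eq)
qed

text \<open>A jump of length |z| changes the penalty by a relative amount of order y = |z| / \<rho>,
  so X - Y is at most X times \<open>2 * min 1 y\<close>. The size \<rho>^\<gamma> of X is beaten by
  giving up part of the integrability in z: the exponent of |z| rises from \<gamma> to (1 +
  \<gamma>) / 2, midway to 1 and hence below 2s for s \<ge> 1/2. The factor 12 is 4 + 8.\<close>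

lemma far_estimate:
  fixes x z :: "'a::real_inner"
  assumes \<gamma>: "0 \<le> \<gamma>" "\<gamma> < 1" and \<rho>: "1 \<le> \<rho>" and z: "1 \<le> norm z" and M: "0 \<le> M"
    and E: "E = 1 + (2 * (x \<bullet> z) + (norm z)\<^sup>2) / (\<rho>\<^sup>2 + (norm x)\<^sup>2)" "0 < E"
    and X: "0 \<le> X" "X \<le> M * (2 * \<rho> powr \<gamma> + 4 * norm z powr \<gamma>)" and Y: "0 \<le> Y" and XY: "X \<le> E * Y"
  shows "X - Y \<le> 12 * M * \<rho> powr (- ((1 - \<gamma>) / 2)) * norm z powr ((1 + \<gamma>) / 2)"
proof -
  define k b where "k = (1 - \<gamma>) / 2" and "b = (1 + \<gamma>) / 2"
  have kb: "0 < k" "k \<le> 1" "0 < b" "b < 1" "\<gamma> + k = b" using \<gamma> by (auto simp: k_def b_def field_simps)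
  define y where "y = norm z / \<rho>"
  have y: "0 < y" "norm z = \<rho> * y"
    using less_le_trans[OF zero_less_one z] \<rho> by (auto simp: y_def)
  have XE: "X / E \<le> Y" using XY E(2) by (simp add: pos_divide_le_eq mult.commute)
  have step: "X - Y \<le> X * (2 * min 1 y)"
  proof (cases "y \<le> 1")
    case True
    define h where "h = (2 * (x \<bullet> z) + (norm z)\<^sup>2) / (\<rho>\<^sup>2 + (norm x)\<^sup>2)"
    have Eh: "E = 1 + h" using E by (simp add: h_def)
    have h: "h \<le> 2 * y"
    proof -
      have "2 * (x \<bullet> z) / (\<rho>\<^sup>2 + (norm x)\<^sup>2) \<le> 2 * norm x / (\<rho>\<^sup>2 + (norm x)\<^sup>2) * norm z"
        using norm_cauchy_schwarz[of x z] by (simp add: divide_right_mono)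
      also have "\<dots> \<le> 1 / \<rho> * norm z" using \<rho> by (intro mult_right_mono penalty_gradient) auto
      finally have 1: "2 * (x \<bullet> z) / (\<rho>\<^sup>2 + (norm x)\<^sup>2) \<le> y" by (simp add: y_def)
      have "(norm z)\<^sup>2 / (\<rho>\<^sup>2 + (norm x)\<^sup>2) \<le> (norm z)\<^sup>2 / \<rho>\<^sup>2"
        using \<rho> by (intro divide_left_mono) (auto simp: add_pos_nonneg)
      also have "\<dots> = y\<^sup>2" by (simp add: y_def power_divide)
      also have "\<dots> \<le> y" using True y by (simp add: power2_eq_square mult_left_le)
      finally show ?thesis using 1 by (simp add: h_def add_divide_distrib)
    qed
    have "X - Y \<le> X - X / E" using XE by simp
    also have "\<dots> = X * (h / E)" using E(2) Eh by (simp add: field_simps)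
    also have "\<dots> \<le> X * (2 * y)"
    proof (intro mult_left_mono X(1))
      show "h / E \<le> 2 * y"
      proof (cases "0 \<le> h")
        case True
        then have "h / E \<le> h / 1" using Eh by (intro divide_left_mono) auto
        then show ?thesis using h by simp
      next
        case False
        then have "h / E \<le> 0" using E(2) by (simp add: divide_le_0_iff)
        then show ?thesis using y by linarith
      qed
    qed
    finally show ?thesis using True by simp
  next
    case False
    then show ?thesis using X(1) Y by simp
  qed
  \<comment> \<open>Interpolation: any power of y with exponent in [0, 1] dominates
    \<open>min 1 y\<close>. It is used with exponent b against \<rho>^\<gamma> and with k = b -
    \<gamma> against |z|^\<gamma>; both give \<rho>^(-k) |z|^b.\<close>
  have pw: "min 1 y \<le> y powr c" if "0 \<le> c" "c \<le> 1" for c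
  proof (cases "y \<le> 1")
    case True
    then show ?thesis using powr_mono'[of c 1 y] that y by simp
  next
    case False
    then show ?thesis using that by (simp add: ge_one_powr_ge_zero)
  qed
  have t1: "\<rho> powr \<gamma> * min 1 y \<le> \<rho> powr (- k) * norm z powr b"
  proof -
    have "\<rho> powr \<gamma> * min 1 y \<le> \<rho> powr \<gamma> * y powr b" using pw[of b] kb by (intro mult_left_mono) auto
    also have "\<dots> = \<rho> powr (- k + b) * y powr b" by (simp add: kb(5)[symmetric])
    also have "\<dots> = \<rho> powr (- k) * norm z powr b" using y \<rho> powr_add[of \<rho> "- k" b] by (simp add: powr_mult)
    finally show ?thesis .
  qed
  have t2: "norm z powr \<gamma> * min 1 y \<le> \<rho> powr (- k) * norm z powr b"
  proof -
    have "norm z powr \<gamma> * min 1 y \<le> norm z powr \<gamma> * y powr k" using pw[of k] kb by (intro mult_left_mono) auto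
    also have "y powr k = norm z powr k / \<rho> powr k" using \<rho> by (simp add: y_def powr_divide)
    also have "\<dots> = norm z powr k * \<rho> powr (- k)" by (simp add: powr_minus divide_inverse)
    also have "norm z powr \<gamma> * (norm z powr k * \<rho> powr (- k)) = \<rho> powr (- k) * norm z powr b"
      by (simp add: kb(5)[symmetric] powr_add)
    finally show ?thesis .
  qed
  have "X - Y \<le> (M * (2 * \<rho> powr \<gamma> + 4 * norm z powr \<gamma>)) * (2 * min 1 y)"
    by (rule order_trans[OF step]) (use X y in \<open>auto intro!: mult_right_mono\<close>)
  also have "\<dots> = M * (4 * (\<rho> powr \<gamma> * min 1 y) + 8 * (norm z powr \<gamma> * min 1 y))" by (simp add: algebra_simps)
  also have "\<dots> \<le> M * (4 * (\<rho> powr (- k) * norm z powr b) + 8 * (\<rho> powr (- k) * norm z powr b))"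
    using t1 t2 M by (intro mult_left_mono add_mono) auto
  finally show ?thesis by (simp add: k_def b_def)
qed

text \<open>Outside a compact set the quotient is at most 1, while \<open>start\<close> exhibits a
  value above 1; the maximum over the compact set is therefore global. Q is this maximal value, and
  the last conclusion is what all variations of the pair are derived from.\<close>

lemma doubling_maximum:
  fixes v :: "'a::euclidean_space \<Rightarrow> real"
  assumes cont: "continuous_on UNIV v" and v1: "\<And>x. 1 \<le> v x"
    and growth: "\<And>x. v x \<le> M * (1 + norm x) powr \<gamma>" and \<gamma>: "0 \<le> \<gamma>" "\<gamma> < 1" and M: "1 \<le> M"
    and L: "0 < L" and \<rho>: "1 \<le> \<rho>"
    and start: "v x0 > v y0 * exp (L * sqrt (norm (x0 - y0))) * (1 + (norm x0)\<^sup>2 / \<rho>\<^sup>2)"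
  obtains x y Q where "1 < Q" "v x = Q * (v y * exp (L * sqrt (norm (x - y))) * (1 + (norm x)\<^sup>2 / \<rho>\<^sup>2))"
    "\<And>x' y'. v x' \<le> Q * (v y' * exp (L * sqrt (norm (x' - y'))) * (1 + (norm x')\<^sup>2 / \<rho>\<^sup>2))"
proof -
  define G where "G x y = v y * exp (L * sqrt (norm (x - y))) * (1 + (norm x)\<^sup>2 / \<rho>\<^sup>2)" for x y
  define F where "F p = v (fst p) / G (fst p) (snd p)" for p
  have pen: "1 \<le> 1 + (norm x)\<^sup>2 / \<rho>\<^sup>2" for x :: 'a by simp
  have ex: "1 \<le> exp (L * sqrt (norm (x - y)))" for x y :: 'a using L by simp
  have vpos: "0 < v x" for x using v1[of x] by linarith
  have G: "0 < G x y" for x y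
    unfolding G_def using vpos[of y] less_le_trans[OF zero_less_one pen[of x]] by (intro mult_pos_pos) auto
  have G1: "exp (L * sqrt (norm (x - y))) \<le> G x y" and G2: "1 + (norm x)\<^sup>2 / \<rho>\<^sup>2 \<le> G x y" for x y
  proof -
    have "exp (L * sqrt (norm (x - y))) * 1 \<le> (v y * exp (L * sqrt (norm (x - y)))) * (1 + (norm x)\<^sup>2 / \<rho>\<^sup>2)"
      using mult_right_mono[OF v1[of y], of "exp (L * sqrt (norm (x - y)))"] pen[of x] vpos[of y]
      by (intro mult_mono) auto
    then show "exp (L * sqrt (norm (x - y))) \<le> G x y" by (simp add: G_def)
    have "1 * 1 \<le> v y * exp (L * sqrt (norm (x - y)))" (is "_ \<le> ?V")
      using v1[of y] ex[of x y] by (intro mult_mono) auto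
    then have "1 * 1 * (1 + (norm x)\<^sup>2 / \<rho>\<^sup>2) \<le> ?V * (1 + (norm x)\<^sup>2 / \<rho>\<^sup>2)"
      by (rule mult_right_mono) simp
    then show "1 + (norm x)\<^sup>2 / \<rho>\<^sup>2 \<le> G x y" by (simp add: G_def)
  qed
  have lin: "v x \<le> M * (1 + norm x)" for x
  proof -
    have "(1 + norm x) powr \<gamma> \<le> (1 + norm x) powr 1" using \<gamma> by (intro powr_mono) auto
    then have "(1 + norm x) powr \<gamma> \<le> 1 + norm x" by (simp add: add_nonneg_nonneg)
    then have "M * (1 + norm x) powr \<gamma> \<le> M * (1 + norm x)" using M by (intro mult_left_mono) auto
    then show ?thesis using growth[of x] by linarith
  qed
  \<comment> \<open>For |x| > a the penalty exceeds the linear bound for \<open>v\<close>. For |x|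
    \<le> a and |y| > b the points are at distance at least (M (1 + a) / L)^2, which makes the
    exponential exceed that bound.\<close>
  define a where "a = 2 * M * \<rho>\<^sup>2"
  define b where "b = a + (M * (1 + a) / L)\<^sup>2"
  have a: "1 \<le> a" unfolding a_def
    using M \<rho> mult_mono[of 1 "2 * M" 1 "\<rho>\<^sup>2"] by (simp add: one_le_power)
  have b: "a \<le> b" by (simp add: b_def)
  have outside: "F (x, y) \<le> 1" if "x \<notin> cball 0 a \<or> y \<notin> cball 0 b" for x y
  proof (cases "norm x \<le> a")
    case False
    then have x: "a < norm x" "1 \<le> norm x" using a by auto
    have "M * (1 + norm x) \<le> (2 * M) * norm x" using x M mult_left_mono[of 1 "norm x" M] by (simp add: algebra_simps)
    also have "\<dots> = a * norm x / \<rho>\<^sup>2" using \<rho> by (simp add: a_def)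
    also have "\<dots> \<le> norm x * norm x / \<rho>\<^sup>2" using x by (intro divide_right_mono mult_right_mono) auto
    finally have "v x \<le> 1 + (norm x)\<^sup>2 / \<rho>\<^sup>2" using lin[of x] by (simp add: power2_eq_square)
    then show ?thesis using G2[of x y] G[of x y] by (simp add: F_def pos_divide_le_eq)
  next
    case True
    then have y: "b < norm y" using that by auto
    have "(M * (1 + a) / L)\<^sup>2 \<le> norm (x - y)"
      using y True norm_triangle_ineq3[of y x] by (simp add: b_def norm_minus_commute)
    then have "M * (1 + a) / L \<le> sqrt (norm (x - y))" by (rule real_le_rsqrt)
    then have "M * (1 + a) \<le> L * sqrt (norm (x - y))" using L by (simp add: field_simps)
    also have "\<dots> \<le> exp (L * sqrt (norm (x - y)))"
      using exp_ge_add_one_self[of "L * sqrt (norm (x - y))"] by linarith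
    finally have "M * (1 + a) \<le> G x y" using G1[of x y] by linarith
    moreover have "M * (1 + norm x) \<le> M * (1 + a)" using True M by (intro mult_left_mono) auto
    ultimately show ?thesis using lin[of x] G[of x y] by (simp add: F_def pos_divide_le_eq)
  qed
  have F0: "1 < F (x0, y0)"
    using start G[of x0 y0] by (simp add: F_def G_def[symmetric] pos_less_divide_eq)
  have cv: "continuous_on S (\<lambda>p. v (f p))" if "continuous_on S f" for S and f :: "'a \<times> 'a \<Rightarrow> 'a"
    by (rule continuous_on_compose2[OF cont that]) auto
  have "continuous_on (cball 0 a \<times> cball 0 b) F"
  proof -
    have "continuous_on (cball 0 a \<times> cball 0 b) (\<lambda>p. G (fst p) (snd p))"
      unfolding G_def using \<rho> by (intro continuous_intros cv) auto
    then show ?thesis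
      unfolding F_def using less_imp_neq[OF G, symmetric] by (intro continuous_intros cv) auto
  qed
  moreover have "compact (cball (0::'a) a \<times> cball (0::'a) b)" by (intro compact_Times compact_cball)
  moreover have "(x0, y0) \<in> cball 0 a \<times> cball 0 b" using outside[of x0 y0] F0 by fastforce
  ultimately obtain p where p: "p \<in> cball 0 a \<times> cball 0 b" "\<And>p'. p' \<in> cball 0 a \<times> cball 0 b \<Longrightarrow> F p' \<le> F p"
    using continuous_attains_sup[of "cball (0::'a) a \<times> cball (0::'a) b" F] by blast
  have Fp: "1 < F p" using p(2)[OF \<open>(x0, y0) \<in> _\<close>] F0 by linarith
  have glob: "F p' \<le> F p" for p'
  proof (cases "p' \<in> cball 0 a \<times> cball 0 b")
    case False
    then have "F p' \<le> 1" using outside[of "fst p'" "snd p'"] by (cases p') auto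
    then show ?thesis using Fp by linarith
  qed (rule p(2))
  show thesis
  proof (rule that[of "F p" "fst p" "snd p"])
    show "1 < F p" by (rule Fp)
    show "v (fst p) = F p * (v (snd p) * exp (L * sqrt (norm (fst p - snd p))) * (1 + (norm (fst p))\<^sup>2 / \<rho>\<^sup>2))"
      using G[of "fst p" "snd p"] unfolding G_def[symmetric] by (simp add: F_def)
    show "v x' \<le> F p * (v y' * exp (L * sqrt (norm (x' - y'))) * (1 + (norm x')\<^sup>2 / \<rho>\<^sup>2))" for x' y'
      using glob[of "(x', y')"] G[of x' y'] unfolding G_def[symmetric] by (simp add: F_def[of "(x', y')"] pos_divide_le_eq)
  qed
qed

text \<open>A small power of \<rho> dominates the logarithm; its exponent is chosen so that the j-th
  power uses at most half of the available decay. The summand 1 in the denominator admits j =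
  0.\<close>

lemma log_power_decay:
  fixes c k :: real and j :: nat
  assumes "1 \<le> c" "0 < k"
  shows "((\<lambda>\<rho>. ln (c * \<rho>) ^ j * \<rho> powr (- k)) \<longlongrightarrow> 0) at_top"
proof -
  define a where "a = k / (2 * (real j + 1))"
  have a: "0 < a" "a * real j \<le> k / 2" using assms by (auto simp: a_def field_simps)
  have lim: "((\<lambda>\<rho>. (c powr a / a) ^ j * \<rho> powr (- (k / 2))) \<longlongrightarrow> (c powr a / a) ^ j * 0) at_top"
    using assms by (intro tendsto_mult tendsto_const tendsto_neg_powr filterlim_ident) auto
  show ?thesis
  proof (rule tendsto_sandwich[of "\<lambda>_. 0" _ _ "\<lambda>\<rho>. (c powr a / a) ^ j * \<rho> powr (- (k / 2))"])
    show "\<forall>\<^sub>F \<rho> in at_top. 0 \<le> ln (c * \<rho>) ^ j * \<rho> powr (- k)"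
      using eventually_ge_at_top[of 1]
    proof eventually_elim
      case (elim \<rho>)
      then have "1 \<le> c * \<rho>" using assms mult_mono[of 1 c 1 \<rho>] by simp
      then show ?case by simp
    qed
    show "\<forall>\<^sub>F \<rho> in at_top. ln (c * \<rho>) ^ j * \<rho> powr (- k) \<le> (c powr a / a) ^ j * \<rho> powr (- (k / 2))"
      using eventually_ge_at_top[of 1]
    proof eventually_elim
      case (elim \<rho>)
      then have 1: "1 \<le> c * \<rho>" using assms mult_mono[of 1 c 1 \<rho>] by simp
      have "ln (c * \<rho>) \<le> (c * \<rho>) powr a / a" using 1 a by (intro ln_powr_bound) auto
      also have "\<dots> = c powr a / a * \<rho> powr a" using assms elim by (simp add: powr_mult)
      finally have "ln (c * \<rho>) ^ j \<le> (c powr a / a * \<rho> powr a) ^ j" using 1 by (intro power_mono) auto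
      also have "\<dots> = (c powr a / a) ^ j * (\<rho> powr a) ^ j" by (rule power_mult_distrib)
      also have "\<dots> = (c powr a / a) ^ j * \<rho> powr (a * real j)" using elim by (simp add: powr_power mult.commute)
      also have "\<dots> \<le> (c powr a / a) ^ j * \<rho> powr (k / 2)"
        using a elim by (intro mult_left_mono powr_mono) auto
      finally have "ln (c * \<rho>) ^ j * \<rho> powr (- k) \<le> (c powr a / a) ^ j * \<rho> powr (k / 2) * \<rho> powr (- k)"
        by (intro mult_right_mono) auto
      also have "\<dots> = (c powr a / a) ^ j * \<rho> powr (- (k / 2))"
        by (simp add: mult.assoc powr_add[symmetric])
      finally show ?case .
    qed
    show "((\<lambda>\<rho>. (c powr a / a) ^ j * \<rho> powr (- (k / 2))) \<longlongrightarrow> 0) at_top" using lim by simp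
  qed simp
qed

section \<open>Test functions for the doubled variables and normalisation\<close>

lemma sqrt_norm_powr: "((norm v)\<^sup>2) powr (1/4) = sqrt (norm v)" "((norm v)\<^sup>2) powr (-3/4) = norm v powr (-3/2)"
proof -
  have "(norm v)\<^sup>2 = norm v powr 2" by simp
  then have *: "((norm v)\<^sup>2) powr a = norm v powr (2 * a)" for a by (simp only: powr_powr)
  show "((norm v)\<^sup>2) powr (1/4) = sqrt (norm v)" unfolding * by (simp add: powr_half_sqrt)
  show "((norm v)\<^sup>2) powr (-3/4) = norm v powr (-3/2)" unfolding * by simp
qed

lemma has_C2_sqrt_norm:
  "has_C2 (- {a}) (\<lambda>x::'a::euclidean_space. L * sqrt (norm (x - a))) (\<lambda>x. (L / 2 * norm (x - a) powr (-3/2)) *\<^sub>R (x - a))"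
proof -
  have "has_C2 (- {a}) (\<lambda>x::'a. (\<lambda>t. L * t powr (1/4)) ((norm (x - a))\<^sup>2))
     (\<lambda>x. (\<lambda>t. L * (1/4 * t powr (-3/4))) ((norm (x - a))\<^sup>2) *\<^sub>R (2 *\<^sub>R (x - a)))"
  proof (rule has_C2_compose[OF has_C2_sq_dist, where h'' = "\<lambda>t. L * (1/4 * (-3/4 * t powr (-7/4)))"])
    fix x assume "x \<in> - {a}"
    then have pos: "0 < (norm (x - a))\<^sup>2" by simp
    show "((\<lambda>t. L * t powr (1/4)) has_real_derivative L * (1/4 * ((norm (x - a))\<^sup>2) powr (-3/4))) (at ((norm (x - a))\<^sup>2))"
      using has_real_derivative_powr[OF pos, of "1/4"] by (intro DERIV_cmult) simp
    show "((\<lambda>t. L * (1/4 * t powr (-3/4))) has_real_derivative L * (1/4 * (-3/4 * ((norm (x - a))\<^sup>2) powr (-7/4))))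
        (at ((norm (x - a))\<^sup>2))"
      using has_real_derivative_powr[OF pos, of "-3/4"] by (intro DERIV_cmult) simp
  next
    show "continuous_on ((\<lambda>x. (norm (x - a))\<^sup>2) ` (- {a})) (\<lambda>t. L * (1/4 * (-3/4 * t powr (-7/4))))"
      by (intro continuous_intros) auto
  qed
  moreover have "(\<lambda>x. (L * (1/4 * ((norm (x - a))\<^sup>2) powr (-3/4))) *\<^sub>R (2 *\<^sub>R (x - a)))
      = (\<lambda>x. (L / 2 * norm (x - a) powr (-3/2)) *\<^sub>R (x - a))"
    using sqrt_norm_powr(2)[where 'a = 'a] by (simp add: fun_eq_iff)
  ultimately show ?thesis by (simp add: sqrt_norm_powr)
qed

lemma has_C2_log_penalty:
  assumes \<rho>: "0 < \<rho>"
  shows "has_C2 S (\<lambda>x::'a::euclidean_space. ln (1 + (norm x)\<^sup>2 / \<rho>\<^sup>2)) (\<lambda>x. (2 / (\<rho>\<^sup>2 + (norm x)\<^sup>2)) *\<^sub>R x)"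
proof -
  have pos: "0 < \<rho>\<^sup>2 + (norm (x - 0))\<^sup>2" for x :: 'a using \<rho> by (simp add: add_pos_nonneg)
  have "has_C2 S (\<lambda>x::'a. (\<lambda>t. ln (1 + t / \<rho>\<^sup>2)) ((norm (x - 0))\<^sup>2))
     (\<lambda>x. (\<lambda>t. 1 / (\<rho>\<^sup>2 + t)) ((norm (x - 0))\<^sup>2) *\<^sub>R (2 *\<^sub>R (x - 0)))"
  proof (rule has_C2_compose[OF has_C2_sq_dist, where h'' = "\<lambda>t. - 1 / (\<rho>\<^sup>2 + t)\<^sup>2"])
    fix x :: 'a
    let ?t = "(norm (x - 0))\<^sup>2"
    have 1: "0 < 1 + ?t / \<rho>\<^sup>2" by (intro add_pos_nonneg) auto
    have eq: "1 / (1 + ?t / \<rho>\<^sup>2) * (1 / \<rho>\<^sup>2) = 1 / (\<rho>\<^sup>2 + ?t)"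
    proof -
      have "(1 + ?t / \<rho>\<^sup>2) * \<rho>\<^sup>2 = \<rho>\<^sup>2 + ?t" using \<rho> by (simp add: distrib_right)
      then show ?thesis by (metis mult.right_neutral times_divide_times_eq)
    qed
    have "((\<lambda>t. ln (1 + t / \<rho>\<^sup>2)) has_real_derivative 1 / (1 + ?t / \<rho>\<^sup>2) * (1 / \<rho>\<^sup>2)) (at ?t)"
    proof (rule DERIV_chain2[where f = ln and g = "\<lambda>t. 1 + t / \<rho>\<^sup>2", OF DERIV_ln_divide[OF 1]])
      show "((\<lambda>t. 1 + t / \<rho>\<^sup>2) has_real_derivative 1 / \<rho>\<^sup>2) (at ?t)"
        using DERIV_add[OF DERIV_const DERIV_cdivide[OF DERIV_ident]] by simp
    qed
    then show "((\<lambda>t. ln (1 + t / \<rho>\<^sup>2)) has_real_derivative 1 / (\<rho>\<^sup>2 + ?t)) (at ?t)" unfolding eq .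
    show "((\<lambda>t. 1 / (\<rho>\<^sup>2 + t)) has_real_derivative - 1 / (\<rho>\<^sup>2 + ?t)\<^sup>2) (at ?t)"
      using pos[of x] by (auto intro!: derivative_eq_intros simp: power2_eq_square)
  next
    show "continuous_on ((\<lambda>x::'a. (norm (x - 0))\<^sup>2) ` S) (\<lambda>t. - 1 / (\<rho>\<^sup>2 + t)\<^sup>2)"
      using \<rho> by (intro continuous_intros) auto
  qed
  then show ?thesis by simp
qed

lemma has_C2_exp:
  assumes "has_C2 S f g"
  shows "has_C2 S (\<lambda>x. c * exp (f x) - 1) (\<lambda>x. (c * exp (f x)) *\<^sub>R g x)"
  by (rule has_C2_compose[OF assms, where h = "\<lambda>t. c * exp t - 1" and h' = "\<lambda>t. c * exp t" and h'' = "\<lambda>t. c * exp t"])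
    (auto intro!: derivative_eq_intros continuous_intros)

text \<open>Obtained as the exponential of a sum, so that the gradient is the value times the sum of
  the logarithmic gradients; dividing by the value of \<open>v\<close> leaves exactly this sum. The
  subtracted 1 passes from \<open>v\<close> back to \<open>u\<close>.\<close>

lemma has_C2_upper_test:
  assumes \<rho>: "0 < \<rho>"
  shows "has_C2 (- {a}) (\<lambda>x::'a::euclidean_space. c * (exp (L * sqrt (norm (x - a))) * (1 + (norm x)\<^sup>2 / \<rho>\<^sup>2)) - 1)
     (\<lambda>x. (c * (exp (L * sqrt (norm (x - a))) * (1 + (norm x)\<^sup>2 / \<rho>\<^sup>2)))
        *\<^sub>R ((L / 2 * norm (x - a) powr (-3/2)) *\<^sub>R (x - a) + (2 / (\<rho>\<^sup>2 + (norm x)\<^sup>2)) *\<^sub>R x))"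
proof -
  have "exp (L * sqrt (norm (x - a)) + ln (1 + (norm x)\<^sup>2 / \<rho>\<^sup>2)) = exp (L * sqrt (norm (x - a))) * (1 + (norm x)\<^sup>2 / \<rho>\<^sup>2)" for x
    by (simp add: exp_add add_pos_nonneg)
  then show ?thesis
    using has_C2_exp[OF has_C2_add[OF has_C2_sqrt_norm has_C2_log_penalty[OF \<rho>]], of a c L] by simp
qed

lemma has_C2_lower_test:
  "has_C2 (- {a}) (\<lambda>y::'a::euclidean_space. c * exp (- (L * sqrt (norm (a - y)))) - 1)
     (\<lambda>y. (c * exp (- (L * sqrt (norm (a - y))))) *\<^sub>R ((L / 2 * norm (a - y) powr (-3/2)) *\<^sub>R (a - y)))"
proof -
  have "(\<lambda>y. (c * exp (- L * sqrt (norm (y - a)))) *\<^sub>R ((- L / 2 * norm (y - a) powr (-3/2)) *\<^sub>R (y - a)))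
     = (\<lambda>y. (c * exp (- (L * sqrt (norm (a - y))))) *\<^sub>R ((L / 2 * norm (a - y) powr (-3/2)) *\<^sub>R (a - y)))"
  proof
    fix y
    have "(- L / 2 * norm (y - a) powr (-3/2)) *\<^sub>R (y - a) = (L / 2 * norm (y - a) powr (-3/2)) *\<^sub>R (a - y)"
      by (simp add: scaleR_diff_right)
    then show "(c * exp (- L * sqrt (norm (y - a)))) *\<^sub>R ((- L / 2 * norm (y - a) powr (-3/2)) *\<^sub>R (y - a))
      = (c * exp (- (L * sqrt (norm (a - y))))) *\<^sub>R ((L / 2 * norm (a - y) powr (-3/2)) *\<^sub>R (a - y))"
      by (simp add: norm_minus_commute[of a])
  qed
  moreover have "(\<lambda>y. c * exp (- L * sqrt (norm (y - a))) - 1) = (\<lambda>y. c * exp (- (L * sqrt (norm (a - y)))) - 1)"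
    by (simp add: norm_minus_commute)
  ultimately show ?thesis
    using has_C2_exp[OF has_C2_sqrt_norm[of a "- L"], of c] by (simp only:)
qed

text \<open>Ellipticity compares two functions at one and the same point. Translation carries both
  contact points to the origin, and positive homogeneity divides by the values of \<open>v\<close>
  there.\<close>

lemma operator_normalize:
  fixes G :: "'a::euclidean_space \<Rightarrow> real"
  assumes "translation_invariant s I" "pos_homogeneous s I" and G: "expands G x g" "G \<in> L1_weight s"
    and s: "0 \<le> s" and c: "0 < c"
  shows "I (\<lambda>z. c * G (z + x)) 0 = c * I G x"
    and "expands (\<lambda>z. c * G (z + x)) 0 (c *\<^sub>R g)" and "(\<lambda>z. c * G (z + x)) \<in> L1_weight s"
proof -
  have ex: "expands (\<lambda>z. G (z + x)) 0 g" using G(1) by (intro expands_shift) simp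
  have L: "(\<lambda>z. G (z + x)) \<in> L1_weight s" by (rule L1_weight_shift[OF G(2) s])
  have "I (\<lambda>z. c * G (z + x)) 0 = c * I (\<lambda>z. G (z + x)) 0"
    using assms(2) expands_C11_at[OF ex] L c unfolding pos_homogeneous_def by blast
  also have "I (\<lambda>z. G (z + x)) 0 = I G (0 + x)"
    using assms(1) expands_C11_at[OF G(1)] G(2) unfolding translation_invariant_def by simp
  finally show "I (\<lambda>z. c * G (z + x)) 0 = c * I G x" by simp
  show "expands (\<lambda>z. c * G (z + x)) 0 (c *\<^sub>R g)" by (rule expands_cmult[OF ex])
  show "(\<lambda>z. c * G (z + x)) \<in> L1_weight s"
    using L unfolding L1_weight_def by (simp add: mult.assoc)
qed

text \<open>A Pucci-type bound: the error P is charged with the upper kernel bound, the gain N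
  credited with the lower one. The compensator sees only the difference of the two
  gradients.\<close>

lemma nonlocal_difference_bound:
  fixes U V :: "'a::euclidean_space \<Rightarrow> real"
  assumes s: "1/2 \<le> s" "s < 1" and lam: "0 \<le> lam" "lam \<le> Lam" and K: "K \<in> kernels s lam Lam"
    and U: "expands U x gU" "U \<in> L1_weight s" and V: "expands V x gV" "V \<in> L1_weight s"
    and bd: "\<And>z. z \<noteq> 0 \<Longrightarrow> (U (x + z) - U x) - (V (x + z) - V x) - indicator (ball 0 1) z * ((gU - gV) \<bullet> z) \<le> P z - N z"
    and PN: "\<And>z. 0 \<le> P z" "\<And>z. 0 \<le> N z"
    and P: "has_bochner_integral lebesgue (\<lambda>z. P z * ker s z) iP"
    and N: "has_bochner_integral lebesgue (\<lambda>z. N z * ker s z) iN"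
  shows "nonlocal_op s K U x - nonlocal_op s K V x \<le> Lam * iP - lam * iN"
proof -
  define fU where "fU z = (U (x + z) - U x - indicator (ball 0 1) z * (gU \<bullet> z)) * K z" for z
  define fV where "fV z = (V (x + z) - V x - indicator (ball 0 1) z * (gV \<bullet> z)) * K z" for z
  have iU: "integrable lebesgue fU" unfolding fU_def by (rule nonlocal_integrable[OF U s K lam])
  have iV: "integrable lebesgue fV" unfolding fV_def by (rule nonlocal_integrable[OF V s K lam])
  have "nonlocal_op s K U x - nonlocal_op s K V x = (\<integral>z. fU z - fV z \<partial>lebesgue)"
    unfolding nonlocal_op_eq[OF U(1) s] nonlocal_op_eq[OF V(1) s] fU_def[symmetric] fV_def[symmetric]
    using iU iV by simp
  also have "\<dots> \<le> (\<integral>z. Lam * (P z * ker s z) - lam * (N z * ker s z) \<partial>lebesgue)"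
  proof (rule integral_mono_AE)
    show "integrable lebesgue (\<lambda>z. fU z - fV z)" using iU iV by simp
    show "integrable lebesgue (\<lambda>z. Lam * (P z * ker s z) - lam * (N z * ker s z))"
      using P N by (auto simp: has_bochner_integral_iff)
    show "AE z in lebesgue. fU z - fV z \<le> Lam * (P z * ker s z) - lam * (N z * ker s z)"
      using AE_lebesgue_nonzero
    proof eventually_elim
      fix z :: 'a assume z: "z \<noteq> 0"
      have Kb: "lam * ker s z \<le> K z" "K z \<le> Lam * ker s z" using kernels_bounds[OF K z] by auto
      have K0: "0 \<le> K z" using Kb mult_nonneg_nonneg[OF lam(1) ker_nonneg[of s z]] by linarith
      have "fU z - fV z = ((U (x + z) - U x) - (V (x + z) - V x) - indicator (ball 0 1) z * ((gU - gV) \<bullet> z)) * K z"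
        by (simp add: fU_def fV_def inner_diff_left algebra_simps)
      also have "\<dots> \<le> (P z - N z) * K z" by (rule mult_right_mono[OF bd[OF z] K0])
      also have "\<dots> = P z * K z - N z * K z" by (simp add: left_diff_distrib)
      also have "\<dots> \<le> P z * (Lam * ker s z) - N z * (lam * ker s z)"
        by (intro diff_mono mult_left_mono Kb PN)
      finally show "fU z - fV z \<le> Lam * (P z * ker s z) - lam * (N z * ker s z)" by (simp only: mult.left_commute)
    qed
  qed
  also have "\<dots> = Lam * iP - lam * iN" using P N by (simp add: has_bochner_integral_iff)
  finally show ?thesis .
qed

text \<open>The ball lies in the cone around \<^term>\<open>e\<close> where \<open>sqrt_norm_concave\<close> applies.\<close>

lemma gain_integral:
  assumes s: "0 < s" "s < 1"
  obtains c where "0 < c" "\<And>(e::'a::euclidean_space) \<tau> A. norm e = 1 \<Longrightarrow> 0 < \<tau> \<Longrightarrow> \<tau> \<le> 1 \<Longrightarrow> 0 \<le> A \<Longrightarrow>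
    \<exists>i. A * c * \<tau> powr (2 - 2 * s) \<le> i \<and>
      has_bochner_integral lebesgue (\<lambda>z. indicator (ball ((\<tau> / 10) *\<^sub>R e) (\<tau> / 1000)) z * (A * (norm z)\<^sup>2) * ker s z) i"
proof -
  \<comment> \<open>On the ball |z| is at least 99/1000 \<tau>, and 9/1000 lies below the square of
    99/1000; the rest is the volume of a ball of radius 1/1000. The kernel is bounded below by its
    value at radius \<tau>.\<close>
  define c where "c = 9/1000 * (unit_ball_vol (real DIM('a)) * (1/1000) ^ DIM('a))"
  have c: "0 < c" unfolding c_def using unit_ball_vol_pos[of "real DIM('a)"] by simp
  have "\<exists>i. A * c * \<tau> powr (2 - 2 * s) \<le> i \<and>
      has_bochner_integral lebesgue (\<lambda>z. indicator (ball ((\<tau> / 10) *\<^sub>R e) (\<tau> / 1000)) z * (A * (norm z)\<^sup>2) * ker s z) i"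
    if e: "norm e = 1" and \<tau>: "0 < \<tau>" "\<tau> \<le> 1" and A: "0 \<le> A" for e :: 'a and \<tau> A
  proof -
    let ?B = "ball ((\<tau> / 10) *\<^sub>R e) (\<tau> / 1000)"
    let ?f = "\<lambda>z. indicator ?B z * (A * (norm z)\<^sup>2) * ker s z"
    let ?p = "- real DIM('a) - 2 * s"
    have B: "99/1000 * \<tau> \<le> norm z" "norm z \<le> \<tau>" if "z \<in> ?B" for z
    proof -
      have "norm (z - (\<tau> / 10) *\<^sub>R e) < \<tau> / 1000" using that by (simp add: dist_norm norm_minus_commute)
      moreover have "norm ((\<tau> / 10) *\<^sub>R e) = \<tau> / 10" using e \<tau> by simp
      ultimately show "99/1000 * \<tau> \<le> norm z" "norm z \<le> \<tau>"
        using norm_triangle_ineq2[of "(\<tau> / 10) *\<^sub>R e" z] norm_triangle_sub[of z "(\<tau> / 10) *\<^sub>R e"] \<tau>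
        by (auto simp: norm_minus_commute)
    qed
    have int: "integrable lebesgue ?f"
    proof (rule Bochner_Integration.integrable_bound)
      show "integrable lebesgue (\<lambda>z::'a. A * (min ((norm z)\<^sup>2) 1 * ker s z))"
        by (intro integrable_mult_right integrable_min_ker_0 s)
      show "?f \<in> borel_measurable lebesgue"
        by (intro measurable_completion borel_measurable_times borel_measurable_indicator) auto
      show "AE z in lebesgue. norm (?f z) \<le> norm (A * (min ((norm z)\<^sup>2) 1 * ker s z))"
      proof (rule AE_I2)
        fix z :: 'a
        show "norm (?f z) \<le> norm (A * (min ((norm z)\<^sup>2) 1 * ker s z))"
        proof (cases "z \<in> ?B")
          case True
          have "(norm z)\<^sup>2 \<le> 1" using B[OF True] \<tau> by (intro power_le_one) auto
          then show ?thesis using True A by (simp add: min_absorb1)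
        qed simp
      qed
    qed
    have "A * c * \<tau> powr (2 - 2 * s) = measure lebesgue ?B * (A * (9/1000 * \<tau>\<^sup>2) * \<tau> powr ?p)"
    proof -
      have "measure lebesgue ?B = unit_ball_vol (real DIM('a)) * (\<tau> / 1000) ^ DIM('a)"
        using \<tau> by (simp add: content_ball)
      moreover have "\<tau> powr (2 - 2 * s) = \<tau> ^ DIM('a) * \<tau>\<^sup>2 * \<tau> powr ?p"
      proof -
        have "\<tau> ^ DIM('a) * \<tau>\<^sup>2 * \<tau> powr ?p = \<tau> powr (real DIM('a)) * \<tau> powr 2 * \<tau> powr ?p"
          using \<tau> by (simp add: powr_realpow)
        also have "\<dots> = \<tau> powr (real DIM('a) + 2 + ?p)" by (simp only: powr_add)
        finally show ?thesis by simp
      qed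
      ultimately show ?thesis by (simp add: c_def power_divide mult_ac)
    qed
    also have "\<dots> = (\<integral>z. indicator ?B z * (A * (9/1000 * \<tau>\<^sup>2) * \<tau> powr ?p) \<partial>lebesgue)" by simp
    also have "\<dots> \<le> integral\<^sup>L lebesgue ?f"
    proof (rule integral_mono[OF _ int])
      show "integrable lebesgue (\<lambda>z::'a. indicator ?B z * (A * (9/1000 * \<tau>\<^sup>2) * \<tau> powr ?p))"
        using emeasure_bounded_finite[of ?B] by (intro integrable_mult_left) auto
      fix z :: 'a
      show "indicator ?B z * (A * (9/1000 * \<tau>\<^sup>2) * \<tau> powr ?p) \<le> ?f z"
      proof (cases "z \<in> ?B")
        case True
        have "(99/1000 * \<tau>)\<^sup>2 \<le> (norm z)\<^sup>2" using B[OF True] \<tau> by (intro power_mono) auto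
        moreover have "9/1000 * \<tau>\<^sup>2 \<le> (99/1000 * \<tau>)\<^sup>2" by (simp add: power_mult_distrib power_divide)
        ultimately have "9/1000 * \<tau>\<^sup>2 \<le> (norm z)\<^sup>2" by linarith
        moreover have "\<tau> powr ?p \<le> ker s z"
          unfolding ker_def using B[OF True] \<tau> s by (intro powr_mono2') auto
        ultimately have "(9/1000 * \<tau>\<^sup>2) * \<tau> powr ?p \<le> (norm z)\<^sup>2 * ker s z"
          by (intro mult_mono) auto
        from mult_left_mono[OF this A] show ?thesis using True by (simp add: mult.assoc)
      qed simp
    qed
    finally show ?thesis using has_bochner_integral_integrable[OF int] by blast
  qed
  then show thesis using that[OF c] by blast
qed

text \<open>Concavity of the root gives the quadratic gap between the exponents B and A. To carry it
  over to the exponentials one needs \<open>A \<ge> 0\<close>, which holds because the ball lies on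
  the side where z points along w; then exp B - exp A \<ge> B - A.\<close>

lemma gain_pointwise:
  fixes w z :: "'a::real_inner"
  assumes w: "w \<noteq> 0" and L: "0 \<le> L" and \<tau>: "0 < \<tau>" "\<tau> \<le> norm w"
    and z: "z \<in> ball ((\<tau> / 10) *\<^sub>R (w /\<^sub>R norm w)) (\<tau> / 1000)"
  shows "L / 8 * norm w powr (-3/2) * (norm z)\<^sup>2
    \<le> exp (L * (sqrt (norm w) - sqrt (norm (w - z)))) - exp (L * (sqrt (norm (w + z)) - sqrt (norm w)))"
    and "99/1000 * \<tau> \<le> norm z" "norm z < \<tau>"
proof -
  define e where "e = w /\<^sub>R norm w"
  have e: "norm e = 1" "w = norm w *\<^sub>R e" using w by (auto simp: e_def)
  define d where "d = z - (\<tau> / 10) *\<^sub>R e"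
  have d: "norm d < \<tau> / 1000" using z by (simp add: d_def e_def dist_norm norm_minus_commute)
  have nz: "norm ((\<tau> / 10) *\<^sub>R e) = \<tau> / 10" using e \<tau> by simp
  have zd: "z = (\<tau> / 10) *\<^sub>R e + d" by (simp add: d_def)
  have z1: "norm z \<le> 101/1000 * \<tau>" using norm_triangle_ineq[of "(\<tau> / 10) *\<^sub>R e" d] nz d unfolding zd[symmetric] by linarith
  have z2: "99/1000 * \<tau> \<le> norm z" using norm_diff_ineq[of "(\<tau> / 10) *\<^sub>R e" d] nz d unfolding zd[symmetric] by linarith
  show "99/1000 * \<tau> \<le> norm z" by (rule z2)
  show "norm z < \<tau>" using z1 \<tau> by linarith
  have ez: "99/1000 * \<tau> \<le> e \<bullet> z"
  proof -
    have "e \<bullet> z = \<tau> / 10 + e \<bullet> d" using e(1) by (simp add: zd inner_add_right power2_norm_eq_inner[symmetric] dot_square_norm)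
    moreover have "\<bar>e \<bullet> d\<bar> \<le> \<tau> / 1000" using Cauchy_Schwarz_ineq2[of e d] e(1) d by simp
    ultimately show ?thesis by linarith
  qed
  have wz: "w \<bullet> z = norm w * (e \<bullet> z)" using e(2) by (metis inner_scaleR_left)
  have wz0: "0 \<le> w \<bullet> z" unfolding wz using ez \<tau> by (intro mult_nonneg_nonneg) auto
  have dir: "9/10 * (norm w)\<^sup>2 * (norm z)\<^sup>2 \<le> (w \<bullet> z)\<^sup>2"
  proof -
    have "(norm z)\<^sup>2 \<le> (101/1000 * \<tau>)\<^sup>2" using z1 by (intro power_mono) auto
    moreover have "(99/1000 * \<tau>)\<^sup>2 \<le> (e \<bullet> z)\<^sup>2" using ez \<tau> by (intro power_mono) auto
    moreover have "9/10 * (101/1000 * \<tau>)\<^sup>2 \<le> (99/1000 * \<tau>)\<^sup>2" by (simp add: power_mult_distrib power_divide)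
    ultimately have "9/10 * (norm z)\<^sup>2 \<le> (e \<bullet> z)\<^sup>2" by linarith
    from mult_left_mono[OF this zero_le_power2[of "norm w"]] show ?thesis
      by (simp add: wz power_mult_distrib mult_ac)
  qed
  have conc: "sqrt (norm (w + z)) + sqrt (norm (w - z)) \<le> 2 * sqrt (norm w) * (1 - (norm z / norm w)\<^sup>2 / 16)"
    using z1 \<tau> by (intro sqrt_norm_concave[OF w _ dir]) simp
  define A B where "A = L * (sqrt (norm (w + z)) - sqrt (norm w))" and "B = L * (sqrt (norm w) - sqrt (norm (w - z)))"
  have "(norm w)\<^sup>2 \<le> (norm (w + z))\<^sup>2"
    unfolding power2_norm_eq_inner using wz0 by (simp add: inner_add inner_commute add_increasing2)
  then have "norm w \<le> norm (w + z)" by (rule power2_le_imp_le) simp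
  then have A0: "0 \<le> A" using L by (simp add: A_def)
  have half: "sqrt (norm w) * (norm z / norm w)\<^sup>2 = norm w powr (-3/2) * (norm z)\<^sup>2"
  proof -
    have "norm w powr (1/2) / norm w powr 2 = norm w powr (1/2 - 2)" by (simp only: powr_diff)
    then have "sqrt (norm w) / (norm w)\<^sup>2 = norm w powr (-3/2)" using w by (simp add: powr_half_sqrt)
    moreover have "sqrt (norm w) * (norm z / norm w)\<^sup>2 = sqrt (norm w) / (norm w)\<^sup>2 * (norm z)\<^sup>2"
      by (simp add: power_divide)
    ultimately show ?thesis by simp
  qed
  have "2 * sqrt (norm w) * (1 - (norm z / norm w)\<^sup>2 / 16) = 2 * sqrt (norm w) - (sqrt (norm w) * (norm z / norm w)\<^sup>2) / 8"
    by (simp add: algebra_simps)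
  then have gap: "(norm w powr (-3/2) * (norm z)\<^sup>2) / 8 \<le> (sqrt (norm w) - sqrt (norm (w - z))) - (sqrt (norm (w + z)) - sqrt (norm w))"
    using conc half by linarith
  have BA: "L / 8 * norm w powr (-3/2) * (norm z)\<^sup>2 \<le> B - A"
  proof -
    have "B - A = L * ((sqrt (norm w) - sqrt (norm (w - z))) - (sqrt (norm (w + z)) - sqrt (norm w)))"
      by (simp only: A_def B_def right_diff_distrib)
    then show ?thesis using mult_left_mono[OF gap L] by simp
  qed
  have BA0: "0 \<le> B - A" by (rule order_trans[OF _ BA]) (use L in simp)
  have "B - A \<le> exp (B - A) - 1" using exp_ge_add_one_self[of "B - A"] by linarith
  also have "\<dots> \<le> exp A * (exp (B - A) - 1)"
    using mult_right_mono[of 1 "exp A" "exp (B - A) - 1"] A0 BA0 by simp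
  also have "\<dots> = exp B - exp A" by (simp add: right_diff_distrib exp_diff)
  finally show "L / 8 * norm w powr (-3/2) * (norm z)\<^sup>2
    \<le> exp (L * (sqrt (norm w) - sqrt (norm (w - z)))) - exp (L * (sqrt (norm (w + z)) - sqrt (norm w)))"
    using BA unfolding A_def B_def by linarith
qed

section \<open>The contradiction at the maximum point\<close>

lemma powr_minus_half:
  fixes t :: real
  shows "0 \<le> t \<Longrightarrow> t powr (- (1/2)) = 1 / sqrt t"
  unfolding powr_minus powr_half_sqrt by (rule inverse_eq_divide)

text \<open>\<open>S1\<close> lets the superlinear Hamiltonian absorb the penalty gradient, so that
  the equations give a nonnegative difference; \<open>S2\<close> makes the concavity gain exceed the
  errors, so that ellipticity gives a negative one. The factor 16 in \<open>S2\<close> combines the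
  1/8 in the gain with the 2 in \<open>ge1\<close>.\<close>

lemma doubling_contradiction:
  fixes u :: "'a::euclidean_space \<Rightarrow> real" and I :: "'a operator"
  assumes s: "1/2 \<le> s" "s < 1" and lam: "0 < lam" "lam \<le> Lam"
    and ti: "translation_invariant s I" and hom: "pos_homogeneous s I"
    and ell: "elliptic s (kernels s lam Lam) I"
    and qm: "0 \<le> q" "0 \<le> m" "1 < q + m"
    and nonneg: "\<And>x. 0 \<le> u x"
    and sol: "visc_solution s I (\<lambda>x r p. rpow r q * rpow (norm p) m) UNIV u"
    and growth: "\<And>x. 1 + u x \<le> M * (1 + norm x) powr \<gamma>" and \<gamma>: "0 \<le> \<gamma>" "\<gamma> < 1" and M: "1 \<le> M"
    and L: "0 < L" and \<rho>: "1 \<le> \<rho>"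
    and c: "0 < c" "\<And>(e::'a) \<tau> A. norm e = 1 \<Longrightarrow> 0 < \<tau> \<Longrightarrow> \<tau> \<le> 1 \<Longrightarrow> 0 \<le> A \<Longrightarrow>
      \<exists>i. A * c * \<tau> powr (2 - 2 * s) \<le> i \<and>
      has_bochner_integral lebesgue (\<lambda>z. indicator (ball ((\<tau> / 10) *\<^sub>R e) (\<tau> / 1000)) z * (A * (norm z)\<^sup>2) * ker s z) i"
    and J: "J = integral\<^sup>L lebesgue (\<lambda>z::'a. min ((norm z)\<^sup>2) (norm z powr ((1 + \<gamma>) / 2)) * ker s z)"
    and C: "exp L * (1 + L) \<le> C" "12 * M \<le> C"
    and S1: "(1 + (q + m - 1) / (m + 1) * ln (2 * M * \<rho>)) / \<rho> \<le> L\<^sup>2 * ((q + m - 1) / (m + 1)) / 2"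
    and S2: "16 * Lam * C * J * \<rho> powr (- ((1 - \<gamma>) / 2)) * (1 + (ln (2 * M * \<rho>) / L) ^ 3) < lam * L * c"
    and start: "1 + u x0 > (1 + u y0) * exp (L * sqrt (norm (x0 - y0))) * (1 + (norm x0)\<^sup>2 / \<rho>\<^sup>2)"
  shows False
proof -
  have s0: "0 < s" using s by simp
  have cont: "continuous_on UNIV u" by (rule visc_solution_continuous[OF sol])
  define v where "v x = 1 + u x" for x
  have v1: "1 \<le> v x" "0 < v x" for x using nonneg[of x] by (auto simp: v_def)
  have vgrowth: "v x \<le> M * (1 + norm x) powr \<gamma>" for x using growth by (simp add: v_def)
  have vcont: "continuous_on UNIV v" unfolding v_def by (intro continuous_intros cont)
  define pen where "pen x = 1 + (norm x)\<^sup>2 / \<rho>\<^sup>2" for x :: 'a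
  have pen: "1 \<le> pen x" "0 < pen x" for x
    by (auto simp: pen_def intro: add_pos_nonneg)
  define f where "f x = L * sqrt (norm x)" for x :: 'a
  obtain X Y Q where Q: "1 < Q" and XY: "v X = Q * (v Y * exp (f (X - Y)) * pen X)"
    and max: "\<And>x y. v x \<le> Q * (v y * exp (f (x - y)) * pen x)"
  proof (rule doubling_maximum[OF vcont v1(1) vgrowth \<gamma> M L \<rho>])
    show "v x0 > v y0 * exp (L * sqrt (norm (x0 - y0))) * (1 + (norm x0)\<^sup>2 / \<rho>\<^sup>2)"
      using start by (simp add: v_def)
  qed (rule that, auto simp: f_def pen_def)
  define w where "w = X - Y"
  \<comment> \<open>The root is not smooth at 0, so contact on the diagonal has to be excluded.
    There the quotient would be 1 / pen X, which is at most 1 < Q.\<close>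
  have w: "w \<noteq> 0"
  proof
    assume "w = 0"
    then have eq: "X = Y" by (simp add: w_def)
    have "1 < Q * pen X" using Q pen(1)[of X] mult_strict_mono[of 1 Q 1 "pen X"] less_le_trans[of 1 Q "Q * pen X"]
      by (simp add: mult_le_cancel_left1)
    then have "v X * 1 < v X * (Q * pen X)" using v1(2)[of X] by (intro mult_strict_left_mono) auto
    moreover have "v X * (Q * pen X) = Q * (v Y * exp (f (X - Y)) * pen X)"
      by (simp add: eq f_def mult.left_commute)
    ultimately show False using XY by linarith
  qed
  define t where "t = norm w"
  have t: "0 < t" using w by (simp add: t_def)
  define y where "y = ln (2 * M * \<rho>)"
  have vX: "exp (f w) * (1 * pen X) \<le> v X"
  proof -
    have "1 * 1 \<le> Q * v Y" using Q v1[of Y] by (intro mult_mono) auto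
    then have "1 * (exp (f w) * pen X) \<le> Q * v Y * (exp (f w) * pen X)"
      using pen(2)[of X] by (intro mult_right_mono) auto
    then show ?thesis unfolding XY w_def by (simp add: mult_ac)
  qed
  have vXpen: "pen X \<le> v X"
  proof -
    have "1 * pen X \<le> exp (f w) * pen X"
      using L pen(2)[of X] by (intro mult_right_mono) (auto simp: f_def)
    then show ?thesis using vX by simp
  qed
  \<comment> \<open>The maximum gives \<open>exp (f w) * pen X \<le> v X\<close>, and the growth
    gives \<open>v X \<le> 2 * M * \<rho> * pen X\<close>. The penalty cancels, wherever X
    lies.\<close>
  have fy: "L * sqrt t \<le> y"
  proof -
    define d where "d = norm X"
    have "1 + d \<le> 2 * \<rho> * pen X"
    proof (cases "d \<le> \<rho>")
      case True
      then have "1 + d \<le> 2 * \<rho> * 1" using \<rho> by simp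
      also have "\<dots> \<le> 2 * \<rho> * pen X" using pen(1)[of X] \<rho> by (intro mult_left_mono) auto
      finally show ?thesis .
    next
      case False
      then have "\<rho> * d \<le> d * d" by (intro mult_right_mono) (auto simp: d_def)
      then have "d \<le> d\<^sup>2 / \<rho>" using \<rho> by (simp add: pos_le_divide_eq power2_eq_square mult.commute)
      then have "1 + d \<le> 2 * (d\<^sup>2 / \<rho>)" using False \<rho> by linarith
      also have "\<dots> = 2 * \<rho> * (d\<^sup>2 / \<rho>\<^sup>2)" using \<rho> by (simp add: power2_eq_square)
      also have "\<dots> \<le> 2 * \<rho> * pen X" using \<rho> by (intro mult_left_mono) (auto simp: pen_def d_def)
      finally show ?thesis .
    qed
    moreover have "(1 + d) powr \<gamma> \<le> 1 + d"
      using powr_mono[of \<gamma> 1 "1 + d"] \<gamma> by (simp add: d_def)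
    ultimately have "v X \<le> M * (2 * \<rho> * pen X)"
      using vgrowth[of X] M unfolding d_def[symmetric]
      by (meson mult_left_mono order_trans zero_le_one)
    then have "exp (f w) * pen X \<le> (2 * M * \<rho>) * pen X" using vX by (simp add: mult_ac)
    then have "exp (f w) \<le> 2 * M * \<rho>" using pen(2)[of X] by simp
    then have "f w \<le> y" unfolding y_def using M \<rho> by (subst ln_ge_iff) auto
    then show ?thesis by (simp add: f_def t_def)
  qed
  define p where "p = (L / 2 * t powr (-3/2)) *\<^sub>R w"
  define e where "e = (2 / (\<rho>\<^sup>2 + (norm X)\<^sup>2)) *\<^sub>R X"
  have normp: "norm p = L / (2 * sqrt t)"
  proof -
    have "norm p = L / 2 * (t powr (-3/2) * t powr 1)" using L t by (simp add: p_def t_def[symmetric])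
    also have "t powr (-3/2) * t powr 1 = t powr (- (1/2))" unfolding powr_add[symmetric] by simp
    also have "\<dots> = 1 / sqrt t" using t by (simp only: powr_minus_half less_imp_le)
    finally show ?thesis by simp
  qed
  have norme: "norm e \<le> 1 / \<rho>"
    using penalty_gradient[of \<rho> X] \<rho> by (simp add: e_def)

  define \<phi> where "\<phi> x = (Q * v Y) * (exp (L * sqrt (norm (x - Y))) * (1 + (norm x)\<^sup>2 / \<rho>\<^sup>2)) - 1" for x
  define \<psi> where "\<psi> y = (v X / (Q * pen X)) * exp (- (L * sqrt (norm (X - y)))) - 1" for y
  have \<phi>X: "\<phi> X = u X" using XY by (simp add: \<phi>_def v_def f_def pen_def mult_ac)
  have \<phi>le: "u x \<le> \<phi> x" for x
    using max[of x Y] by (simp add: \<phi>_def v_def f_def pen_def mult_ac)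
  have \<psi>Y: "\<psi> Y = u Y"
  proof -
    have "v X / (Q * pen X) = v Y * exp (f w)" using Q pen(2)[of X] by (simp add: XY w_def)
    then show ?thesis by (simp add: \<psi>_def f_def w_def v_def mult.assoc exp_minus_inverse)
  qed
  have \<psi>le: "\<psi> y \<le> u y" for y
  proof -
    have "v X / (Q * pen X) \<le> v y * exp (f (X - y))"
      using max[of X y] Q pen(2)[of X] by (simp add: pos_divide_le_eq mult_ac)
    then have "v X / (Q * pen X) * exp (- f (X - y)) \<le> v y * exp (f (X - y)) * exp (- f (X - y))"
      by (rule mult_right_mono) simp
    also have "v y * exp (f (X - y)) * exp (- f (X - y)) = v y" by (simp only: mult.assoc exp_minus_inverse mult_1_right)
    finally show ?thesis by (simp add: \<psi>_def f_def v_def)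
  qed
  define g\<phi> where "g\<phi> x = ((Q * v Y) * (exp (L * sqrt (norm (x - Y))) * (1 + (norm x)\<^sup>2 / \<rho>\<^sup>2)))
        *\<^sub>R ((L / 2 * norm (x - Y) powr (-3/2)) *\<^sub>R (x - Y) + (2 / (\<rho>\<^sup>2 + (norm x)\<^sup>2)) *\<^sub>R x)" for x
  define g\<psi> where "g\<psi> y = ((v X / (Q * pen X)) * exp (- (L * sqrt (norm (X - y)))))
        *\<^sub>R ((L / 2 * norm (X - y) powr (-3/2)) *\<^sub>R (X - y))" for y
  have C2\<phi>: "has_C2 (- {Y}) \<phi> g\<phi>" unfolding \<phi>_def g\<phi>_def using \<rho> by (intro has_C2_upper_test) simp
  have C2\<psi>: "has_C2 (- {X}) \<psi> g\<psi>" unfolding \<psi>_def g\<psi>_def by (rule has_C2_lower_test)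
  have g\<phi>X: "g\<phi> X = v X *\<^sub>R (p + e)"
  proof -
    have "(Q * v Y) * (exp (L * sqrt (norm (X - Y))) * (1 + (norm X)\<^sup>2 / \<rho>\<^sup>2)) = v X"
      by (simp add: XY f_def pen_def mult_ac)
    then show ?thesis by (simp add: g\<phi>_def p_def e_def t_def w_def)
  qed
  have g\<psi>Y: "g\<psi> Y = v Y *\<^sub>R p"
  proof -
    have "(v X / (Q * pen X)) * exp (- (L * sqrt (norm (X - Y)))) = v Y"
      using \<psi>Y by (simp add: \<psi>_def v_def)
    then show ?thesis by (simp add: g\<psi>_def p_def t_def w_def)
  qed

  \<comment> \<open>The scale of the gain: at most |w|, as concavity requires, and at most 1, to
    stay in the unit ball where \<open>near_estimate\<close> applies.\<close>
  define \<tau> where "\<tau> = min t 1"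
  have \<tau>: "0 < \<tau>" "\<tau> \<le> t" "\<tau> \<le> 1" using t by (auto simp: \<tau>_def)
  define k b where "k = (1 - \<gamma>) / 2" and "b = (1 + \<gamma>) / 2"
  have kb: "0 < k" "k \<le> 1" "0 < b" "b < 1" using \<gamma> by (auto simp: k_def b_def)
  define h where "h z = min ((norm z)\<^sup>2) (norm z powr b)" for z :: 'a
  have Jint: "has_bochner_integral lebesgue (\<lambda>z. h z * ker s z) J"
    unfolding h_def J b_def[symmetric]
    by (intro has_bochner_integral_integrable integrable_min_ker) (use s kb in auto)
  have J0: "0 \<le> J" unfolding J by (intro integral_nonneg_AE AE_I2) auto
  have C0: "0 \<le> C" using C(2) M by linarith
  \<comment> \<open>One coefficient for short and long jumps; the short-jump factor 1 / \<rho> is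
    weakened to \<rho>^(-k) to match.\<close>
  define Ca where "Ca = C * \<rho> powr (- k) * (1 + 1 / sqrt t)"
  have Ca: "0 \<le> Ca" using C0 t by (simp add: Ca_def)
  define A where "A = L / 8 * t powr (-3/2)"
  have A: "0 < A" using L t by (simp add: A_def)
  have gap: "Lam * (Ca * J) < lam * (A * c * \<tau> powr (2 - 2 * s))"
  proof -
    define T where "T = 1 + (y / L) ^ 3"
    \<comment> \<open>For t \<le> 1 this compares the exponents -1/2 and 1/2 - 2s, which is where s
      \<ge> 1/2 enters. For t > 1 the gain is smaller by t^(3/2), which \<open>fy\<close> bounds by
      the cube of a logarithm over L.\<close>
    have ge1: "1 + 1 / sqrt t \<le> 2 * T * (t powr (-3/2) * \<tau> powr (2 - 2 * s))"
    proof -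
      have y0: "0 \<le> y / L" using fy L t by (smt (verit) divide_nonneg_pos mult_nonneg_nonneg real_sqrt_ge_zero)
      then have T: "1 \<le> T" by (simp add: T_def)
      show ?thesis
      proof (cases "t \<le> 1")
        case True
        have "1 / sqrt t = t powr (- (1/2))" using t by (simp only: powr_minus_half less_imp_le)
        also have "\<dots> \<le> t powr (-3/2 + (2 - 2 * s))" using t True s by (intro powr_mono') auto
        also have "\<dots> = t powr (-3/2) * \<tau> powr (2 - 2 * s)" using True by (simp only: powr_add \<tau>_def min_absorb1)
        finally have 1: "1 / sqrt t \<le> t powr (-3/2) * \<tau> powr (2 - 2 * s)" .
        have 2: "1 \<le> 1 / sqrt t" using t True by simp
        have "1 + 1 / sqrt t \<le> 2 * 1 * (t powr (-3/2) * \<tau> powr (2 - 2 * s))" using 1 2 by linarith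
        also have "\<dots> \<le> 2 * T * (t powr (-3/2) * \<tau> powr (2 - 2 * s))"
          using T by (intro mult_right_mono) auto
        finally show ?thesis .
      next
        case False
        have tau1: "\<tau> = 1" using False by (simp add: \<tau>_def)
        have "sqrt t \<le> y / L" using fy L by (simp add: pos_le_divide_eq mult.commute)
        then have "sqrt t ^ 3 \<le> (y / L) ^ 3" using t by (intro power_mono) auto
        moreover have "sqrt t ^ 3 = t powr (3/2)"
        proof -
          have "sqrt t ^ 3 = (t powr (1/2)) ^ 3" using t by (simp add: powr_half_sqrt)
          also have "\<dots> = t powr (3/2)" using t by (simp add: powr_power)
          finally show ?thesis .
        qed
        ultimately have "t powr (3/2) \<le> T" by (simp add: T_def)
        then have "t powr (3/2) * t powr (-3/2) \<le> T * t powr (-3/2)" by (rule mult_right_mono) simp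
        then have "1 \<le> T * t powr (-3/2)" using t by (simp add: powr_add[symmetric])
        moreover have "1 / sqrt t \<le> 1" using False by simp
        ultimately show ?thesis by (simp add: tau1)
      qed
    qed
    have pos: "0 < t powr (-3/2) * \<tau> powr (2 - 2 * s)" using t \<tau> by simp
    have "Lam * (Ca * J) = (Lam * C * J * \<rho> powr (- k)) * (1 + 1 / sqrt t)" by (simp add: Ca_def)
    also have "\<dots> \<le> (Lam * C * J * \<rho> powr (- k)) * (2 * T * (t powr (-3/2) * \<tau> powr (2 - 2 * s)))"
      using lam C0 J0 by (intro mult_left_mono ge1) auto
    also have "\<dots> = (16 * Lam * C * J * \<rho> powr (- k) * T) * ((t powr (-3/2) * \<tau> powr (2 - 2 * s)) / 8)" by simp
    also have "\<dots> < (lam * L * c) * ((t powr (-3/2) * \<tau> powr (2 - 2 * s)) / 8)"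
      using S2 pos by (intro mult_strict_right_mono) (auto simp: k_def T_def y_def)
    also have "\<dots> = lam * (A * c * \<tau> powr (2 - 2 * s))" by (simp add: A_def)
    finally show ?thesis .
  qed
  obtain iN where iN: "A * c * \<tau> powr (2 - 2 * s) \<le> iN" and Nint:
    "has_bochner_integral lebesgue (\<lambda>z. indicator (ball ((\<tau> / 10) *\<^sub>R (w /\<^sub>R norm w)) (\<tau> / 1000)) z * (A * (norm z)\<^sup>2) * ker s z) iN"
    using c(2)[of "w /\<^sub>R norm w" \<tau> A] w \<tau> A by auto
  define N where "N z = indicator (ball ((\<tau> / 10) *\<^sub>R (w /\<^sub>R norm w)) (\<tau> / 1000)) z * (A * (norm z)\<^sup>2)" for z

  have ball\<phi>: "has_C2 (ball X t) \<phi> g\<phi>"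
    by (rule has_C2_subset[OF C2\<phi>]) (auto simp: t_def w_def dist_norm)
  have ball\<psi>: "has_C2 (ball Y t) \<psi> g\<psi>"
    by (rule has_C2_subset[OF C2\<psi>]) (auto simp: t_def w_def dist_norm norm_minus_commute)
  obtain C1 r1 where C1: "0 \<le> C1" "0 < r1" "\<And>z. norm z < r1 \<Longrightarrow> \<bar>\<phi> (X + z) - \<phi> X - g\<phi> X \<bullet> z\<bar> \<le> C1 * (norm z)\<^sup>2"
    using expandsE[OF has_C2_expands[OF ball\<phi> t]] by blast
  obtain C2 r2 where C2: "0 \<le> C2" "0 < r2" "\<And>z. norm z < r2 \<Longrightarrow> \<bar>\<psi> (Y + z) - \<psi> Y - g\<psi> Y \<bullet> z\<bar> \<le> C2 * (norm z)\<^sup>2"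
    using expandsE[OF has_C2_expands[OF ball\<psi> t]] by blast
  \<comment> \<open>C1 and C2 are compactness constants of unknown size. They act on the glued balls
    only, with total weight of order r^(2 - 2s), which is made smaller than the strict gap by the
    choice of r.\<close>
  define Cs where "Cs = C1 / v X + C2 / v Y"
  have Cs: "0 \<le> Cs" using C1 C2 v1(2) less_imp_le by (auto simp: Cs_def intro!: add_nonneg_nonneg divide_nonneg_pos)
  define J2 where "J2 = integral\<^sup>L lebesgue (\<lambda>z::'a. min ((norm z)\<^sup>2) 1 * ker s z)"
  have "((\<lambda>r. Lam * (Cs * J2 * r powr (2 - 2 * s))) \<longlongrightarrow> Lam * (Cs * J2 * 0 powr (2 - 2 * s))) (at_right 0)"
    using s by (intro tendsto_mult tendsto_const tendsto_powr' tendsto_ident_at)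
      (auto intro!: eventually_at_rightI[of 0 1])
  then have "((\<lambda>r. Lam * (Cs * J2 * r powr (2 - 2 * s))) \<longlongrightarrow> 0) (at_right 0)" by simp
  then have ev1: "\<forall>\<^sub>F r in at_right 0. Lam * (Cs * J2 * r powr (2 - 2 * s)) < lam * (A * c * \<tau> powr (2 - 2 * s)) - Lam * (Ca * J)"
    using gap by (intro order_tendstoD(2)) auto
  \<comment> \<open>The bound \<tau> / 20 keeps the glued balls clear of the ball carrying the gain,
    whose points have norm at least 99/1000 \<tau>, and of the singular points of the test
    functions.\<close>
  have ev2: "\<forall>\<^sub>F r in at_right 0. r \<in> {0<..<min (min r1 r2) (\<tau> / 20)}"
    using C1 C2 \<tau> by (intro eventually_at_right_real) auto
  obtain r where "Lam * (Cs * J2 * r powr (2 - 2 * s)) < lam * (A * c * \<tau> powr (2 - 2 * s)) - Lam * (Ca * J) \<and>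
      r \<in> {0<..<min (min r1 r2) (\<tau> / 20)}"
    using eventually_happens'[OF trivial_limit_at_right_real eventually_conj[OF ev1 ev2]] by blast
  then have r: "Lam * (Cs * J2 * r powr (2 - 2 * s)) < lam * (A * c * \<tau> powr (2 - 2 * s)) - Lam * (Ca * J)"
    "r < r1" "r < r2" "r < \<tau> / 20" "0 < r"
    by simp_all
  define P where "P z = Ca * h z + Cs * (r\<^sup>2 * min ((norm (z /\<^sub>R r))\<^sup>2) 1)" for z :: 'a
  have Pint: "has_bochner_integral lebesgue (\<lambda>z. P z * ker s z) (Ca * J + Cs * J2 * r powr (2 - 2 * s))"
  proof -
    have sum: "has_bochner_integral lebesgue (\<lambda>z. Ca * (h z * ker s z) + Cs * r\<^sup>2 * (min ((norm (z /\<^sub>R r))\<^sup>2) 1 * ker s z))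
       (Ca * J + Cs * r\<^sup>2 * (J2 * r powr (- 2 * s)))"
      unfolding J2_def using r s0 s
      by (intro has_bochner_integral_add has_bochner_integral_mult_right Jint min_scale_integral) auto
    have pw: "r\<^sup>2 * r powr (- 2 * s) = r powr (2 - 2 * s)"
    proof -
      have "r\<^sup>2 * r powr (- 2 * s) = r powr 2 * r powr (- 2 * s)" using r by simp
      also have "\<dots> = r powr (2 + - 2 * s)" by (simp only: powr_add)
      finally show ?thesis by simp
    qed
    have "Cs * r\<^sup>2 * (J2 * r powr (- 2 * s)) = Cs * J2 * (r\<^sup>2 * r powr (- 2 * s))" by (simp only: mult_ac)
    also have "\<dots> = Cs * J2 * r powr (2 - 2 * s)" unfolding pw ..
    finally have val: "Cs * r\<^sup>2 * (J2 * r powr (- 2 * s)) = Cs * J2 * r powr (2 - 2 * s)" .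
    show ?thesis using sum[unfolded val] by (simp add: P_def distrib_right mult.assoc)
  qed

  let ?G = "glue \<phi> X r u" and ?H = "glue \<psi> Y r u"
  have sub: "visc_subsolution s I (\<lambda>x r p. rpow r q * rpow (norm p) m) UNIV u"
    and super: "visc_supersolution s I (\<lambda>x r p. rpow r q * rpow (norm p) m) UNIV u"
    using sol by (auto simp: visc_solution_def)
  have rt: "r < t" using r \<tau> by linarith
  have cX: "cball X r \<subseteq> - {Y}" and cY: "cball Y r \<subseteq> - {X}"
    using rt by (auto simp: t_def w_def dist_norm norm_minus_commute)
  note G = subsolution_test[OF sub s0 s(2) C2\<phi> r(5) cX \<phi>X[symmetric] \<phi>le]
  note H = supersolution_test[OF super s0 s(2) C2\<psi> r(5) cY \<psi>Y[symmetric] \<psi>le]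
  define U where "U z = 1 / v X * ?G (z + X)" for z
  define V where "V z = 1 / v Y * ?H (z + Y)" for z
  have vinv: "0 < 1 / v X" "0 < 1 / v Y" using v1(2) by auto
  have U: "I U 0 = 1 / v X * I ?G X" "expands U 0 ((1 / v X) *\<^sub>R g\<phi> X)" "U \<in> L1_weight s"
    unfolding U_def using operator_normalize[OF ti hom G(3,2) _ vinv(1)] s0 by auto
  have V: "I V 0 = 1 / v Y * I ?H Y" "expands V 0 ((1 / v Y) *\<^sub>R g\<psi> Y)" "V \<in> L1_weight s"
    unfolding V_def using operator_normalize[OF ti hom H(3,2) _ vinv(2)] s0 by auto
  have gU: "(1 / v X) *\<^sub>R g\<phi> X = p + e" and gV: "(1 / v Y) *\<^sub>R g\<psi> Y = p"
    using v1(2)[of X] v1(2)[of Y] by (simp_all add: g\<phi>X g\<psi>Y)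

  have IUV: "0 \<le> I U 0 - I V 0"
  proof -
    define kk where "kk = (q + m - 1) / (m + 1)"
    have kk: "0 < kk" using qm by (simp add: kk_def)
    have fw: "f w = L * sqrt t" by (simp add: f_def t_def)
    have f0: "0 \<le> f w" using L by (simp add: f_def)
    have vv: "exp (f w) * v Y \<le> v X"
    proof -
      have "1 * 1 \<le> Q * pen X" using Q pen(1)[of X] by (intro mult_mono) auto
      then have "(exp (f w) * v Y) * 1 \<le> (exp (f w) * v Y) * (Q * pen X)"
        using v1(2)[of Y] by (intro mult_left_mono) auto
      then show ?thesis by (simp add: XY w_def mult_ac)
    qed
    have uu: "u Y \<le> u X"
    proof -
      have "1 * v Y \<le> exp (f w) * v Y" using f0 v1(2)[of Y] by (intro mult_right_mono) auto
      then show ?thesis using vv by (simp add: v_def)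
    qed
    \<comment> \<open>Since \<open>f w\<close> times the norm of p is exactly L^2 / 2, the
      exponential factor lowers the norm of p by at least (L^2 kk / 2) / (1 + kk f w). By
      \<open>S1\<close> this is no less than 1 / \<rho>, hence no less than the norm of e.\<close>
    have np: "norm p * exp (- kk * f w) \<le> norm (p + e)"
    proof -
      have "exp (- (kk * f w)) \<le> 1 / (1 + kk * f w)"
      proof -
        have "1 + kk * f w \<le> exp (kk * f w)" by (rule exp_ge_add_one_self)
        then show ?thesis using kk f0 by (simp add: exp_minus divide_inverse le_imp_inverse_le add_pos_nonneg)
      qed
      then have "norm p * exp (- (kk * f w)) \<le> norm p * (1 / (1 + kk * f w))" by (rule mult_left_mono) simp
      also have "\<dots> = norm p - norm p * (kk * f w) / (1 + kk * f w)"
      proof -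
        have "0 < 1 + kk * f w" using kk f0 by (simp add: add_pos_nonneg)
        then show ?thesis by (simp add: field_simps)
      qed
      also have "norm p * (kk * f w) = L\<^sup>2 * kk / 2"
        using t by (simp add: normp fw power2_eq_square)
      finally have 1: "norm p * exp (- (kk * f w)) \<le> norm p - L\<^sup>2 * kk / 2 / (1 + kk * f w)" .
      have "1 + kk * f w \<le> 1 + kk * y" using fy kk by (simp add: fw)
      then have "(1 + kk * f w) / \<rho> \<le> (1 + kk * y) / \<rho>" using \<rho> by (intro divide_right_mono) auto
      also have "\<dots> \<le> L\<^sup>2 * kk / 2" using S1 by (simp add: kk_def y_def)
      finally have "1 / \<rho> \<le> L\<^sup>2 * kk / 2 / (1 + kk * f w)"
        using kk f0 \<rho> by (simp add: pos_le_divide_eq add_pos_nonneg mult.commute)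
      then have "norm p * exp (- (kk * f w)) \<le> norm p - norm e" using 1 norme by linarith
      also have "\<dots> \<le> norm (p + e)" by (rule norm_diff_ineq)
      finally show ?thesis by simp
    qed
    have "rpow (u Y) q * rpow ((1 + u Y) * norm p) m / (1 + u Y)
       \<le> rpow (u X) q * rpow ((1 + u X) * norm (p + e)) m / (1 + u X)"
    proof (rule hamiltonian_compare[OF qm nonneg uu f0])
      show "exp (f w) * (1 + u Y) \<le> 1 + u X" using vv by (simp add: v_def)
      show "norm p * exp (- ((q + m - 1) / (m + 1)) * f w) \<le> norm (p + e)" using np by (simp add: kk_def)
    qed simp
    moreover have "I V 0 \<le> rpow (u Y) q * rpow ((1 + u Y) * norm p) m / (1 + u Y)"
      unfolding V(1) using H(1) v1(2)[of Y] by (simp add: g\<psi>Y v_def[symmetric] divide_right_mono)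
    moreover have "rpow (u X) q * rpow ((1 + u X) * norm (p + e)) m / (1 + u X) \<le> I U 0"
      unfolding U(1) using G(1) v1(2)[of X] by (simp add: g\<phi>X v_def[symmetric] divide_right_mono)
    ultimately show ?thesis by linarith
  qed

  have U0: "U 0 = u X / v X" and V0: "V 0 = u Y / v Y"
    using r by (simp_all add: U_def V_def glue_def \<phi>X \<psi>Y)
  \<comment> \<open>Three ranges: below r both functions are the test functions and only their
    Taylor bounds count; from r to 1 maximality and concavity are used; beyond 1 there is no
    compensator, and the growth of \<open>v\<close> decides.\<close>
  have bound: "(U (0 + z) - U 0) - (V (0 + z) - V 0) - indicator (ball 0 1) z * ((p + e - p) \<bullet> z) \<le> P z - N z"
    if z: "z \<noteq> 0" for z
  proof (cases "norm z < r")
    case True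
    have Nz: "N z = 0"
    proof (rule ccontr)
      assume "N z \<noteq> 0"
      then have "z \<in> ball ((\<tau> / 10) *\<^sub>R (w /\<^sub>R norm w)) (\<tau> / 1000)" by (auto simp: N_def indicator_def split: if_splits)
      from gain_pointwise(2)[OF w less_imp_le[OF L] \<tau>(1) \<tau>(2)[unfolded t_def] this] show False
        using True r \<tau> by linarith
    qed
    have Uz: "U z = \<phi> (X + z) / v X" and Vz: "V z = \<psi> (Y + z) / v Y"
      using True by (simp_all add: U_def V_def glue_def dist_norm add.commute)
    have "U z - U 0 - (p + e) \<bullet> z = (\<phi> (X + z) - \<phi> X - g\<phi> X \<bullet> z) / v X"
      using v1(2)[of X] by (simp add: Uz U0 \<phi>X g\<phi>X diff_divide_distrib)
    also have "\<dots> \<le> C1 * (norm z)\<^sup>2 / v X"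
      using C1(3)[of z] True r v1(2)[of X] by (intro divide_right_mono) auto
    finally have 1: "U z - U 0 - (p + e) \<bullet> z \<le> C1 * (norm z)\<^sup>2 / v X" .
    have "- (C2 * (norm z)\<^sup>2 / v Y) \<le> (\<psi> (Y + z) - \<psi> Y - g\<psi> Y \<bullet> z) / v Y"
      unfolding minus_divide_left using C2(3)[of z] True r v1(2)[of Y] by (intro divide_right_mono) auto
    also have "\<dots> = V z - V 0 - p \<bullet> z"
      using v1(2)[of Y] by (simp add: Vz V0 \<psi>Y g\<psi>Y diff_divide_distrib)
    finally have 2: "- (C2 * (norm z)\<^sup>2 / v Y) \<le> V z - V 0 - p \<bullet> z" .
    have "Cs * (norm z)\<^sup>2 \<le> P z"
    proof -
      have "norm (z /\<^sub>R r) \<le> 1" using True r by (simp add: field_simps)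
      then have "(norm (z /\<^sub>R r))\<^sup>2 \<le> 1" by (intro power_le_one) auto
      then have "min ((norm (z /\<^sub>R r))\<^sup>2) 1 = (norm (z /\<^sub>R r))\<^sup>2" by (rule min_absorb1)
      moreover have "r\<^sup>2 * (norm (z /\<^sub>R r))\<^sup>2 = (norm z)\<^sup>2" using r by (simp add: field_simps)
      ultimately have "Cs * (r\<^sup>2 * min ((norm (z /\<^sub>R r))\<^sup>2) 1) = Cs * (norm z)\<^sup>2" by simp
      moreover have "0 \<le> Ca * h z" using Ca by (simp add: h_def)
      ultimately show ?thesis unfolding P_def by linarith
    qed
    moreover have "C1 * (norm z)\<^sup>2 / v X + C2 * (norm z)\<^sup>2 / v Y = Cs * (norm z)\<^sup>2"
      by (simp add: Cs_def distrib_right)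
    moreover have "z \<in> ball 0 1" using True r \<tau> by simp
    ultimately show ?thesis using 1 2 Nz by (simp add: inner_add_left)
  next
    case False
    define XX YY E where "XX = v (X + z) / v X" and "YY = v (Y + z) / v Y" and "E = pen (X + z) / pen X"
    have Uz': "U z = u (X + z) / v X" and Vz': "V z = u (Y + z) / v Y"
      using False by (simp_all add: U_def V_def glue_def dist_norm add.commute)
    \<comment> \<open>Increments of \<open>u\<close> divided by \<open>v\<close> are increments of
      ratios of \<open>v\<close>: the added 1 cancels.\<close>
    have shift: "a / (1 + b) - b / (1 + b) = (1 + a) / (1 + b) - 1" if "0 < 1 + b" for a b :: real
    proof -
      have "a / (1 + b) - b / (1 + b) = ((1 + a) - (1 + b)) / (1 + b)"
        by (simp only: diff_divide_distrib[symmetric] add_diff_cancel_left)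
      also have "\<dots> = (1 + a) / (1 + b) - 1" by (subst diff_divide_distrib) (use that in simp)
      finally show ?thesis .
    qed
    have Uz: "U z - U 0 = XX - 1" and Vz: "V z - V 0 = YY - 1"
      using v1(2)[of X] v1(2)[of Y] unfolding Uz' Vz' U0 V0 XX_def YY_def v_def
      by (simp_all only: shift)
    have Epos: "0 < E" using pen by (simp add: E_def)
    have E: "E = 1 + (2 * (X \<bullet> z) + (norm z)\<^sup>2) / (\<rho>\<^sup>2 + (norm X)\<^sup>2)"
    proof -
      have den: "0 < \<rho>\<^sup>2 + (norm X)\<^sup>2" using \<rho> by (simp add: add_pos_nonneg)
      have p: "pen x = (\<rho>\<^sup>2 + (norm x)\<^sup>2) / \<rho>\<^sup>2" for x using \<rho> by (simp add: pen_def add_divide_distrib)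
      have "E = (\<rho>\<^sup>2 + (norm (X + z))\<^sup>2) / (\<rho>\<^sup>2 + (norm X)\<^sup>2)" using \<rho> by (simp add: E_def p)
      also have "(norm (X + z))\<^sup>2 = (norm X)\<^sup>2 + (2 * (X \<bullet> z) + (norm z)\<^sup>2)"
        unfolding power2_norm_eq_inner by (simp add: inner_add inner_commute)
      also have "(\<rho>\<^sup>2 + ((norm X)\<^sup>2 + (2 * (X \<bullet> z) + (norm z)\<^sup>2))) / (\<rho>\<^sup>2 + (norm X)\<^sup>2)
        = (\<rho>\<^sup>2 + (norm X)\<^sup>2) / (\<rho>\<^sup>2 + (norm X)\<^sup>2) + (2 * (X \<bullet> z) + (norm z)\<^sup>2) / (\<rho>\<^sup>2 + (norm X)\<^sup>2)"
        unfolding add_divide_distrib[symmetric] by (simp add: add.assoc)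
      finally show ?thesis using \<rho> by simp
    qed
    \<comment> \<open>Moving both points by z leaves their difference, and with it the factor exp f,
      unchanged; only the penalty differs. The next two facts move one point at a time.\<close>
    have XE: "XX \<le> E * YY"
    proof -
      have "v (X + z) \<le> Q * (v (Y + z) * exp (f w) * pen (X + z))" using max[of "X + z" "Y + z"] by (simp add: w_def)
      then have "XX \<le> Q * (v (Y + z) * exp (f w) * pen (X + z)) / v X"
        unfolding XX_def using v1(2)[of X] by (intro divide_right_mono) auto
      also have "\<dots> = E * YY" using Q pen(2)[of X] v1(2)[of Y] by (simp add: XY E_def YY_def w_def mult_ac)
      finally show ?thesis .
    qed
    have Xa: "XX \<le> E * exp (L * (sqrt (norm (w + z)) - sqrt (norm w)))"
    proof -
      have "v (X + z) \<le> Q * (v Y * exp (f (w + z)) * pen (X + z))" using max[of "X + z" Y] by (simp add: w_def algebra_simps)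
      then have "XX \<le> Q * (v Y * exp (f (w + z)) * pen (X + z)) / v X"
        unfolding XX_def using v1(2)[of X] by (intro divide_right_mono) auto
      also have "\<dots> = E * (exp (f (w + z)) / exp (f w))" using Q pen(2)[of X] v1(2)[of Y] by (simp add: XY E_def w_def mult_ac)
      also have "exp (f (w + z)) / exp (f w) = exp (L * (sqrt (norm (w + z)) - sqrt (norm w)))"
        by (simp add: exp_diff f_def right_diff_distrib)
      finally show ?thesis .
    qed
    have Yb: "exp (L * (sqrt (norm w) - sqrt (norm (w - z)))) \<le> YY"
    proof -
      have "Q * (v Y * exp (f w) * pen X) \<le> Q * (v (Y + z) * exp (f (w - z)) * pen X)"
        using max[of X "Y + z"] by (simp add: XY w_def algebra_simps)
      then have "v Y * exp (f w) \<le> v (Y + z) * exp (f (w - z))" using Q pen(2)[of X] by simp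
      then have "exp (f w) / exp (f (w - z)) \<le> v (Y + z) / v Y" using v1(2)[of Y] by (simp add: field_simps)
      moreover have "exp (f w) / exp (f (w - z)) = exp (L * (sqrt (norm w) - sqrt (norm (w - z))))"
        by (simp add: exp_diff f_def right_diff_distrib)
      ultimately show ?thesis by (simp add: YY_def)
    qed
    have Pz: "Ca * h z \<le> P z" using Cs by (simp add: P_def)
    have b2: "norm z powr 2 = (norm z)\<^sup>2" using z by simp
    show ?thesis
    proof (cases "norm z < 1")
      case near: True
      have hz: "h z = (norm z)\<^sup>2"
      proof -
        have "norm z powr 2 \<le> norm z powr b" using near kb by (intro powr_mono') auto
        then show ?thesis unfolding h_def b2 by (rule min_absorb1)
      qed
      have "XX - YY - e \<bullet> z \<le> exp L * (1 + L) * ((1 + 1 / sqrt t) / \<rho>) * (norm z)\<^sup>2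
         - max 0 (exp (L * (sqrt (norm w) - sqrt (norm (w - z)))) - exp (L * (sqrt (norm (w + z)) - sqrt (norm w))))"
        unfolding e_def t_def
        by (rule near_estimate[OF w less_imp_le[OF L] \<rho> less_imp_le[OF near] E less_imp_le[OF Epos] XE Xa Yb])
      moreover have "exp L * (1 + L) * ((1 + 1 / sqrt t) / \<rho>) * (norm z)\<^sup>2 \<le> Ca * h z"
      proof -
        have "1 / \<rho> \<le> \<rho> powr (- k)"
          using powr_mono[of "- 1" "- k" \<rho>] kb \<rho> by (simp add: powr_minus divide_inverse)
        then have "exp L * (1 + L) * (1 / \<rho>) \<le> C * \<rho> powr (- k)"
          using C(1) C0 \<rho> by (intro mult_mono) auto
        then have "exp L * (1 + L) * (1 / \<rho>) * ((1 + 1 / sqrt t) * (norm z)\<^sup>2) \<le> C * \<rho> powr (- k) * ((1 + 1 / sqrt t) * (norm z)\<^sup>2)"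
          using t by (intro mult_right_mono) auto
        then show ?thesis by (simp add: Ca_def hz mult.assoc)
      qed
      moreover have "N z \<le> max 0 (exp (L * (sqrt (norm w) - sqrt (norm (w - z)))) - exp (L * (sqrt (norm (w + z)) - sqrt (norm w))))"
      proof (cases "z \<in> ball ((\<tau> / 10) *\<^sub>R (w /\<^sub>R norm w)) (\<tau> / 1000)")
        case True
        then have "N z = L / 8 * norm w powr (-3/2) * (norm z)\<^sup>2" by (simp add: N_def A_def t_def)
        then show ?thesis
          using gain_pointwise(1)[OF w less_imp_le[OF L] \<tau>(1) \<tau>(2)[unfolded t_def] True]
          by (intro max.coboundedI2) linarith
      next
        case False
        then show ?thesis by (simp add: N_def)
      qed
      ultimately have "XX - YY - e \<bullet> z \<le> Ca * h z - N z" by linarith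
      then show ?thesis using Pz near Uz Vz by simp
    next
      case far: False
      then have z1: "1 \<le> norm z" by simp
      have hz: "h z = norm z powr b"
      proof -
        have "norm z powr b \<le> norm z powr 2" using z1 kb by (intro powr_mono) auto
        then show ?thesis unfolding h_def b2 by (rule min_absorb2)
      qed
      have Nz: "N z = 0"
      proof (rule ccontr)
        assume "N z \<noteq> 0"
        then have "z \<in> ball ((\<tau> / 10) *\<^sub>R (w /\<^sub>R norm w)) (\<tau> / 1000)" by (auto simp: N_def indicator_def split: if_splits)
        from gain_pointwise(3)[OF w less_imp_le[OF L] \<tau>(1) \<tau>(2)[unfolded t_def] this] show False
          using z1 \<tau> by linarith
      qed
      have XM: "XX \<le> M * (2 * \<rho> powr \<gamma> + 4 * norm z powr \<gamma>)"
      proof -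
        have "XX \<le> v (X + z) / pen X"
          unfolding XX_def using vXpen v1(2)[of X] v1(2)[of "X + z"] pen(2)[of X] by (intro divide_left_mono) auto
        also have "\<dots> \<le> M * (1 + norm (X + z)) powr \<gamma> / pen X"
          using vgrowth[of "X + z"] pen(2)[of X] by (intro divide_right_mono) auto
        also have "\<dots> = M * ((1 + norm (X + z)) powr \<gamma> / pen X)" by simp
        also have "\<dots> \<le> M * (2 * \<rho> powr \<gamma> + 4 * norm z powr \<gamma>)"
          unfolding pen_def using M by (intro mult_left_mono growth_ratio \<gamma> \<rho> z1) auto
        finally show ?thesis .
      qed
      have "XX - YY \<le> 12 * M * \<rho> powr (- ((1 - \<gamma>) / 2)) * norm z powr ((1 + \<gamma>) / 2)"
        by (rule far_estimate[OF \<gamma> \<rho> z1 _ E Epos _ XM _ XE])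
          (use M v1(2) less_imp_le in \<open>auto simp: XX_def YY_def intro!: divide_nonneg_pos\<close>)
      also have "\<dots> \<le> C * \<rho> powr (- k) * norm z powr b"
        unfolding k_def b_def using C(2) by (intro mult_right_mono) auto
      also have "\<dots> \<le> Ca * h z"
      proof -
        have "C * \<rho> powr (- k) * norm z powr b * 1 \<le> C * \<rho> powr (- k) * norm z powr b * (1 + 1 / sqrt t)"
          using C0 t by (intro mult_left_mono) auto
        then show ?thesis by (simp add: Ca_def hz mult_ac)
      qed
      finally show ?thesis using Pz far Uz Vz Nz by simp
    qed
  qed
  have "I U 0 - I V 0 \<le> Lam * (Ca * J + Cs * J2 * r powr (2 - 2 * s)) - lam * iN"
  proof (rule elliptic_upper[OF ell expands_C11_at[OF U(2)] U(3) expands_C11_at[OF V(2)] V(3)])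
    fix K :: "'a \<Rightarrow> real" assume K: "K \<in> kernels s lam Lam"
    show "nonlocal_op s K U 0 - nonlocal_op s K V 0 \<le> Lam * (Ca * J + Cs * J2 * r powr (2 - 2 * s)) - lam * iN"
    proof (rule nonlocal_difference_bound[OF s _ lam(2) K U(2,3) V(2,3), where P = P and N = N])
      show "0 \<le> P z" for z using Ca Cs by (simp add: P_def h_def)
      show "0 \<le> N z" for z using A by (simp add: N_def)
    qed (use lam bound Pint Nint in \<open>simp_all add: gU gV N_def\<close>)
  qed
  also have "\<dots> < 0"
  proof -
    have "lam * (A * c * \<tau> powr (2 - 2 * s)) \<le> lam * iN" using iN lam by (intro mult_left_mono) auto
    then show ?thesis using r(1) by (simp add: distrib_left)
  qed
  finally show False using IUV by linarith
qed

text \<open>A pair with different values fixes L. All constants are then determined, and each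
  remaining requirement is an asymptotic one on \<rho>, so a single large \<rho> meets them
  together.\<close>

lemma liouville_sublinear:
  fixes u :: "'a::euclidean_space \<Rightarrow> real" and I :: "'a operator"
  assumes s: "1/2 \<le> s" "s < 1" and lam: "0 < lam" "lam \<le> Lam"
    and ti: "translation_invariant s I" and hom: "pos_homogeneous s I"
    and ell: "elliptic s (kernels s lam Lam) I"
    and qm: "0 \<le> q" "0 \<le> m" "1 < q + m"
    and nonneg: "\<And>x. 0 \<le> u x"
    and sol: "visc_solution s I (\<lambda>x r p. rpow r q * rpow (norm p) m) UNIV u"
    and \<gamma>: "\<gamma> < 1" and growth: "\<And>x. \<bar>u x\<bar> \<le> M * (1 + norm x) powr \<gamma>"
  shows "u constant_on UNIV"
proof (rule ccontr)
  assume "\<not> u constant_on UNIV"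
  then have "\<exists>a. u a \<noteq> u 0" unfolding constant_on_def by blast
  then obtain x0 y0 where xy: "u y0 < u x0" by (meson linorder_neqE_linordered_idom)
  \<comment> \<open>\<open>v = 1 + u\<close> is at least 1, so a negative exponent must be raised to
    0; \<open>M'\<close> absorbs the added 1 and the sign of M.\<close>
  define g where "g = max \<gamma> 0"
  define M' where "M' = 1 + max M 0"
  have g: "0 \<le> g" "g < 1" "\<gamma> \<le> g" and M': "1 \<le> M'" using \<gamma> by (auto simp: g_def M'_def)
  have growth': "1 + u x \<le> M' * (1 + norm x) powr g" for x
  proof -
    have 1: "1 \<le> (1 + norm x) powr g" using g by (intro ge_one_powr_ge_zero) auto
    have "u x \<le> M * (1 + norm x) powr \<gamma>" using growth[of x] by simp
    also have "\<dots> \<le> max M 0 * (1 + norm x) powr \<gamma>" by (intro mult_right_mono) auto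
    also have "\<dots> \<le> max M 0 * (1 + norm x) powr g" using g by (intro mult_left_mono powr_mono) auto
    finally show ?thesis using 1 by (simp add: M'_def distrib_right)
  qed
  have d: "0 < norm (x0 - y0)" using xy by auto
  \<comment> \<open>A third of the available logarithm is spent on the distance of the two points.
    The slack that remains is strict, hence survives the penalty at \<open>x0\<close> once \<rho> is
    large.\<close>
  define \<sigma> where "\<sigma> = ln ((1 + u x0) / (1 + u y0)) / 3"
  have quot: "1 < (1 + u x0) / (1 + u y0)" using xy nonneg[of y0] by (simp add: pos_less_divide_eq)
  then have \<sigma>: "0 < \<sigma>" by (simp add: \<sigma>_def)
  define L where "L = \<sigma> / sqrt (norm (x0 - y0))"
  have L: "0 < L" "L * sqrt (norm (x0 - y0)) = \<sigma>" using \<sigma> d by (auto simp: L_def)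
  have strict: "(1 + u y0) * exp \<sigma> * 1 < 1 + u x0"
  proof -
    have "exp \<sigma> < exp (ln ((1 + u x0) / (1 + u y0)))" using \<sigma> by (simp add: \<sigma>_def)
    also have "\<dots> = (1 + u x0) / (1 + u y0)" using quot by simp
    finally show ?thesis using nonneg[of y0] by (simp add: pos_less_divide_eq mult.commute)
  qed
  obtain c where c: "0 < c" "\<And>(e::'a) \<tau> A. norm e = 1 \<Longrightarrow> 0 < \<tau> \<Longrightarrow> \<tau> \<le> 1 \<Longrightarrow> 0 \<le> A \<Longrightarrow>
      \<exists>i. A * c * \<tau> powr (2 - 2 * s) \<le> i \<and>
      has_bochner_integral lebesgue (\<lambda>z. indicator (ball ((\<tau> / 10) *\<^sub>R e) (\<tau> / 1000)) z * (A * (norm z)\<^sup>2) * ker s z) i"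
    using gain_integral[of s, where 'a='a] s by auto
  define J where "J = integral\<^sup>L lebesgue (\<lambda>z::'a. min ((norm z)\<^sup>2) (norm z powr ((1 + g) / 2)) * ker s z)"
  define C where "C = exp L * (1 + L) + 12 * M'"
  have C: "exp L * (1 + L) \<le> C" "12 * M' \<le> C" using L M' by (auto simp: C_def)
  define k where "k = (q + m - 1) / (m + 1)"
  have k: "0 < k" using qm by (simp add: k_def)
  have decay: "((\<lambda>\<rho>. ln (2 * M' * \<rho>) ^ j * \<rho> powr (- a)) \<longlongrightarrow> 0) at_top" if "0 < a" for a j
    using log_power_decay[of "2 * M'" a j] M' that by simp
  have e1: "\<forall>\<^sub>F \<rho> in at_top. (1 + k * ln (2 * M' * \<rho>)) / \<rho> \<le> L\<^sup>2 * k / 2"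
  proof -
    have "((\<lambda>\<rho>. ln (2 * M' * \<rho>) ^ 0 * \<rho> powr (- 1) + k * (ln (2 * M' * \<rho>) ^ 1 * \<rho> powr (- 1))) \<longlongrightarrow> 0 + k * 0) at_top"
      by (intro tendsto_add tendsto_mult tendsto_const decay) auto
    then have "\<forall>\<^sub>F \<rho> in at_top. ln (2 * M' * \<rho>) ^ 0 * \<rho> powr (- 1) + k * (ln (2 * M' * \<rho>) ^ 1 * \<rho> powr (- 1)) < L\<^sup>2 * k / 2"
      using L k by (intro order_tendstoD(2)) auto
    then show ?thesis using eventually_gt_at_top[of 0]
    proof eventually_elim
      case (elim \<rho>)
      have "\<rho> powr (- 1) = 1 / \<rho>" using elim by (simp add: powr_minus_divide)
      then have "(1 + k * ln (2 * M' * \<rho>)) / \<rho>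
          = ln (2 * M' * \<rho>) ^ 0 * \<rho> powr (- 1) + k * (ln (2 * M' * \<rho>) ^ 1 * \<rho> powr (- 1))"
        by (simp add: add_divide_distrib)
      then show ?case using elim by linarith
    qed
  qed
  have e2: "\<forall>\<^sub>F \<rho> in at_top. 16 * Lam * C * J * \<rho> powr (- ((1 - g) / 2)) * (1 + (ln (2 * M' * \<rho>) / L) ^ 3) < lam * L * c"
  proof -
    let ?a = "(1 - g) / 2"
    have "((\<lambda>\<rho>. 16 * Lam * C * J * (ln (2 * M' * \<rho>) ^ 0 * \<rho> powr (- ?a) + (1 / L ^ 3) * (ln (2 * M' * \<rho>) ^ 3 * \<rho> powr (- ?a))))
        \<longlongrightarrow> 16 * Lam * C * J * (0 + (1 / L ^ 3) * 0)) at_top"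
      using g by (intro tendsto_add tendsto_mult tendsto_const decay) auto
    then have "\<forall>\<^sub>F \<rho> in at_top. 16 * Lam * C * J * (ln (2 * M' * \<rho>) ^ 0 * \<rho> powr (- ?a) + (1 / L ^ 3) * (ln (2 * M' * \<rho>) ^ 3 * \<rho> powr (- ?a))) < lam * L * c"
      using L lam c(1) by (intro order_tendstoD(2)) auto
    moreover have eq: "16 * Lam * C * J * p * (1 + (l / L) ^ 3)
        = 16 * Lam * C * J * (l ^ 0 * p + (1 / L ^ 3) * (l ^ 3 * p))" for p l
      by (simp add: power_divide distrib_left mult_ac)
    ultimately show ?thesis unfolding eq by simp
  qed
  have e3: "\<forall>\<^sub>F \<rho> in at_top. (1 + u y0) * exp \<sigma> * (1 + (norm x0)\<^sup>2 / \<rho>\<^sup>2) < 1 + u x0"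
  proof -
    have "((\<lambda>\<rho>::real. (norm x0)\<^sup>2 / \<rho>\<^sup>2) \<longlongrightarrow> 0) at_top"
      by (intro tendsto_divide_0[OF tendsto_const] filterlim_at_top_imp_at_infinity filterlim_pow_at_top filterlim_ident) simp
    then have "((\<lambda>\<rho>. (1 + u y0) * exp \<sigma> * (1 + (norm x0)\<^sup>2 / \<rho>\<^sup>2)) \<longlongrightarrow> (1 + u y0) * exp \<sigma> * (1 + 0)) at_top"
      by (intro tendsto_mult tendsto_add tendsto_const)
    then show ?thesis using strict by (intro order_tendstoD(2)) auto
  qed
  have "\<forall>\<^sub>F \<rho> in at_top. 1 \<le> \<rho> \<and> (1 + k * ln (2 * M' * \<rho>)) / \<rho> \<le> L\<^sup>2 * k / 2 \<and>
      16 * Lam * C * J * \<rho> powr (- ((1 - g) / 2)) * (1 + (ln (2 * M' * \<rho>) / L) ^ 3) < lam * L * c \<and>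
      (1 + u y0) * exp \<sigma> * (1 + (norm x0)\<^sup>2 / \<rho>\<^sup>2) < 1 + u x0"
    by (intro eventually_conj eventually_ge_at_top e1 e2 e3)
  then obtain \<rho> where \<rho>: "1 \<le> \<rho>" "(1 + k * ln (2 * M' * \<rho>)) / \<rho> \<le> L\<^sup>2 * k / 2"
      "16 * Lam * C * J * \<rho> powr (- ((1 - g) / 2)) * (1 + (ln (2 * M' * \<rho>) / L) ^ 3) < lam * L * c"
      "(1 + u y0) * exp \<sigma> * (1 + (norm x0)\<^sup>2 / \<rho>\<^sup>2) < 1 + u x0"
    using eventually_happens'[OF trivial_limit_at_top_linorder] by blast
  show False
    by (rule doubling_contradiction[OF s lam ti hom ell qm nonneg sol growth' g(1,2) M' L(1) \<rho>(1) c J_def C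
          \<rho>(2)[unfolded k_def] \<rho>(3), of y0 x0])
      (use \<rho>(4) in \<open>simp_all add: L(2)\<close>)
qed

theorem theorem1p5:
  fixes s lam Lam :: real
  assumes "1/2 \<le> s" "s < 1" "0 < lam" "lam \<le> Lam"
  shows
    "(\<forall>(I :: 'a::euclidean_space operator) q m u M \<gamma>.
        translation_invariant s I \<and> pos_homogeneous s I \<and> elliptic s (kernels s lam Lam) I \<and>
        0 \<le> q \<and> 0 \<le> m \<and> 1 < q + m \<and>
        (\<forall>x. 0 \<le> u x) \<and>
        visc_solution s I (\<lambda>x r p. rpow r q * rpow (norm p) m) UNIV u \<and>
        \<gamma> < 1 \<and> (\<forall>x. \<bar>u x\<bar> \<le> M * (1 + norm x) powr \<gamma>)
        \<longrightarrow> u constant_on UNIV)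
     \<and>
     (\<forall>(I :: 'a operator) m.
        1/2 < s \<and> 1 < m \<and>
        translation_invariant s I \<and> pos_homogeneous s I \<and> elliptic s (kernels_sym s lam Lam) I
        \<longrightarrow> \<not> (\<exists>u. (\<forall>x. 0 \<le> u x) \<and>
               visc_solution s I (\<lambda>x r p. rpow (norm p) m) UNIV u \<and>
               \<not> u constant_on UNIV \<and>
               (\<exists>M \<gamma>. \<gamma> < 2 * s \<and> (\<forall>x. \<bar>u x\<bar> \<le> M * (1 + norm x) powr \<gamma>) \<and>
                  0 < Limsup at_infinity (\<lambda>x. ereal (\<bar>u x\<bar> / norm x powr \<gamma>)))))"
proof (intro conjI allI impI notI; elim exE conjE)
  fix I :: "'a operator" and q m u M \<gamma>
  assume "translation_invariant s I" "pos_homogeneous s I" "elliptic s (kernels s lam Lam) I"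
    "0 \<le> q" "0 \<le> m" "1 < q + m" "\<forall>x. 0 \<le> u x"
    "visc_solution s I (\<lambda>x r p. rpow r q * rpow (norm p) m) UNIV u"
    "\<gamma> < 1" "\<forall>x. \<bar>u x\<bar> \<le> M * (1 + norm x) powr \<gamma>"
  then show "u constant_on UNIV"
    by (intro liouville_sublinear[OF assms]) auto
next
  fix I :: "'a operator" and m u M \<gamma>
  assume m: "1 < m" and I: "translation_invariant s I" "pos_homogeneous s I" "elliptic s (kernels_sym s lam Lam) I"
    and u: "\<forall>x. 0 \<le> u x" "visc_solution s I (\<lambda>x r p. rpow (norm p) m) UNIV u" "\<not> u constant_on UNIV"
    and \<gamma>: "\<gamma> < 2 * s" and growth: "\<forall>x. \<bar>u x\<bar> \<le> M * (1 + norm x) powr \<gamma>"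
    and limsup: "0 < Limsup at_infinity (\<lambda>x. ereal (\<bar>u x\<bar> / norm x powr \<gamma>))"
  show False
  \<comment> \<open>Below the first power the symmetric class is used as a part of the full class.
    From 1 up to 2s the decay relative to |x|^\<gamma> contradicts the positive upper limit.\<close>
  proof (cases "\<gamma> < 1")
    case True
    have ell: "elliptic s (kernels s lam Lam) I"
      by (rule elliptic_mono[OF I(3)]) (auto simp: kernels_sym_def)
    \<comment> \<open>With the convention 0^0 = 1 the factor with q = 0 is 1 also where
      \<open>u\<close> vanishes, so the two Hamiltonians agree everywhere.\<close>
    have "(\<lambda>(x::'a) r p. rpow r 0 * rpow (norm (p::'a)) m) = (\<lambda>x r p. rpow (norm p) m)"
      by (simp add: rpow_def)
    then have "u constant_on UNIV"
      using liouville_sublinear[OF assms I(1,2) ell, where q = 0 and m = m and u = u and \<gamma> = \<gamma> and M = M] m u True growth by simp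
    then show False using u(3) by simp
  next
    case False
    have "Limsup at_infinity (\<lambda>x. ereal (\<bar>u x\<bar> / norm x powr \<gamma>)) \<le> 0"
    proof (rule Limsup_le_zero_of_little_o)
      fix \<eta> :: real assume "0 < \<eta>"
      moreover have "u x \<le> M * (1 + norm x) powr \<gamma>" for x using growth abs_le_D1 by blast
      ultimately show "\<forall>\<^sub>F x in at_infinity. u x \<le> \<eta> * norm x powr \<gamma>"
        using u False \<gamma> assms
        by (intro sym_solution_little_o[OF assms m I(2,3) _ u(2)]) auto
    qed (use u in auto)
    then show False using limsup by simp
  qed
qed

end
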